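(* Consider the nonlinear second-order cone program $$\min_{x\in\mathbb{R}^n} f(x)\quad\text{s.t.}\quad h(x)=0,\quad g^j(x)\in Q_j,\ j=1,\dots,J,$$ where $f:\mathbb{R}^n\to\mathbb{R}$, $h:\mathbb{R}^n\to\mathbb{R}^m$, $g^j:\mathbb{R}^n\to\mathbb{R}^{1+r_j}$ are twice continuously differentiable and $Q_j\subseteq\mathbb{R}^{1+r_j}$ ($r_j\ge 0$) is the second-order cone. Let $x^*$ be a locally optimal solution and let $y^*=(\lambda^*,\mu^* )$ be a corresponding multiplier, i.e. $(x^*,y^* )\in S_{\rm KKT}(0,0)$. Then the following two statements are equivalent: (1) the solution mapping $S_{\rm KKT}$ of the canonically perturbed KKT system has the Aubin property at $(0,0)$ for $(x^*,y^* )$; (2) $(x^*,y^* )$ is a strongly regular solution of the KKT system (written as a generalized equation).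
   Context: For $r\ge1$, a vector $y\in\mathbb{R}^{1+r}$ is written $y=(\dot y;\bar y)$ with $\dot y\in\mathbb{R}$ its first component and $\bar y\in\mathbb{R}^r$ the rest; $Q_j=\{y\in\mathbb{R}^{1+r_j}:\dot y\ge\|\bar y\|\}$, and $Q_j=[0,+\infty)$ if $r_j=0$. Put $\mathcal{Y}=\mathbb{R}^m\times\prod_{j=1}^J\mathbb{R}^{1+r_j}$, $G=(h,g^1,\dots,g^J):\mathbb{R}^n\to\mathcal{Y}$, $K=\{0\}\times\prod_j Q_j$, with dual cone $K^*=\mathbb{R}^m\times\prod_j Q_j$. For $y=(\lambda,\mu)\in\mathcal{Y}$ the Lagrangian is $L(x,y)=f(x)-\langle y,G(x)\rangle$. $\mathcal{J}G(x)$ is the Jacobian and $\nabla G(x)$ its transpose. $N_C$ is the normal cone mapping of convex analysis of a closed convex set $C$ (empty outside $C$). For $(a,b)\in\mathbb{R}^n\times\mathcal{Y}$, $$S_{\rm KKT}(a,b)=\{(x,y): a=\nabla_xL(x,y),\ b\in G(x)+N_{K^*}(y)\}.$$ Aubin property of $S_{\rm KKT}$ at $(0,0)$ for $(x^*,y^* )$: there exist $\kappa>0$ and open neighborhoods $U$ of $(0,0)$ and $V$ of $(x^*,y^* )$ such that $S_{\rm KKT}(a',b')\cap V\subseteq S_{\rm KKT}(a,b)+\kappa\|(a',b')-(a,b)\|\mathbb{B}$ for all $(a,b),(a',b')\in U$, where $\mathbb{B}$ is the closed unit ball of $\mathbb{R}^n\times\mathcal{Y}$. Strong regularity (Robinson):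 the KKT system without perturbation is the generalized equation $0\in(\nabla_xL(x,y);\,G(x))+\{0\}\times N_{K^*}(y)$. Its solution $(x^*,y^* )$ is strongly regular if there exist neighborhoods $U$ of $(0,0)\in\mathbb{R}^n\times\mathcal{Y}$ and $V$ of $(x^*,y^* )$ such that for every $(a,b)\in U$ the linearized generalized equation $$a=\nabla_xL(x^*,y^* )+\nabla^2_{xx}L(x^*,y^* )(x-x^* )-\nabla G(x^* )(y-y^* ),\qquad b\in G(x^* )+\mathcal{J}G(x^* )(x-x^* )+N_{K^*}(y)$$ has a unique solution $(x,y)$ in $V$, denoted $q_V(a,b)$, and the mapping $q_V:U\to V$ is locally Lipschitz continuous. *)

theory Defs
  imports "HOL-Analysis.Analysis"
begin

section \<open>Convex and variational analysis\<close>

definition dual_cone :: "'a::real_inner set \<Rightarrow> 'a set" where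
  "dual_cone K = {v. \<forall>y\<in>K. 0 \<le> v \<bullet> y}"

definition normal_cone :: "'a::real_inner set \<Rightarrow> 'a \<Rightarrow> 'a set" where
  "normal_cone C y = (if y \<in> C then {v. \<forall>z\<in>C. v \<bullet> (z - y) \<le> 0} else {})"

definition twice_cont_differentiable ::
    "('a::real_normed_vector \<Rightarrow> 'b::real_normed_vector) \<Rightarrow> bool" where
  "twice_cont_differentiable f \<longleftrightarrow>
     (\<exists>(f' :: 'a \<Rightarrow> 'a \<Rightarrow>\<^sub>L 'b) (f'' :: 'a \<Rightarrow> 'a \<Rightarrow>\<^sub>L 'a \<Rightarrow>\<^sub>L 'b).
        (\<forall>x. (f has_derivative blinfun_apply (f' x)) (at x)) \<and>
        (\<forall>x. (f' has_derivative blinfun_apply (f'' x)) (at x)) \<and>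
        continuous_on UNIV f'')"

text \<open>
  The gradient and the Hessian matrix are meaningful only where the function is (twice)
  differentiable.
\<close>

definition grad :: "('a::real_inner \<Rightarrow> real) \<Rightarrow> 'a \<Rightarrow> 'a" where
  "grad f x = (THE D. GDERIV f x :> D)"

definition hessian :: "(real ^ 'n \<Rightarrow> real) \<Rightarrow> real ^ 'n \<Rightarrow> real ^ 'n ^ 'n" where
  "hessian f x = jacobian (grad f) (at x)"

definition aubin_property ::
    "('p::real_normed_vector \<Rightarrow> 'q::real_normed_vector set) \<Rightarrow> 'p \<Rightarrow> 'q \<Rightarrow> bool" where
  "aubin_property S p0 q0 \<longleftrightarrow>
     (\<exists>\<kappa>>0. \<exists>U V. open U \<and> p0 \<in> U \<and> open V \<and> q0 \<in> V \<and>
        (\<forall>p\<in>U. \<forall>p'\<in>U.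
           S p' \<inter> V \<subseteq> {s + (\<kappa> * norm (p' - p)) *\<^sub>R u | s u. s \<in> S p \<and> u \<in> cball 0 1}))"

definition locally_lipschitz_on ::
    "'p::metric_space set \<Rightarrow> ('p \<Rightarrow> 'q::metric_space) \<Rightarrow> bool" where
  "locally_lipschitz_on U q \<longleftrightarrow>
     (\<forall>p\<in>U. \<exists>\<epsilon>>0. \<exists>L. L-lipschitz_on (U \<inter> ball p \<epsilon>) q)"

section \<open>KKT systems\<close>

text \<open>
  In this section \<open>C\<close> plays the role of the dual cone of the constraint cone.
\<close>

definition lagrangian ::
    "(real ^ 'n \<Rightarrow> real) \<Rightarrow> (real ^ 'n \<Rightarrow> real ^ 'k) \<Rightarrow> real ^ 'n \<Rightarrow> real ^ 'k \<Rightarrow> real" where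
  "lagrangian f G x y = f x - y \<bullet> G x"

definition S_KKT ::
    "(real ^ 'n \<Rightarrow> real) \<Rightarrow> (real ^ 'n \<Rightarrow> real ^ 'k) \<Rightarrow> (real ^ 'k) set
      \<Rightarrow> (real ^ 'n) \<times> (real ^ 'k) \<Rightarrow> ((real ^ 'n) \<times> (real ^ 'k)) set" where
  "S_KKT f G C = (\<lambda>(a, b).
     {(x, y). a = grad (\<lambda>x. lagrangian f G x y) x \<and>
              b \<in> (+) (G x) ` normal_cone C y})"

definition S_linearized ::
    "(real ^ 'n \<Rightarrow> real) \<Rightarrow> (real ^ 'n \<Rightarrow> real ^ 'k) \<Rightarrow> (real ^ 'k) set
      \<Rightarrow> real ^ 'n \<Rightarrow> real ^ 'k
      \<Rightarrow> (real ^ 'n) \<times> (real ^ 'k) \<Rightarrow> ((real ^ 'n) \<times> (real ^ 'k)) set" where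
  "S_linearized f G C xs ys = (\<lambda>(a, b).
     {(x, y).
        a = grad (\<lambda>x. lagrangian f G x ys) xs
            + hessian (\<lambda>x. lagrangian f G x ys) xs *v (x - xs)
            - transpose (jacobian G (at xs)) *v (y - ys) \<and>
        b \<in> (+) (G xs + jacobian G (at xs) *v (x - xs)) ` normal_cone C y})"

text \<open>
  Neighbourhoods are not required to be open: \<open>U\<close> is a neighbourhood of \<open>p\<close> iff
  \<open>p \<in> interior U\<close>.
\<close>

definition strongly_regular ::
    "(real ^ 'n \<Rightarrow> real) \<Rightarrow> (real ^ 'n \<Rightarrow> real ^ 'k) \<Rightarrow> (real ^ 'k) set
      \<Rightarrow> real ^ 'n \<Rightarrow> real ^ 'k \<Rightarrow> bool" where
  "strongly_regular f G C xs ys \<longleftrightarrow>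
     (\<exists>U V. (0, 0) \<in> interior U \<and> (xs, ys) \<in> interior V \<and>
        (\<forall>p\<in>U. \<exists>!z. z \<in> S_linearized f G C xs ys p \<inter> V) \<and>
        locally_lipschitz_on U (\<lambda>p. THE z. z \<in> S_linearized f G C xs ys p \<inter> V))"

section \<open>Second-order cone programs\<close>

text \<open>
  A vector of $\mathbb{R}^{1+r}$ is given by its coordinates \<open>v 0\<close> (the distinguished first
  one) and \<open>v 1, \<dots>, v r\<close>.  The values \<open>v i\<close> for \<open>i > r\<close> are irrelevant.
\<close>

definition soc :: "nat \<Rightarrow> (nat \<Rightarrow> real) set" where
  "soc r = {v. L2_set v {1..r} \<le> v 0}"

text \<open>
  The space $\mathcal{Y} = \mathbb{R}^m \times \prod_{j=1}^J \mathbb{R}^{1+r_j}$ depends on the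
  numbers \<open>m\<close>, \<open>J\<close>, \<open>r j\<close>.  It is represented by \<open>real ^ 'k\<close>, together with a bijection \<open>lab\<close>
  from \<open>'k\<close> onto the set \<open>coords m J r\<close> of its coordinates.  The norm and the inner product
  of \<open>real ^ 'k\<close> are then those of the product.  Both \<open>m = 0\<close> and \<open>J = 0\<close> are possible, but
  not simultaneously, since \<open>'k\<close> is not empty.
\<close>

datatype coord = Eq nat | Cone nat nat

definition coords :: "nat \<Rightarrow> nat \<Rightarrow> (nat \<Rightarrow> nat) \<Rightarrow> coord set" where
  "coords m J r = {Eq i | i. i \<in> {1..m}} \<union> {Cone j i | j i. j \<in> {1..J} \<and> i \<in> {0..r j}}"

definition eq_part :: "('k::finite \<Rightarrow> coord) \<Rightarrow> real ^ 'k \<Rightarrow> nat \<Rightarrow> real" where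
  "eq_part lab y = (\<lambda>i. y $ inv lab (Eq i))"

definition cone_part :: "('k::finite \<Rightarrow> coord) \<Rightarrow> real ^ 'k \<Rightarrow> nat \<Rightarrow> nat \<Rightarrow> real" where
  "cone_part lab y j = (\<lambda>i. y $ inv lab (Cone j i))"

text \<open>\<open>G = (h, g\<^sup>1, \<dots>, g\<^sup>J)\<close>\<close>

definition constraint_map ::
    "('k::finite \<Rightarrow> coord) \<Rightarrow> ('x \<Rightarrow> nat \<Rightarrow> real) \<Rightarrow> (nat \<Rightarrow> 'x \<Rightarrow> nat \<Rightarrow> real)
      \<Rightarrow> 'x \<Rightarrow> real ^ 'k" where
  "constraint_map lab h g x =
     (\<chi> k. case lab k of Eq i \<Rightarrow> h x i | Cone j i \<Rightarrow> g j x i)"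

definition constraint_cone ::
    "nat \<Rightarrow> nat \<Rightarrow> (nat \<Rightarrow> nat) \<Rightarrow> ('k::finite \<Rightarrow> coord) \<Rightarrow> (real ^ 'k) set" where
  "constraint_cone m J r lab =
     {y. (\<forall>i\<in>{1..m}. eq_part lab y i = 0) \<and> (\<forall>j\<in>{1..J}. cone_part lab y j \<in> soc (r j))}"

definition socp_feasible ::
    "nat \<Rightarrow> nat \<Rightarrow> (nat \<Rightarrow> nat) \<Rightarrow> ('x \<Rightarrow> nat \<Rightarrow> real) \<Rightarrow> (nat \<Rightarrow> 'x \<Rightarrow> nat \<Rightarrow> real) \<Rightarrow> 'x set" where
  "socp_feasible m J r h g =
     {x. (\<forall>i\<in>{1..m}. h x i = 0) \<and> (\<forall>j\<in>{1..J}. g j x \<in> soc (r j))}"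

definition local_minimizer :: "('a::metric_space \<Rightarrow> real) \<Rightarrow> 'a set \<Rightarrow> 'a \<Rightarrow> bool" where
  "local_minimizer f F xs \<longleftrightarrow> xs \<in> F \<and> (\<exists>\<epsilon>>0. \<forall>x \<in> F \<inter> ball xs \<epsilon>. f xs \<le> f x)"

section \<open>Consistency of the coordinate representation\<close>

lemma
  assumes "bij_betw lab UNIV (coords m J r)"
  shows eq_part_constraint_map:
      "i \<in> {1..m} \<Longrightarrow> eq_part lab (constraint_map lab h g x) i = h x i"
    and cone_part_constraint_map:
      "j \<in> {1..J} \<Longrightarrow> i \<in> {0..r j} \<Longrightarrow> cone_part lab (constraint_map lab h g x) j i = g j x i"
proof -
  have lab_inv: "lab (inv lab c) = c" if "c \<in> coords m J r" for c
    using assms that by (metis bij_betw_imp_surj_on f_inv_into_f)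
  show "i \<in> {1..m} \<Longrightarrow> eq_part lab (constraint_map lab h g x) i = h x i"
    by (simp add: eq_part_def constraint_map_def lab_inv coords_def)
  show "j \<in> {1..J} \<Longrightarrow> i \<in> {0..r j} \<Longrightarrow> cone_part lab (constraint_map lab h g x) j i = g j x i"
    by (simp add: cone_part_def constraint_map_def lab_inv coords_def)
qed

lemma soc_cong:
  assumes "\<And>i. i \<in> {0..r} \<Longrightarrow> v i = w i"
  shows "v \<in> soc r \<longleftrightarrow> w \<in> soc r"
proof -
  have "L2_set v {1..r} = L2_set w {1..r}"
    using assms by (intro L2_set_cong) auto
  then show ?thesis using assms[of 0] by (simp add: soc_def)
qed

lemma socp_feasible_iff:
  assumes "bij_betw lab UNIV (coords m J r)"
  shows "x \<in> socp_feasible m J r h g \<longleftrightarrow> constraint_map lab h g x \<in> constraint_cone m J r lab"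
proof -
  have "cone_part lab (constraint_map lab h g x) j \<in> soc (r j) \<longleftrightarrow> g j x \<in> soc (r j)"
    if "j \<in> {1..J}" for j
    using that by (intro soc_cong cone_part_constraint_map[OF assms])
  then show ?thesis
    by (simp add: socp_feasible_def constraint_cone_def eq_part_constraint_map[OF assms])
qed

lemma inner_coords:
  fixes u v :: "real ^ 'k::finite"
  assumes "bij_betw lab UNIV (coords m J r)"
  shows "u \<bullet> v = (\<Sum>i\<in>{1..m}. eq_part lab u i * eq_part lab v i)
     + (\<Sum>j\<in>{1..J}. \<Sum>i\<in>{0..r j}. cone_part lab u j i * cone_part lab v j i)"
proof -
  let ?t = "\<lambda>c. u $ inv lab c * v $ inv lab c"
  have inj: "inj lab" using assms by (simp add: bij_betw_def)
  let ?A = "Eq ` {1..m}" and ?B = "(\<lambda>(j, i). Cone j i) ` (SIGMA j:{1..J}. {0..r j})"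
  have C: "coords m J r = ?A \<union> ?B" by (auto simp: coords_def image_iff)
  have "u \<bullet> v = (\<Sum>k\<in>UNIV. ?t (lab k))"
    using inj by (simp add: inner_vec_def)
  also have "\<dots> = sum ?t (coords m J r)"
    using sum.reindex_bij_betw[OF assms, of ?t] by simp
  also have "\<dots> = sum ?t ?A + sum ?t ?B"
    unfolding C by (intro sum.union_disjoint) auto
  also have "sum ?t ?A = (\<Sum>i\<in>{1..m}. eq_part lab u i * eq_part lab v i)"
    by (subst sum.reindex) (auto simp: inj_on_def eq_part_def)
  also have "sum ?t ?B = (\<Sum>(j, i)\<in>(SIGMA j:{1..J}. {0..r j}). cone_part lab u j i * cone_part lab v j i)"
    by (subst sum.reindex) (auto simp: inj_on_def cone_part_def case_prod_unfold)
  also have "\<dots> = (\<Sum>j\<in>{1..J}. \<Sum>i\<in>{0..r j}. cone_part lab u j i * cone_part lab v j i)"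
    by (rule sum.Sigma[symmetric]) auto
  finally show ?thesis .
qed

lemma soc_self_dual_ineq:
  assumes "v \<in> soc r" "w \<in> soc r"
  shows "0 \<le> (\<Sum>i\<in>{0..r}. v i * w i)"
proof -
  have "\<bar>\<Sum>i\<in>{1..r}. v i * w i\<bar> \<le> (\<Sum>i\<in>{1..r}. \<bar>v i\<bar> * \<bar>w i\<bar>)"
    using sum_abs[of "\<lambda>i. v i * w i" "{1..r}"] by (simp add: abs_mult)
  also have "\<dots> \<le> L2_set v {1..r} * L2_set w {1..r}" by (rule L2_set_mult_ineq)
  also have "\<dots> \<le> v 0 * w 0"
    using assms L2_set_nonneg[of v "{1..r}"] L2_set_nonneg[of w "{1..r}"]
    by (intro mult_mono) (auto simp: soc_def simp del: L2_set_nonneg)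
  finally show ?thesis
    by (simp add: sum.atLeast_Suc_atMost)
qed

lemma dual_constraint_cone:
  fixes lab :: "'k::finite \<Rightarrow> coord"
  assumes bij: "bij_betw lab UNIV (coords m J r)"
  shows "dual_cone (constraint_cone m J r lab) =
    {y. \<forall>j\<in>{1..J}. cone_part lab y j \<in> soc (r j)}"
proof (intro equalityI subsetI)
  fix v assume "v \<in> {y. \<forall>j\<in>{1..J}. cone_part lab y j \<in> soc (r j)}"
  then have v: "cone_part lab v j \<in> soc (r j)" if "j \<in> {1..J}" for j using that by blast
  have "0 \<le> v \<bullet> y" if y: "y \<in> constraint_cone m J r lab" for y
  proof -
    have "(\<Sum>i\<in>{1..m}. eq_part lab v i * eq_part lab y i) = 0"
      using y by (simp add: constraint_cone_def)
    moreover have "0 \<le> (\<Sum>j\<in>{1..J}. \<Sum>i\<in>{0..r j}. cone_part lab v j i * cone_part lab y j i)"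
    proof (rule sum_nonneg)
      fix j assume j: "j \<in> {1..J}"
      then have "cone_part lab y j \<in> soc (r j)" using y unfolding constraint_cone_def by blast
      then show "0 \<le> (\<Sum>i\<in>{0..r j}. cone_part lab v j i * cone_part lab y j i)"
        using soc_self_dual_ineq[OF v[OF j]] by blast
    qed
    ultimately show ?thesis unfolding inner_coords[OF bij] by linarith
  qed
  then show "v \<in> dual_cone (constraint_cone m J r lab)" by (simp add: dual_cone_def)
next
  fix v assume v: "v \<in> dual_cone (constraint_cone m J r lab)"
  have "cone_part lab v j \<in> soc (r j)" if j: "j \<in> {1..J}" for j
  proof -
    define c where "c = cone_part lab v j"
    define N where "N = L2_set c {1..r j}"
    define w where "w = (\<lambda>i::nat. if i = 0 then N else - c i)"
    define w' where "w' = (if N = 0 then (\<lambda>i::nat. if i = 0 then 1 else 0) else w)"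
    define y :: "real ^ 'k" where
      "y = constraint_map lab (\<lambda>_ _. 0) (\<lambda>j' _. if j' = j then w' else (\<lambda>_. 0)) ()"
    have N2: "(\<Sum>i\<in>{1..r j}. c i * c i) = N * N"
    proof -
      have "N * N = (\<Sum>i\<in>{1..r j}. (c i)\<^sup>2)"
        unfolding N_def L2_set_def by (simp add: sum_nonneg)
      then show ?thesis by (simp only: power2_eq_square)
    qed
    have N0: "0 \<le> N" by (simp add: N_def)
    have "w \<in> soc (r j)"
    proof -
      have "L2_set w {1..r j} = N"
        unfolding N_def L2_set_def
        by (intro arg_cong[where f = sqrt] sum.cong) (auto simp: w_def)
      then show ?thesis by (simp add: soc_def w_def)
    qed
    moreover have "(\<lambda>i::nat. if i = 0 then 1 else 0) \<in> soc (r j)"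
      by (simp add: soc_def L2_set_def)
    ultimately have w': "w' \<in> soc (r j)"
      unfolding w'_def by (cases "N = 0") (simp_all only: if_True if_False simp_thms)
    have zero: "(\<lambda>_. 0) \<in> soc (r j')" for j'
      by (simp add: soc_def L2_set_def)
    have "() \<in> socp_feasible m J r (\<lambda>_ _. 0) (\<lambda>j' _. if j' = j then w' else (\<lambda>_. 0))"
      using w' zero by (simp add: socp_feasible_def)
    then have "y \<in> constraint_cone m J r lab"
      unfolding y_def by (simp only: socp_feasible_iff[OF bij])
    then have "0 \<le> v \<bullet> y" using v by (simp add: dual_cone_def)
    also have "v \<bullet> y = (\<Sum>j'\<in>{1..J}. \<Sum>i\<in>{0..r j'}. cone_part lab v j' i * cone_part lab y j' i)"
    proof -
      have "eq_part lab y i = 0" if "i \<in> {1..m}" for i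
        unfolding y_def by (rule eq_part_constraint_map[OF bij that])
      then show ?thesis unfolding inner_coords[OF bij] by simp
    qed
    also have "\<dots> = (\<Sum>j'\<in>{1..J}. if j' = j then (\<Sum>i\<in>{0..r j}. c i * w' i) else 0)"
    proof (rule sum.cong)
      fix j' assume j': "j' \<in> {1..J}"
      have "cone_part lab y j' i = (if j' = j then w' else (\<lambda>_. 0)) i" if "i \<in> {0..r j'}" for i
        unfolding y_def by (rule cone_part_constraint_map[OF bij j' that])
      then have "(\<Sum>i\<in>{0..r j'}. cone_part lab v j' i * cone_part lab y j' i)
          = (\<Sum>i\<in>{0..r j'}. cone_part lab v j' i * (if j' = j then w' else (\<lambda>_. 0)) i)"
        by (intro sum.cong) auto
      then show "(\<Sum>i\<in>{0..r j'}. cone_part lab v j' i * cone_part lab y j' i)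
          = (if j' = j then (\<Sum>i\<in>{0..r j}. c i * w' i) else 0)"
        by (cases "j' = j") (simp_all add: c_def)
    qed simp
    also have "\<dots> = (\<Sum>i\<in>{0..r j}. c i * w' i)" using j by simp
    also have "\<dots> = c 0 * w' 0 + (\<Sum>i\<in>{1..r j}. c i * w' i)"
      by (simp add: sum.atLeast_Suc_atMost)
    finally have ge: "0 \<le> c 0 * w' 0 + (\<Sum>i\<in>{1..r j}. c i * w' i)" .
    have "N \<le> c 0"
    proof (cases "N = 0")
      case True
      then have "(\<Sum>i\<in>{1..r j}. c i * w' i) = 0"
        by (intro sum.neutral) (auto simp: w'_def)
      with ge True show ?thesis by (simp add: w'_def)
    next
      case False
      have "(\<Sum>i\<in>{1..r j}. c i * w' i) = - (\<Sum>i\<in>{1..r j}. c i * c i)"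
        using False by (simp add: w'_def w_def flip: sum_negf)
      with ge N2 False have "0 \<le> (c 0 - N) * N" by (simp add: w'_def w_def algebra_simps)
      with False N0 show ?thesis by (simp add: zero_le_mult_iff)
    qed
    then show ?thesis by (simp add: soc_def c_def N_def)
  qed
  then show "v \<in> {y. \<forall>j\<in>{1..J}. cone_part lab y j \<in> soc (r j)}" by blast
qed

end

theory Submission
  imports Defs
begin

text \<open>
  A pair \<open>(y, g)\<close> of complementary vectors is kept in place of \<open>b \<in> G x + N y\<close>. Applying the Aubin
  property at the base points \<open>(ys + \<epsilon> p, gs + \<epsilon> q)\<close> with right-hand sides varying by \<open>\<epsilon>\<^sup>2\<close> and
  letting \<open>\<epsilon> \<rightarrow> 0\<close> shows that the linearized system is solvable for every right-hand side when the
  complementarity relation is replaced by any of its generic tangent relations. Solvability with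
  respect to one of them gives constraint nondegeneracy. For the strong second-order condition one starts
  with the smallest subspace, where local optimality gives a nonnegative and solvability a positive
  definite form, and enlarges the subspace one block at a time: each time the rank of the tangent relation
  jumps, solvability of a one-dimensional complementarity problem rules out directions of nonpositive
  curvature. A block with vanishing constraint and multiplier is reached through the pairs
  \<open>(u, \<kappa> Ru)\<close>, where \<open>u\<close> lies on the boundary of the cone and \<open>R\<close> is the reflection in its axis, by
  letting \<open>\<kappa>\<close> run from \<open>0\<close> to infinity. Nondegeneracy and the strong second-order condition make the
  Minty map of the linearized system bi-Lipschitz onto its image, which is open by invariance of domain;
  this is strong regularity. Conversely, strong regularity yields the Aubin property by a contraction
  argument.
\<close>

section \<open>Complementary pairs in a second-order cone\<close>

text \<open>At \<open>(ys, gs)\<close> itself the tangent relation of the complementarity condition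
  is in general not linear, so it offers no quadratic form to test. Base points shifted by order
  \<epsilon> under increments of order \<epsilon>^2 select one linear piece of it, or the passage
  between two pieces. In each block the smallest piece is the lineality space of the tangent cone at
  the constraint value, the largest the span of the critical cone; nondegeneracy concerns the first,
  the strong second-order condition the second. The form is the Hessian of the Lagrangian corrected
  by the curvature of the cone boundaries. Local optimality speaks only of feasible points, so the
  initial pieces are realised by shifting the multiplier alone; the later ones get their sign from
  solvability. Since \<open>definite_jump\<close> adds one dimension at a time, a block with
  vanishing constraint value and multiplier cannot go from {0} to the whole space at once. It passes
  through a line and a hyperplane containing it. The gap between these two is bridged by the
  boundary curvature, which acts as a penalty that vanishes on the line only and is lowered to
  zero.\<close>

definition rfl :: "'b::real_inner \<Rightarrow> 'b \<Rightarrow> 'b" where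
  "rfl e y = (2 * (y \<bullet> e)) *\<^sub>R e - y"

text \<open>The second inequality is the Lorentz form: \<open>y \<bullet> rfl e y\<close> is the
  square of the head minus the squared norm of the tail (\<open>qcone_tail\<close>). Membership is
  thus given by polynomials, which allow polarisation and limits. The cone lives in the whole space;
  on the subspace of a block with axis \<open>e\<close> it is the second-order cone of that
  block.\<close>

definition qcone :: "'b::real_inner \<Rightarrow> 'b set" where
  "qcone e = {y. 0 \<le> y \<bullet> e \<and> 0 \<le> y \<bullet> rfl e y}"

definition soc_pair :: "'b::real_inner \<Rightarrow> 'b \<Rightarrow> 'b \<Rightarrow> bool" where
  "soc_pair e y g \<longleftrightarrow> y \<in> qcone e \<and> g \<in> qcone e \<and> y \<bullet> g = 0"

lemma rfl_linear: "linear (rfl e)"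
  by (auto simp: linear_iff rfl_def inner_simps algebra_simps)

lemma rfl_add: "rfl e (x + y) = rfl e x + rfl e y"
  and rfl_diff: "rfl e (x - y) = rfl e x - rfl e y"
  and rfl_scaleR: "rfl e (c *\<^sub>R x) = c *\<^sub>R rfl e x"
  and rfl_zero [simp]: "rfl e 0 = 0"
  and rfl_minus: "rfl e (- x) = - rfl e x"
  by (simp_all add: rfl_def inner_simps algebra_simps)

lemma tendsto_rfl [tendsto_intros]:
  "(f \<longlongrightarrow> a) F \<Longrightarrow> ((\<lambda>x. rfl e (f x)) \<longlongrightarrow> rfl e a) F"
  unfolding rfl_def by (intro tendsto_intros)

lemma rfl_inner_commute: "rfl e x \<bullet> y = x \<bullet> rfl e y"
  by (simp add: rfl_def inner_simps inner_commute)

context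
  fixes e :: "'b::real_inner"
  assumes e: "norm e = 1"
begin

lemma inner_unit: "e \<bullet> e = 1"
  using e by (simp add: norm_eq_1)

lemma rfl_rfl [simp]: "rfl e (rfl e x) = x"
  by (simp add: rfl_def inner_simps inner_unit algebra_simps)

lemma rfl_inner_unit [simp]: "rfl e x \<bullet> e = x \<bullet> e"
  by (simp add: rfl_def inner_simps inner_unit)

lemma rfl_unit [simp]: "rfl e e = e"
  by (simp add: rfl_def inner_unit scaleR_2)

lemma rfl_inner_rfl: "rfl e x \<bullet> rfl e y = x \<bullet> y"
  by (simp add: rfl_inner_commute)

lemma rfl_in_qcone [simp]: "rfl e x \<in> qcone e \<longleftrightarrow> x \<in> qcone e"
  by (simp add: qcone_def rfl_inner_commute)

lemma unit_in_qcone: "e \<in> qcone e"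
  by (simp add: qcone_def inner_unit)

lemma qcone_tail:
  "y \<bullet> rfl e y = (y \<bullet> e)\<^sup>2 - (norm (y - (y \<bullet> e) *\<^sub>R e))\<^sup>2"
  unfolding power2_norm_eq_inner
  by (simp add: rfl_def inner_simps inner_unit inner_commute power2_eq_square algebra_simps)

lemma qcone_iff: "y \<in> qcone e \<longleftrightarrow> norm (y - (y \<bullet> e) *\<^sub>R e) \<le> y \<bullet> e"
proof -
  have "0 \<le> y \<bullet> rfl e y \<longleftrightarrow> norm (y - (y \<bullet> e) *\<^sub>R e) \<le> y \<bullet> e" if "0 \<le> y \<bullet> e"
    unfolding qcone_tail using that abs_le_square_iff[of "norm (y - (y \<bullet> e) *\<^sub>R e)" "y \<bullet> e"] by simp
  then show ?thesis
    unfolding qcone_def using norm_ge_zero order_trans by blast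
qed

lemma qcone_inner_split:
  "y \<bullet> g = (y \<bullet> e) * (g \<bullet> e) + (y - (y \<bullet> e) *\<^sub>R e) \<bullet> (g - (g \<bullet> e) *\<^sub>R e)"
  by (simp add: inner_simps inner_unit inner_commute algebra_simps)

lemma qcone_inner_nonneg:
  assumes "y \<in> qcone e" "g \<in> qcone e"
  shows "0 \<le> y \<bullet> g"
proof -
  let ?y = "y - (y \<bullet> e) *\<^sub>R e" and ?g = "g - (g \<bullet> e) *\<^sub>R e"
  have "\<bar>?y \<bullet> ?g\<bar> \<le> norm ?y * norm ?g" by (rule Cauchy_Schwarz_ineq2)
  also have "\<dots> \<le> (y \<bullet> e) * (g \<bullet> e)"
    using assms unfolding qcone_iff by (intro mult_mono) (auto intro: order_trans[OF norm_ge_zero])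
  finally show ?thesis unfolding qcone_inner_split[of y g] by linarith
qed

lemma qcone_head_pos: "y \<in> qcone e \<Longrightarrow> y \<noteq> 0 \<Longrightarrow> 0 < y \<bullet> e"
  unfolding qcone_iff by (cases "y \<bullet> e = 0") (auto intro: order_trans[OF norm_ge_zero] simp: less_le)

text \<open>Orthogonality forces equality in the Cauchy-Schwarz estimate of the tails: with heads
  \<open>a\<close> and \<open>b\<close>, the vector \<open>a *\<^sub>R ?g + b *\<^sub>R ?y\<close>
  has norm at most zero. Hence \<open>g\<close> lies on the ray of the reflection of
  \<open>y\<close>.\<close>

lemma soc_pair_eq:
  assumes "soc_pair e y g" "y \<noteq> 0"
  shows "g = ((g \<bullet> e) / (y \<bullet> e)) *\<^sub>R rfl e y"
proof -
  define a b where "a = y \<bullet> e" and "b = g \<bullet> e"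
  let ?y = "y - a *\<^sub>R e" and ?g = "g - b *\<^sub>R e"
  have a: "0 < a" and b: "0 \<le> b"
    using assms qcone_head_pos[of y] by (auto simp: soc_pair_def qcone_def a_def b_def)
  have yy: "?y \<bullet> ?y \<le> a * a" and gg: "?g \<bullet> ?g \<le> b * b"
    using assms a b power_mono[of "norm ?y" a 2] power_mono[of "norm ?g" b 2]
    unfolding soc_pair_def qcone_iff a_def b_def power2_norm_eq_inner power2_eq_square[symmetric]
    by auto
  have yg: "?y \<bullet> ?g = - (a * b)"
    using assms qcone_inner_split[of y g] by (simp add: soc_pair_def a_def b_def)
  have "(a *\<^sub>R ?g + b *\<^sub>R ?y) \<bullet> (a *\<^sub>R ?g + b *\<^sub>R ?y)
      = a * a * (?g \<bullet> ?g) + 2 * (a * b) * (?y \<bullet> ?g) + b * b * (?y \<bullet> ?y)"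
    unfolding inner_add_left inner_add_right inner_scaleR_left inner_scaleR_right
    by (simp only: inner_commute[of ?g ?y]) (simp add: algebra_simps)
  also have "\<dots> \<le> a * a * (b * b) - 2 * (a * b) * (a * b) + b * b * (a * a)"
    unfolding yg using mult_left_mono[OF gg, of "a * a"] mult_left_mono[OF yy, of "b * b"]
    zero_le_square[of a] zero_le_square[of b] by linarith
  also have "\<dots> = 0" by simp
  finally have "a *\<^sub>R ?g + b *\<^sub>R ?y = 0" by (metis inner_eq_zero_iff inner_ge_zero order_antisym)
  then have "a *\<^sub>R g = b *\<^sub>R rfl e y"
    by (simp add: rfl_def a_def[symmetric] algebra_simps flip: scaleR_left.add)
  then have "g = (b / a) *\<^sub>R rfl e y"
    using a by (metis divide_inverse_commute less_numeral_extra(3) real_vector_eq_affinity scaleR_scaleR vector_fraction_eq_iff eq_vector_fraction_iff)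
  then show ?thesis by (simp add: a_def b_def)
qed

lemma soc_pair_commute: "soc_pair e y g \<longleftrightarrow> soc_pair e g y"
  by (auto simp: soc_pair_def inner_commute)

text \<open>For \<open>y \<noteq> 0\<close>, \<open>g\<close> is a positive multiple of R y, so
  orthogonality of \<open>y\<close> and \<open>g\<close> is the vanishing of the Lorentz form at
  \<open>y\<close>.\<close>

lemma soc_pair_boundary:
  assumes "soc_pair e y g" "g \<noteq> 0"
  shows "y \<bullet> rfl e y = 0"
proof (cases "y = 0")
  case False
  have "0 < g \<bullet> e" "0 < y \<bullet> e"
    using assms False qcone_head_pos by (auto simp: soc_pair_def)
  moreover have "((g \<bullet> e) / (y \<bullet> e)) * (y \<bullet> rfl e y) = 0"
    using soc_pair_eq[OF assms(1) False] assms(1)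
    by (metis inner_scaleR_right soc_pair_def)
  ultimately show ?thesis by simp
qed simp

lemma soc_pair_interior: "soc_pair e y g \<Longrightarrow> 0 < y \<bullet> rfl e y \<Longrightarrow> g = 0"
  using soc_pair_boundary by fastforce

lemma soc_pair_zero [simp]: "soc_pair e y 0 \<longleftrightarrow> y \<in> qcone e" "soc_pair e 0 y \<longleftrightarrow> y \<in> qcone e"
  by (auto simp: soc_pair_def qcone_def)

lemma soc_pair_rfl:
  assumes "y \<in> qcone e" "y \<bullet> rfl e y = 0" "0 \<le> \<kappa>"
  shows "soc_pair e y (\<kappa> *\<^sub>R rfl e y)"
  using assms by (simp add: soc_pair_def qcone_def rfl_inner_commute rfl_scaleR)

lemma soc_pair_scaleR: "soc_pair e y g \<Longrightarrow> 0 \<le> c \<Longrightarrow> soc_pair e (c *\<^sub>R y) (c *\<^sub>R g)"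
  by (simp add: soc_pair_def qcone_def rfl_scaleR)

text \<open>The sign is reversed because it is \<open>- g\<close>, not \<open>g\<close>, that is
  normal to the cone at \<open>y\<close>.\<close>

lemma soc_pair_monotone:
  assumes "soc_pair e y g" "soc_pair e y' g'"
  shows "(y' - y) \<bullet> (g' - g) \<le> 0"
  using assms qcone_inner_nonneg[of y g'] qcone_inner_nonneg[of y' g]
  by (simp add: soc_pair_def inner_simps)

lemma qcone_add: "y \<in> qcone e \<Longrightarrow> z \<in> qcone e \<Longrightarrow> y + z \<in> qcone e"
  unfolding qcone_iff
  using norm_triangle_ineq[of "y - (y \<bullet> e) *\<^sub>R e" "z - (z \<bullet> e) *\<^sub>R e"]
  by (simp add: inner_simps algebra_simps)

lemma qcone_scaleR: "y \<in> qcone e \<Longrightarrow> 0 \<le> c \<Longrightarrow> c *\<^sub>R y \<in> qcone e"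
  by (simp add: qcone_def rfl_scaleR)

lemma closed_qcone: "closed (qcone e)"
  unfolding qcone_def rfl_def
  by (intro closed_Collect_conj closed_Collect_le continuous_intros)

section \<open>Difference quotients of complementary pairs\<close>

text \<open>Both pairs of a quotient may vary: the base pair moves in the shifted families, and
  uniqueness later compares two arbitrary nearby solutions.\<close>

context
  fixes y g dy dg :: 'b and y1 y2 g1 g2 :: "nat \<Rightarrow> 'b" and t :: "nat \<Rightarrow> real"
  assumes t: "\<And>k. 0 < t k"
    and y1: "y1 \<longlonglongrightarrow> y" and g1: "g1 \<longlonglongrightarrow> g" and y2: "y2 \<longlonglongrightarrow> y" and g2: "g2 \<longlonglongrightarrow> g"
    and dy: "(\<lambda>k. (1 / t k) *\<^sub>R (y2 k - y1 k)) \<longlonglongrightarrow> dy"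
    and dg: "(\<lambda>k. (1 / t k) *\<^sub>R (g2 k - g1 k)) \<longlonglongrightarrow> dg"
    and p1: "\<And>k. soc_pair e (y1 k) (g1 k)" and p2: "\<And>k. soc_pair e (y2 k) (g2 k)"
begin

lemma quotient_monotone: "dy \<bullet> dg \<le> 0"
proof (rule tendsto_upperbound[OF tendsto_inner[OF dy dg]])
  show "\<forall>\<^sub>F k in sequentially. (1 / t k) *\<^sub>R (y2 k - y1 k) \<bullet> (1 / t k) *\<^sub>R (g2 k - g1 k) \<le> 0"
    using soc_pair_monotone[OF p1 p2] t
    by (intro always_eventually allI) (simp add: mult_nonneg_nonpos divide_nonpos_pos less_imp_le)
qed simp

text \<open>Near \<open>y \<noteq> 0\<close> every pair satisfies g = \<kappa> R y with \<kappa> the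
  ratio of the heads, so g2 - g1 = (\<kappa>2 - \<kappa>1) R y1 + \<kappa>2 R (y2 - y1).\<close>

lemma quotient_nonzero:
  assumes "y \<noteq> 0"
  shows "dg = ((dg \<bullet> e - (g \<bullet> e) / (y \<bullet> e) * (dy \<bullet> e)) / (y \<bullet> e)) *\<^sub>R rfl e y
            + ((g \<bullet> e) / (y \<bullet> e)) *\<^sub>R rfl e dy"
proof -
  define \<kappa>1 \<kappa>2 where "\<kappa>1 k = (g1 k \<bullet> e) / (y1 k \<bullet> e)" and "\<kappa>2 k = (g2 k \<bullet> e) / (y2 k \<bullet> e)" for k
  have "y \<in> qcone e"
    using closed_sequentially[OF closed_qcone, of y1 y] p1 y1 by (auto simp: soc_pair_def)
  then have ye: "0 < y \<bullet> e" using qcone_head_pos assms by blast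
  have e1: "\<forall>\<^sub>F k in sequentially. 0 < y1 k \<bullet> e" and e2: "\<forall>\<^sub>F k in sequentially. 0 < y2 k \<bullet> e"
    using order_tendstoD(1)[OF tendsto_inner[OF y1 tendsto_const] ye]
      order_tendstoD(1)[OF tendsto_inner[OF y2 tendsto_const] ye] .
  have k2: "\<kappa>2 \<longlonglongrightarrow> (g \<bullet> e) / (y \<bullet> e)"
    unfolding \<kappa>2_def using ye by (intro tendsto_intros g2 y2) auto
  \<comment> \<open>This is (\<kappa>2 - \<kappa>1) / t. Its convergence is not given, but taking
    heads in the identity for g2 - g1 expresses it by quantities with known limits.\<close>
  define \<rho> where "\<rho> k = ((((1 / t k) *\<^sub>R (g2 k - g1 k)) \<bullet> e)
      - \<kappa>2 k * (((1 / t k) *\<^sub>R (y2 k - y1 k)) \<bullet> e)) / (y1 k \<bullet> e)" for k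
  have rho: "\<rho> \<longlonglongrightarrow> (dg \<bullet> e - (g \<bullet> e) / (y \<bullet> e) * (dy \<bullet> e)) / (y \<bullet> e)"
    unfolding \<rho>_def using ye by (intro tendsto_intros dg dy k2 y1) auto
  have ev: "\<forall>\<^sub>F k in sequentially. (1 / t k) *\<^sub>R (g2 k - g1 k)
      = \<rho> k *\<^sub>R rfl e (y1 k) + \<kappa>2 k *\<^sub>R rfl e ((1 / t k) *\<^sub>R (y2 k - y1 k))"
    using e1 e2
  proof eventually_elim
    case (elim k)
    have g1k: "g1 k = \<kappa>1 k *\<^sub>R rfl e (y1 k)" and g2k: "g2 k = \<kappa>2 k *\<^sub>R rfl e (y2 k)"
      unfolding \<kappa>1_def \<kappa>2_def using soc_pair_eq[OF p1] soc_pair_eq[OF p2] elim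
      by (metis inner_zero_left less_irrefl)+
    have ne: "y1 k \<bullet> e \<noteq> 0" using elim by simp
    have "g1 k \<bullet> e = \<kappa>1 k * (y1 k \<bullet> e)" "g2 k \<bullet> e = \<kappa>2 k * (y2 k \<bullet> e)"
      using g1k g2k by (metis inner_scaleR_left rfl_inner_unit)+
    then have "\<rho> k = (\<kappa>2 k * (y2 k \<bullet> e) - \<kappa>1 k * (y1 k \<bullet> e)
        - \<kappa>2 k * (y2 k \<bullet> e - y1 k \<bullet> e)) / t k / (y1 k \<bullet> e)"
      unfolding \<rho>_def by (simp add: inner_simps diff_divide_distrib right_diff_distrib)
    also have "\<dots> = (\<kappa>2 k - \<kappa>1 k) / t k"
      using ne t[of k] by (simp add: field_simps)
    finally have \<rho>k: "\<rho> k = (\<kappa>2 k - \<kappa>1 k) / t k" .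
    show ?case
      unfolding \<rho>k using t[of k] g1k g2k
      by (simp add: rfl_scaleR rfl_diff scaleR_diff_right scaleR_diff_left diff_divide_distrib)
  qed
  have "(\<lambda>k. \<rho> k *\<^sub>R rfl e (y1 k) + \<kappa>2 k *\<^sub>R rfl e ((1 / t k) *\<^sub>R (y2 k - y1 k))) \<longlonglongrightarrow>
      ((dg \<bullet> e - (g \<bullet> e) / (y \<bullet> e) * (dy \<bullet> e)) / (y \<bullet> e)) *\<^sub>R rfl e y
            + ((g \<bullet> e) / (y \<bullet> e)) *\<^sub>R rfl e dy"
    by (intro tendsto_intros rho k2 y1 dy)
  then show ?thesis by (rule LIMSEQ_unique[OF Lim_transform_eventually[OF dg ev]])
qed

text \<open>Polarisation of the Lorentz form: the pairing of y2 - y1 with R (y2 + y1) is the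
  difference of its two vanishing values.\<close>

lemma quotient_boundary:
  assumes "\<forall>\<^sub>F k in sequentially. y1 k \<bullet> rfl e (y1 k) = 0 \<and> y2 k \<bullet> rfl e (y2 k) = 0"
  shows "dy \<bullet> rfl e y = 0"
proof -
  have "(\<lambda>k. (1 / t k) *\<^sub>R (y2 k - y1 k) \<bullet> rfl e (y2 k + y1 k)) \<longlonglongrightarrow> dy \<bullet> rfl e (y + y)"
    by (intro tendsto_intros dy y1 y2)
  moreover have "\<forall>\<^sub>F k in sequentially. (1 / t k) *\<^sub>R (y2 k - y1 k) \<bullet> rfl e (y2 k + y1 k) = 0"
    using assms
  proof eventually_elim
    case (elim k)
    have "(y2 k - y1 k) \<bullet> rfl e (y2 k + y1 k) = y2 k \<bullet> rfl e (y2 k) - y1 k \<bullet> rfl e (y1 k)"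
      by (simp add: inner_simps rfl_add) (metis rfl_inner_commute inner_commute)
    then show ?case using elim by simp
  qed
  ultimately have "(\<lambda>k. 0::real) \<longlonglongrightarrow> dy \<bullet> rfl e (y + y)"
    by (rule Lim_transform_eventually)
  then have "dy \<bullet> rfl e (y + y) = 0" by (simp add: LIMSEQ_const_iff)
  then show ?thesis by (simp add: rfl_add inner_simps)
qed

lemma quotient_zero:
  assumes "\<forall>\<^sub>F k in sequentially. g1 k = 0 \<and> g2 k = 0"
  shows "dg = 0"
proof -
  have "(\<lambda>k. 0) \<longlonglongrightarrow> dg"
    by (rule Lim_transform_eventually[OF dg]) (use assms in eventually_elim, simp)
  then show ?thesis by (simp add: LIMSEQ_const_iff)
qed

lemma quotient_interior:
  assumes "0 < y \<bullet> rfl e y"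
  shows "dg = 0"
proof (rule quotient_zero)
  have "\<forall>\<^sub>F k in sequentially. 0 < y1 k \<bullet> rfl e (y1 k)" "\<forall>\<^sub>F k in sequentially. 0 < y2 k \<bullet> rfl e (y2 k)"
    using assms by (auto intro!: order_tendstoD(1) tendsto_intros y1 y2)
  then show "\<forall>\<^sub>F k in sequentially. g1 k = 0 \<and> g2 k = 0"
    by eventually_elim (use p1 p2 soc_pair_interior in blast)
qed

lemma eventually_nonzero:
  assumes "g \<noteq> 0"
  shows "\<forall>\<^sub>F k in sequentially. y1 k \<bullet> rfl e (y1 k) = 0 \<and> y2 k \<bullet> rfl e (y2 k) = 0"
proof -
  have "\<forall>\<^sub>F k in sequentially. g1 k \<noteq> 0" "\<forall>\<^sub>F k in sequentially. g2 k \<noteq> 0"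
    using assms tendsto_imp_eventually_ne g1 g2 by auto
  then show ?thesis by eventually_elim (use p1 p2 soc_pair_boundary in blast)
qed

end

end

section \<open>Quadratic forms and solvability\<close>

text \<open>Definiteness makes \<open>B\<close> injective on \<open>F\<close>, so the orthogonal
  complement of the image of \<open>F\<close> has complementary dimension; by definiteness again it
  meets \<open>F\<close> only in 0, and the two add up to the whole space.\<close>

lemma subspace_orthogonal_split:
  fixes B :: "'a::euclidean_space \<Rightarrow> 'a"
  assumes "linear B" "subspace F" and pos: "\<And>x. x \<in> F \<Longrightarrow> x \<noteq> 0 \<Longrightarrow> 0 < x \<bullet> B x"
  obtains x where "x \<in> F" "\<And>z. z \<in> F \<Longrightarrow> (d - x) \<bullet> B z = 0"
proof -
  define P where "P = {y \<in> UNIV. \<forall>x \<in> B ` F. orthogonal x y}"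
  have BF: "subspace (B ` F)" using assms by (simp add: linear_subspace_image)
  have inj: "inj_on B F"
    unfolding linear_inj_on_iff_eq_0[OF assms(1,2)] using pos by fastforce
  have P: "subspace P"
    unfolding P_def by (simp add: subspace_def orthogonal_clauses)
  have "dim P + dim (B ` F) = DIM('a)"
    unfolding P_def using dim_subspace_orthogonal_to_vectors[OF BF subspace_UNIV] by simp
  moreover have "dim (B ` F) = dim F"
    using dim_image_eq[of B F] inj assms by (simp add: span_eq_iff[THEN iffD2])
  moreover have "F \<inter> P \<subseteq> {0}"
    using pos by (force simp: P_def orthogonal_def inner_commute)
  then have "dim (F \<inter> P) = 0" by (simp add: dim_eq_0)
  ultimately have "dim {x + y |x y. x \<in> F \<and> y \<in> P} = DIM('a)"
    using dim_sums_Int[OF assms(2) P] by linarith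
  then have "span {x + y |x y. x \<in> F \<and> y \<in> P} = UNIV"
    by (simp add: dim_eq_full)
  then have "d \<in> {x + y |x y. x \<in> F \<and> y \<in> P}"
    using span_eq_iff[of "{x + y |x y. x \<in> F \<and> y \<in> P}"] subspace_sums[OF assms(2) P] by auto
  then obtain x y where "d = x + y" "x \<in> F" "y \<in> P" by blast
  then show thesis
    using that[of x] by (auto simp: P_def orthogonal_def inner_commute)
qed

text \<open>The solvability assumption is the variational inequality of a one-dimensional
  complementarity condition on \<open>F + \<real>\<^sub>\<ge>\<^sub>0 v\<close>; testing it with a direction of
  nonpositive curvature as right-hand side gives the contradiction.\<close>

lemma definite_jump:
  fixes B :: "'a::euclidean_space \<Rightarrow> 'a" and M :: "real \<Rightarrow> 'a set"
  assumes "linear B" and sym: "\<And>x z. x \<bullet> B z = z \<bullet> B x"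
    and M0: "subspace (M 0)"
    and M_add: "\<And>x z s t. x \<in> M s \<Longrightarrow> z \<in> M t \<Longrightarrow> x + z \<in> M (s + t)"
    and M_scale: "\<And>x s c. x \<in> M s \<Longrightarrow> c *\<^sub>R x \<in> M (c * s)"
    and nonneg: "\<And>d. d \<in> M 0 \<Longrightarrow> 0 \<le> d \<bullet> B d"
    and solvable: "\<And>a. \<exists>s\<ge>0. \<exists>x\<in>M s. (\<forall>d\<in>M 0. a \<bullet> d = d \<bullet> B x) \<and> (\<forall>d\<in>M 1. a \<bullet> d \<le> d \<bullet> B x)"
    and d: "d \<in> M s" "d \<noteq> 0"
  shows "0 < d \<bullet> B d"
proof -
  have add: "B (x + z) = B x + B z" and diff: "B (x - z) = B x - B z" and sc: "B (c *\<^sub>R x) = c *\<^sub>R B x"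
    for x z c using assms(1) by (simp_all add: linear_add linear_diff linear_scale)
  have M_diff: "x - z \<in> M (s - t)" if "x \<in> M s" "z \<in> M t" for x z s t
    using M_add[OF that(1) M_scale[OF that(2), of "-1"]] by simp
  have pos: "0 < d \<bullet> B d" if d: "d \<in> M 0" "d \<noteq> 0" for d
  proof (rule ccontr)
    assume "\<not> 0 < d \<bullet> B d"
    then have d0: "d \<bullet> B d = 0" using nonneg[OF d(1)] by simp
    \<comment> \<open>A null vector of a nonnegative form lies in its radical: otherwise the value
      at \<open>c *\<^sub>R d + z\<close> is affine in \<open>c\<close> with nonzero slope, and the
      \<open>c\<close> below makes it -1.\<close>
    have orth: "d \<bullet> B z = 0" if z: "z \<in> M 0" for z
    proof (rule ccontr)
      assume nz: "d \<bullet> B z \<noteq> 0"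
      define c where "c = - (z \<bullet> B z + 1) / (2 * (d \<bullet> B z))"
      have "c *\<^sub>R d + z \<in> M 0"
        using d z M0 by (simp add: subspace_add subspace_scale)
      then have "0 \<le> (c *\<^sub>R d + z) \<bullet> B (c *\<^sub>R d + z)" by (rule nonneg)
      also have "\<dots> = 2 * c * (d \<bullet> B z) + z \<bullet> B z"
        using d0 sym[of z d] by (simp add: add sc inner_simps)
      also have "\<dots> = -1" using nz by (simp add: c_def field_simps)
      finally show False by simp
    qed
    have dd: "0 < d \<bullet> d" using d by simp
    \<comment> \<open>Since \<open>d\<close> is in the radical, its pairing with a vector is
      determined by the level of that vector, and linearly so. The right-hand sides \<open>d\<close>
      and \<open>- d\<close> would need opposite signs at positive levels.\<close>
    obtain s x where s: "0 \<le> s" "x \<in> M s" "d \<bullet> d = d \<bullet> B x" using solvable[of d] d by blast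
    obtain s' x' where s': "0 \<le> s'" "x' \<in> M s'" "- d \<bullet> d = d \<bullet> B x'" using solvable[of "-d"] d by blast
    have "s \<noteq> 0" "s' \<noteq> 0" using orth s s' dd by auto
    then have ss: "0 < s" "0 < s'" using s s' by auto
    then have "(1 / s) *\<^sub>R x - (1 / s') *\<^sub>R x' \<in> M 0"
      using M_diff[OF M_scale[OF s(2), of "1 / s"] M_scale[OF s'(2), of "1 / s'"]] by simp
    then have "d \<bullet> B ((1 / s) *\<^sub>R x - (1 / s') *\<^sub>R x') = 0" by (rule orth)
    then have "(d \<bullet> B x) / s - (d \<bullet> B x') / s' = 0"
      by (simp add: diff sc inner_simps)
    then have "(d \<bullet> d) / s + (d \<bullet> d) / s' = 0"
      by (simp flip: s(3) s'(3))
    moreover have "0 < (d \<bullet> d) / s" "0 < (d \<bullet> d) / s'" using ss dd by simp_all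
    ultimately show False by linarith
  qed
  show ?thesis
  proof (cases "s = 0")
    case True
    then show ?thesis using pos d by simp
  next
    case False
    show ?thesis
    proof (rule ccontr)
      assume neg: "\<not> 0 < d \<bullet> B d"
      define d1 where "d1 = (1 / s) *\<^sub>R d"
      have d1: "d1 \<in> M 1" using M_scale[OF d(1), of "1 / s"] False by (simp add: d1_def)
      have d1neg: "d1 \<bullet> B d1 \<le> 0"
        using neg by (simp add: d1_def sc divide_nonpos_nonneg)
      \<comment> \<open>Removing the \<open>B\<close>-projection onto \<open>M 0\<close> does not
        increase the value of the form and makes the rest \<open>d2\<close> orthogonal to
        \<open>M 0\<close> with respect to \<open>B\<close>. The pairing with \<open>d2\<close> then
        depends on the level only.\<close>
      obtain w where w: "w \<in> M 0" and wo: "\<And>z. z \<in> M 0 \<Longrightarrow> (d1 - w) \<bullet> B z = 0"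
        using subspace_orthogonal_split[OF assms(1) M0 pos] by blast
      define d2 where "d2 = d1 - w"
      have d2: "d2 \<in> M 1" using M_diff[OF d1 w] by (simp add: d2_def)
      have "d1 \<bullet> B d1 = d2 \<bullet> B d2 + 2 * (d2 \<bullet> B w) + w \<bullet> B w"
      proof -
        have "d1 = d2 + w" by (simp add: d2_def)
        then show ?thesis using sym[of w d2] by (simp add: add inner_simps)
      qed
      then have d2neg: "d2 \<bullet> B d2 \<le> 0"
        using d1neg wo[OF w] nonneg[OF w] by (simp add: d2_def)
      have d2nz: "d2 \<noteq> 0"
      proof
        assume "d2 = 0"
        then have "d1 = w" by (simp add: d2_def)
        then have "d1 \<in> M 0" "d1 \<noteq> 0" using w d(2) False by (auto simp: d1_def)
        then show False using pos d1neg by fastforce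
      qed
      obtain \<sigma> x where \<sigma>: "0 \<le> \<sigma>" "x \<in> M \<sigma>" "d2 \<bullet> d2 \<le> d2 \<bullet> B x" using solvable[of d2] d2 by blast
      have "x - \<sigma> *\<^sub>R d2 \<in> M 0" using M_diff[OF \<sigma>(2) M_scale[OF d2, of \<sigma>]] by simp
      then have "d2 \<bullet> B (x - \<sigma> *\<^sub>R d2) = 0" using wo by (simp add: d2_def)
      then have "d2 \<bullet> B x = \<sigma> * (d2 \<bullet> B d2)" by (simp add: diff sc inner_simps)
      then have "d2 \<bullet> d2 \<le> 0" using \<sigma> d2neg by (simp add: mult_nonneg_nonpos order_trans)
      then show False using d2nz by (metis inner_gt_zero_iff not_le)
    qed
  qed
qed

text \<open>If \<open>q\<close> took a negative value, the least \<open>c\<close> with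
  \<open>q + c * \<phi>\<close> nonnegative on \<open>Z\<close> would be positive and the form would
  have a nonzero null vector there, which \<open>pen\<close> forbids. This critical \<open>c\<close>
  is the maximum of \<open>- q / \<phi>\<close> over the unit vectors with \<open>q \<le> 0\<close>;
  on these \<phi> is positive, as \<open>q\<close> is positive at the nonzero zeros of
  \<phi>.\<close>

lemma nonneg_of_penalized_definite:
  fixes q \<phi> :: "'a::euclidean_space \<Rightarrow> real"
  assumes "subspace Z" and cont: "continuous_on UNIV q" "continuous_on UNIV \<phi>"
    and hom: "\<And>x c. q (c *\<^sub>R x) = c\<^sup>2 * q x" "\<And>x c. \<phi> (c *\<^sub>R x) = c\<^sup>2 * \<phi> x"
    and \<phi>: "\<And>x. x \<in> Z \<Longrightarrow> 0 \<le> \<phi> x"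
    and q: "\<And>x. x \<in> Z \<Longrightarrow> \<phi> x = 0 \<Longrightarrow> x \<noteq> 0 \<Longrightarrow> 0 < q x"
    and pen: "\<And>c x. 0 < c \<Longrightarrow> (\<And>z. z \<in> Z \<Longrightarrow> 0 \<le> q z + c * \<phi> z) \<Longrightarrow> x \<in> Z \<Longrightarrow> x \<noteq> 0
        \<Longrightarrow> 0 < q x + c * \<phi> x"
    and x: "x \<in> Z"
  shows "0 \<le> q x"
proof (rule ccontr)
  assume neg: "\<not> 0 \<le> q x"
  define D where "D = {z \<in> Z \<inter> sphere 0 1. q z \<le> 0}"
  have "closed {z. q z \<le> 0}" using cont by (intro closed_Collect_le) auto
  then have "compact D"
    unfolding D_def Collect_conj_eq Collect_mem_eq Int_assoc[symmetric]
    using closed_subspace[OF assms(1)] by (simp add: closed_Int_compact compact_Int_closed)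
  have pos\<phi>: "0 < \<phi> z" if "z \<in> D" for z
  proof -
    have "z \<noteq> 0" "z \<in> Z" "q z \<le> 0" using that by (auto simp: D_def)
    then show ?thesis using q \<phi>[of z] by (metis less_le not_le)
  qed
  have xn: "x \<noteq> 0" using neg hom(1)[of 0 x] by auto
  have xD: "(1 / norm x) *\<^sub>R x \<in> D" and xq: "q ((1 / norm x) *\<^sub>R x) < 0"
    using neg x assms(1) xn by (auto simp: D_def subspace_scale hom mult_nonneg_nonpos mult_pos_neg)
  have "continuous_on D (\<lambda>z. - q z / \<phi> z)"
    by (intro continuous_intros continuous_on_subset[OF cont(1)] continuous_on_subset[OF cont(2)])
      (auto dest: pos\<phi> simp: less_le)
  then obtain z where z: "z \<in> D" and max: "\<And>w. w \<in> D \<Longrightarrow> - q w / \<phi> w \<le> - q z / \<phi> z"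
    using continuous_attains_sup[OF \<open>compact D\<close>] xD by blast
  define c where "c = - q z / \<phi> z"
  have "0 < - q ((1 / norm x) *\<^sub>R x) / \<phi> ((1 / norm x) *\<^sub>R x)"
    using xq pos\<phi>[OF xD] by (intro divide_pos_pos) auto
  then have c: "0 < c" using max[OF xD] by (simp add: c_def)
  have "0 \<le> q w + c * \<phi> w" if w: "w \<in> Z" for w
  proof (cases "w = 0")
    case True
    then show ?thesis using hom[of 0 w] by simp
  next
    case False
    define u where "u = (1 / norm w) *\<^sub>R w"
    have u: "u \<in> Z" "norm u = 1" using w False assms(1) by (auto simp: u_def subspace_scale)
    have "0 \<le> q u + c * \<phi> u"
    proof (cases "q u \<le> 0")
      case True
      then have uD: "u \<in> D" using u by (simp add: D_def)
      then have "- q u / \<phi> u \<le> c" using max by (simp add: c_def)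
      then show ?thesis using pos\<phi>[OF uD] by (simp add: field_simps)
    next
      case False
      then show ?thesis using \<phi>[OF u(1)] c by simp
    qed
    moreover have "w = norm w *\<^sub>R u" using False by (simp add: u_def)
    then have "q w + c * \<phi> w = (norm w)\<^sup>2 * (q u + c * \<phi> u)"
      by (metis hom distrib_left mult.left_commute)
    ultimately show ?thesis by simp
  qed
  moreover have "z \<in> Z" "z \<noteq> 0" using z by (auto simp: D_def)
  ultimately have "0 < q z + c * \<phi> z" using pen[OF c] by blast
  then show False using pos\<phi>[OF z] by (simp add: c_def)
qed

section \<open>Second-order expansions\<close>

text \<open>Mean value theorem on the segment from \<open>x0 + p\<close> to
  \<open>x0 + p + d\<close>, for \<open>L\<close> minus its quadratic model at \<open>x0\<close>.
  The displacement \<open>p\<close> allows increments along all sides of a parallelogram.\<close>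

lemma second_order_increment:
  fixes L :: "'a::euclidean_space \<Rightarrow> real"
  assumes L: "\<And>x. (L has_derivative (\<lambda>h. gL x \<bullet> h)) (at x)"
    and H: "linear H"
    and r: "\<And>x. norm (x - x0) \<le> \<delta> \<Longrightarrow> norm (gL x - gL x0 - H (x - x0)) \<le> \<eta> * norm (x - x0)"
    and p: "norm p \<le> \<rho>" and pd: "norm (p + d) \<le> \<rho>" and \<rho>: "\<rho> \<le> \<delta>" and \<eta>: "0 \<le> \<eta>"
  shows "\<bar>L (x0 + p + d) - L (x0 + p) - gL x0 \<bullet> d - H p \<bullet> d - (1 / 2) * (H d \<bullet> d)\<bar> \<le> \<eta> * \<rho> * norm d"
proof -
  define \<phi> where "\<phi> t = L (x0 + p + t *\<^sub>R d) - t * (gL x0 \<bullet> d) - t * (H p \<bullet> d) - (1 / 2) * t\<^sup>2 * (H d \<bullet> d)" for t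
  have "(\<phi> has_real_derivative (gL (x0 + p + t *\<^sub>R d) \<bullet> d - gL x0 \<bullet> d - H p \<bullet> d - t * (H d \<bullet> d))) (at t)" for t
  proof -
    have "((\<lambda>t. L (x0 + p + t *\<^sub>R d)) has_derivative (\<lambda>h. gL (x0 + p + t *\<^sub>R d) \<bullet> (h *\<^sub>R d))) (at t)"
      by (rule has_derivative_compose[OF _ L]) (auto intro!: derivative_eq_intros)
    then have "((\<lambda>t. L (x0 + p + t *\<^sub>R d)) has_real_derivative gL (x0 + p + t *\<^sub>R d) \<bullet> d) (at t)"
      by (simp add: has_field_derivative_def mult_commute_abs)
    then show ?thesis
      unfolding \<phi>_def by (auto intro!: derivative_eq_intros)
  qed
  then obtain t where t: "0 < t" "t < 1"
      "\<phi> 1 - \<phi> 0 = gL (x0 + p + t *\<^sub>R d) \<bullet> d - gL x0 \<bullet> d - H p \<bullet> d - t * (H d \<bullet> d)"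
    using MVT2[of 0 1 \<phi> "\<lambda>t. gL (x0 + p + t *\<^sub>R d) \<bullet> d - gL x0 \<bullet> d - H p \<bullet> d - t * (H d \<bullet> d)"] by auto
  have "p + t *\<^sub>R d = (1 - t) *\<^sub>R p + t *\<^sub>R (p + d)" by (simp add: algebra_simps)
  then have "norm (p + t *\<^sub>R d) \<le> (1 - t) * norm p + t * norm (p + d)"
    using t norm_triangle_ineq[of "(1 - t) *\<^sub>R p" "t *\<^sub>R (p + d)"] by simp
  also have "\<dots> \<le> (1 - t) * \<rho> + t * \<rho>"
    using t p pd by (intro add_mono mult_left_mono) auto
  finally have n: "norm (p + t *\<^sub>R d) \<le> \<rho>" by (simp add: algebra_simps)
  have "\<phi> 1 - \<phi> 0 = (gL (x0 + p + t *\<^sub>R d) - gL x0 - H (p + t *\<^sub>R d)) \<bullet> d"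
    unfolding t(3) using H by (simp add: inner_simps linear_add linear_scale)
  also have "\<bar>\<dots>\<bar> \<le> norm (gL (x0 + p + t *\<^sub>R d) - gL x0 - H (p + t *\<^sub>R d)) * norm d"
    by (rule Cauchy_Schwarz_ineq2)
  also have "\<dots> \<le> (\<eta> * \<rho>) * norm d"
  proof (rule mult_right_mono)
    have "norm (gL (x0 + p + t *\<^sub>R d) - gL x0 - H (p + t *\<^sub>R d)) \<le> \<eta> * norm (p + t *\<^sub>R d)"
      using r[of "x0 + p + t *\<^sub>R d"] n \<rho> by (simp add: algebra_simps)
    then show "norm (gL (x0 + p + t *\<^sub>R d) - gL x0 - H (p + t *\<^sub>R d)) \<le> \<eta> * \<rho>"
      using n \<eta> mult_left_mono order_trans by blast
  qed simp
  finally show ?thesis by (simp add: \<phi>_def algebra_simps)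
qed

lemma derivative_bound_ball:
  assumes "(F has_derivative H) (at x0)" "0 < \<eta>"
  obtains \<delta> where "0 < \<delta>" "\<And>x. norm (x - x0) \<le> \<delta> \<Longrightarrow> norm (F x - F x0 - H (x - x0)) \<le> \<eta> * norm (x - x0)"
proof -
  obtain d where "0 < d" "\<And>x. norm (x - x0) < d \<Longrightarrow> norm (F x - F x0 - H (x - x0)) \<le> \<eta> * norm (x - x0)"
    using assms unfolding has_derivative_at_alt by blast
  then show thesis using that[of "d / 2"] by auto
qed

text \<open>The gradient is known to be differentiable at \<open>x0\<close> only. The two paths
  along the sides of a small parallelogram end at the same corner, so the two mixed terms differ by
  at most four model errors.\<close>

lemma hessian_symmetric:
  fixes L :: "'a::euclidean_space \<Rightarrow> real"
  assumes L: "\<And>x. (L has_derivative (\<lambda>h. gL x \<bullet> h)) (at x)"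
    and H: "(gL has_derivative H) (at x0)"
  shows "H u \<bullet> v = H v \<bullet> u"
proof -
  have lin: "linear H" using H has_derivative_linear by blast
  define N where "N = norm u + norm v + 1"
  have N: "0 < N" unfolding N_def by (smt (verit) norm_ge_zero)
  have "\<bar>H u \<bullet> v - H v \<bullet> u\<bar> \<le> \<epsilon>" if \<epsilon>: "0 < \<epsilon>" for \<epsilon>
  proof -
    \<comment> \<open>With t N = \<delta> all corners stay within \<delta> of \<open>x0\<close>, and
      four errors of size \<eta> \<delta>^2 add up to exactly t^2 \<epsilon>.\<close>
    define \<eta> where "\<eta> = \<epsilon> / (4 * N * N)"
    have \<eta>: "0 < \<eta>" using \<epsilon> N by (simp add: \<eta>_def)
    obtain \<delta> where \<delta>: "0 < \<delta>"
      and r: "\<And>x. norm (x - x0) \<le> \<delta> \<Longrightarrow> norm (gL x - gL x0 - H (x - x0)) \<le> \<eta> * norm (x - x0)"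
      using derivative_bound_ball[OF H \<eta>] by blast
    define t where "t = \<delta> / N"
    have t: "0 < t" using \<delta> N by (simp add: t_def)
    have tN: "t * N = \<delta>" using N by (simp add: t_def)
    have b: "norm (t *\<^sub>R u) \<le> \<delta>" "norm (t *\<^sub>R v) \<le> \<delta>" "norm (t *\<^sub>R u + t *\<^sub>R v) \<le> \<delta>"
      using t norm_triangle_ineq[of u v] unfolding tN[symmetric] N_def
      by (simp_all add: mult_left_mono flip: scaleR_add_right)
    note inc = second_order_increment[OF L lin r _ _ order_refl less_imp_le[OF \<eta>], simplified]
    let ?u = "t *\<^sub>R u" and ?v = "t *\<^sub>R v"
    have sm: "\<eta> * \<delta> * norm ?u \<le> \<eta> * \<delta> * \<delta>" "\<eta> * \<delta> * norm ?v \<le> \<eta> * \<delta> * \<delta>"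
      using b \<eta> \<delta> by (intro mult_left_mono; simp)+
    have "\<bar>L (x0 + 0 + ?u) - L (x0 + 0) - gL x0 \<bullet> ?u - H 0 \<bullet> ?u - (1 / 2) * (H ?u \<bullet> ?u)\<bar> \<le> \<eta> * \<delta> * norm ?u"
      "\<bar>L (x0 + ?u + ?v) - L (x0 + ?u) - gL x0 \<bullet> ?v - H ?u \<bullet> ?v - (1 / 2) * (H ?v \<bullet> ?v)\<bar> \<le> \<eta> * \<delta> * norm ?v"
      "\<bar>L (x0 + 0 + ?v) - L (x0 + 0) - gL x0 \<bullet> ?v - H 0 \<bullet> ?v - (1 / 2) * (H ?v \<bullet> ?v)\<bar> \<le> \<eta> * \<delta> * norm ?v"
      "\<bar>L (x0 + ?v + ?u) - L (x0 + ?v) - gL x0 \<bullet> ?u - H ?v \<bullet> ?u - (1 / 2) * (H ?u \<bullet> ?u)\<bar> \<le> \<eta> * \<delta> * norm ?u"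
      by (rule second_order_increment[OF L lin r _ _ order_refl less_imp_le[OF \<eta>]];
          use b \<delta> in \<open>simp add: add.commute\<close>)+
    then have "\<bar>H ?u \<bullet> ?v - H ?v \<bullet> ?u\<bar> \<le> 4 * (\<eta> * \<delta> * \<delta>)"
      using sm by (simp only: add.assoc add.commute[of ?v ?u] add_0_left add_0_right linear_0[OF lin]
          inner_zero_left)
    also have "\<dots> = t * t * \<epsilon>"
      unfolding tN[symmetric] \<eta>_def using N by (simp add: field_simps)
    also have "H ?u \<bullet> ?v - H ?v \<bullet> ?u = t * t * (H u \<bullet> v - H v \<bullet> u)"
      using lin by (simp add: linear_scale algebra_simps)
    finally show ?thesis using t by (simp add: abs_mult)
  qed
  then have "\<bar>H u \<bullet> v - H v \<bullet> u\<bar> \<le> 0" by (rule field_le_epsilon[of _ 0, simplified])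
  then show ?thesis by simp
qed

lemma second_order_limit:
  fixes L :: "'a::euclidean_space \<Rightarrow> real" and t :: "nat \<Rightarrow> real"
  assumes L: "\<And>x. (L has_derivative (\<lambda>h. gL x \<bullet> h)) (at x)"
    and H: "(gL has_derivative H) (at x0)" and crit: "gL x0 = 0"
    and t: "\<And>k. 0 < t k" "t \<longlonglongrightarrow> 0"
    and x: "(\<lambda>k. (1 / t k) *\<^sub>R (x k - x0)) \<longlonglongrightarrow> d"
  shows "(\<lambda>k. (L (x k) - L x0) / (t k)\<^sup>2) \<longlonglongrightarrow> (1 / 2) * (H d \<bullet> d)"
proof -
  have lin: "linear H" and bl: "bounded_linear H" using H has_derivative_linear has_derivative_bounded_linear by blast+
  define w where "w k = (1 / t k) *\<^sub>R (x k - x0)" for k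
  have w: "w \<longlonglongrightarrow> d" using x by (simp add: w_def[abs_def])
  have xw: "x k - x0 = t k *\<^sub>R w k" for k using t(1)[of k] by (simp add: w_def)
  have lim: "(\<lambda>k. (1 / 2) * (H (w k) \<bullet> w k)) \<longlonglongrightarrow> (1 / 2) * (H d \<bullet> d)"
    by (intro tendsto_intros bounded_linear.tendsto[OF bl] w)
  have "(\<lambda>k. (L (x k) - L x0) / (t k)\<^sup>2 - (1 / 2) * (H (w k) \<bullet> w k)) \<longlonglongrightarrow> 0"
  proof (rule LIMSEQ_I)
    fix \<epsilon> :: real assume \<epsilon>: "0 < \<epsilon>"
    define N where "N = (norm d)\<^sup>2 + 1"
    define \<eta> where "\<eta> = \<epsilon> / (2 * N)"
    have dn: "0 < N" by (simp add: N_def add_nonneg_pos)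
    then have \<eta>: "0 < \<eta>" using \<epsilon> by (simp add: \<eta>_def)
    obtain \<delta> where \<delta>: "0 < \<delta>"
      and r: "\<And>x. norm (x - x0) \<le> \<delta> \<Longrightarrow> norm (gL x - gL x0 - H (x - x0)) \<le> \<eta> * norm (x - x0)"
      using derivative_bound_ball[OF H \<eta>] by blast
    have "(\<lambda>k. norm (t k *\<^sub>R w k)) \<longlonglongrightarrow> norm (0 *\<^sub>R d)" by (intro tendsto_intros t w)
    then have "\<forall>\<^sub>F k in sequentially. norm (t k *\<^sub>R w k) < \<delta>"
      using \<delta> by (simp add: order_tendstoD(2))
    moreover have "(\<lambda>k. (norm (w k))\<^sup>2) \<longlonglongrightarrow> (norm d)\<^sup>2" by (intro tendsto_intros w)
    then have "\<forall>\<^sub>F k in sequentially. (norm (w k))\<^sup>2 < N" by (simp add: N_def order_tendstoD(2))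
    ultimately have "\<forall>\<^sub>F k in sequentially. norm ((L (x k) - L x0) / (t k)\<^sup>2 - (1 / 2) * (H (w k) \<bullet> w k) - 0) < \<epsilon>"
    proof eventually_elim
      case (elim k)
      have "\<bar>L (x0 + 0 + t k *\<^sub>R w k) - L (x0 + 0) - gL x0 \<bullet> (t k *\<^sub>R w k) - H 0 \<bullet> (t k *\<^sub>R w k)
          - (1 / 2) * (H (t k *\<^sub>R w k) \<bullet> (t k *\<^sub>R w k))\<bar> \<le> \<eta> * norm (t k *\<^sub>R w k) * norm (t k *\<^sub>R w k)"
        by (rule second_order_increment[OF L lin r _ _ less_imp_le[OF elim(1)]]) (use \<eta> in auto)
      moreover have "x0 + t k *\<^sub>R w k = x k" using xw[of k] by (simp add: algebra_simps)
      ultimately have "\<bar>L (x k) - L x0 - (t k)\<^sup>2 * ((1 / 2) * (H (w k) \<bullet> w k))\<bar> \<le> (t k)\<^sup>2 * (\<eta> * (norm (w k))\<^sup>2)"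
        using lin t(1)[of k] by (simp add: crit linear_0 linear_scale power2_eq_square algebra_simps)
      moreover have "L (x k) - L x0 - (t k)\<^sup>2 * ((1 / 2) * (H (w k) \<bullet> w k))
         = (t k)\<^sup>2 * ((L (x k) - L x0) / (t k)\<^sup>2 - (1 / 2) * (H (w k) \<bullet> w k))"
        using t(1)[of k] by (simp add: field_simps)
      ultimately have "\<bar>(L (x k) - L x0) / (t k)\<^sup>2 - (1 / 2) * (H (w k) \<bullet> w k)\<bar> \<le> \<eta> * (norm (w k))\<^sup>2"
        using t(1)[of k] by (simp add: abs_mult)
      also have "\<dots> \<le> \<eta> * N" using elim(2) \<eta> by (intro mult_left_mono) auto
      also have "\<dots> = \<epsilon> / 2" using dn by (simp add: \<eta>_def)
      also have "\<dots> < \<epsilon>" using \<epsilon> by simp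
      finally show ?case by simp
    qed
    then show "\<exists>no. \<forall>n\<ge>no. norm ((L (x n) - L x0) / (t n)\<^sup>2 - (1 / 2) * (H (w n) \<bullet> w n) - 0) < \<epsilon>"
      by (simp add: eventually_sequentially)
  qed
  from tendsto_add[OF this lim] show ?thesis by simp
qed

section \<open>Tangent relations of the complementarity condition\<close>

text \<open>\<open>dg\<close> lies in the cone spanned by the space \<open>E\<close> and the ray of
  \<open>n\<close>, and \<open>dy - s *\<^sub>R rfl e dg\<close> in the dual of that cone. With
  \<open>n = 0\<close> this is one linear piece of the tangent relation; with
  \<open>n \<noteq> 0\<close> it describes the passage between two pieces. The number
  \<open>s\<close> carries the curvature of the cone boundary.\<close>

definition block_rel :: "'b::real_inner \<Rightarrow> 'b set \<Rightarrow> 'b \<Rightarrow> real \<Rightarrow> 'b \<Rightarrow> 'b \<Rightarrow> bool" where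
  "block_rel e E n s dy dg \<longleftrightarrow> (\<exists>\<sigma>\<ge>0. dg - \<sigma> *\<^sub>R n \<in> E) \<and>
     (\<forall>w\<in>E. (dy - s *\<^sub>R rfl e dg) \<bullet> w = 0) \<and> 0 \<le> (dy - s *\<^sub>R rfl e dg) \<bullet> n"

definition const_tangent ::
    "'b::real_inner set \<Rightarrow> 'b \<Rightarrow> 'b \<Rightarrow> 'b \<Rightarrow> 'b set \<Rightarrow> 'b \<Rightarrow> real \<Rightarrow> bool" where
  "const_tangent V e y g E n s \<longleftrightarrow> (\<forall>t y' g' dy dg.
     (\<forall>k::nat. 0 < t k \<and> y' k \<in> V \<and> g' k \<in> V \<and> soc_pair e (y' k) (g' k)) \<longrightarrow> t \<longlonglongrightarrow> 0 \<longrightarrow>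
     (\<lambda>k. (1 / t k) *\<^sub>R (y' k - y)) \<longlonglongrightarrow> dy \<longrightarrow> (\<lambda>k. (1 / t k) *\<^sub>R (g' k - g)) \<longlonglongrightarrow> dg \<longrightarrow>
     block_rel e E n s dy dg)"

text \<open>The base point moves with speed \<open>\<epsilon>\<close> while the increments are of order \<open>\<epsilon>\<^sup>2\<close>, so that
  the tangent relation is that of a generic pair near \<open>(y, g)\<close>.\<close>

definition tangent_family ::
    "'b::real_inner set \<Rightarrow> 'b \<Rightarrow> 'b \<Rightarrow> 'b \<Rightarrow> 'b \<Rightarrow> 'b \<Rightarrow> 'b set \<Rightarrow> 'b \<Rightarrow> real \<Rightarrow> bool" where
  "tangent_family V e y g p q E n s \<longleftrightarrow> p \<in> V \<and> q \<in> V \<and>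
     (\<forall>\<epsilon>>0. soc_pair e (y + \<epsilon> *\<^sub>R p) (g + \<epsilon> *\<^sub>R q)) \<and>
     (\<forall>\<epsilon> y' g' dy dg.
     (\<forall>k::nat. 0 < \<epsilon> k \<and> y' k \<in> V \<and> g' k \<in> V \<and> soc_pair e (y' k) (g' k)) \<longrightarrow> \<epsilon> \<longlonglongrightarrow> 0 \<longrightarrow>
     (\<lambda>k. (1 / (\<epsilon> k)\<^sup>2) *\<^sub>R (y' k - (y + \<epsilon> k *\<^sub>R p))) \<longlonglongrightarrow> dy \<longrightarrow>
     (\<lambda>k. (1 / (\<epsilon> k)\<^sup>2) *\<^sub>R (g' k - (g + \<epsilon> k *\<^sub>R q))) \<longlonglongrightarrow> dg \<longrightarrow>
     block_rel e E n s dy dg)"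

lemma tendsto_of_quotient:
  fixes a b :: "nat \<Rightarrow> 'b::real_normed_vector"
  assumes "\<And>k. 0 < t k" "t \<longlonglongrightarrow> 0" "(\<lambda>k. (1 / t k) *\<^sub>R (b k - a k)) \<longlonglongrightarrow> d" "a \<longlonglongrightarrow> y"
  shows "b \<longlonglongrightarrow> y"
proof -
  have "(\<lambda>k. a k + t k *\<^sub>R ((1 / t k) *\<^sub>R (b k - a k))) \<longlonglongrightarrow> y + 0 *\<^sub>R d"
    by (intro tendsto_intros assms)
  moreover have "a k + t k *\<^sub>R ((1 / t k) *\<^sub>R (b k - a k)) = b k" for k
    using assms(1)[of k] by simp
  ultimately show ?thesis by simp
qed

lemma limit_in_subspace:
  fixes V :: "'b::euclidean_space set"
  assumes "subspace V" "\<And>k. f k \<in> V" "f \<longlonglongrightarrow> l"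
  shows "l \<in> V"
  using closed_sequentially[OF closed_subspace[OF assms(1)], of f l] assms by blast

context
  fixes V :: "'b::euclidean_space set" and e :: 'b
  assumes V: "subspace V" and eV: "e \<in> V" and e: "norm e = 1"
begin

lemma rfl_in_subspace: "y \<in> V \<Longrightarrow> rfl e y \<in> V"
  unfolding rfl_def using V eV by (simp add: subspace_diff subspace_scale)

lemma limit_quotient_in_subspace:
  assumes "\<And>k. a k \<in> V" "\<And>k. b k \<in> V" "(\<lambda>k. c k *\<^sub>R (a k - b k)) \<longlonglongrightarrow> d"
  shows "d \<in> V"
  by (rule limit_in_subspace[OF V _ assms(3)]) (use V assms in \<open>simp add: subspace_diff subspace_scale\<close>)

lemma const_tangent_family:
  assumes "const_tangent V e y g E n s" "soc_pair e y g"
  shows "tangent_family V e y g 0 0 E n s"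
  unfolding tangent_family_def
proof (intro conjI allI impI)
  fix \<epsilon> y' g' dy dg
  assume h: "\<forall>k::nat. 0 < \<epsilon> k \<and> y' k \<in> V \<and> g' k \<in> V \<and> soc_pair e (y' k) (g' k)" "\<epsilon> \<longlonglongrightarrow> 0"
    "(\<lambda>k. (1 / (\<epsilon> k)\<^sup>2) *\<^sub>R (y' k - (y + \<epsilon> k *\<^sub>R 0))) \<longlonglongrightarrow> dy"
    "(\<lambda>k. (1 / (\<epsilon> k)\<^sup>2) *\<^sub>R (g' k - (g + \<epsilon> k *\<^sub>R 0))) \<longlonglongrightarrow> dg"
  have "\<And>k. 0 < (\<epsilon> k)\<^sup>2" by (rule zero_less_power) (use h(1) in blast)
  moreover have "(\<lambda>k. (\<epsilon> k)\<^sup>2) \<longlonglongrightarrow> 0" using tendsto_power[OF h(2), of 2] by simp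
  ultimately show "block_rel e E n s dy dg"
    using assms(1)[unfolded const_tangent_def, rule_format, of "\<lambda>k. (\<epsilon> k)\<^sup>2" y' g' dy dg] h by simp
qed (use assms(2) V in \<open>auto simp: subspace_0\<close>)

text \<open>Homogeneity: dividing by \<epsilon> carries the base pair (\<epsilon> p, \<epsilon> q)
  to (p, q) and increments of order \<epsilon>^2 to increments of order \<epsilon>. Near the pair
  (0, 0) the tangent relation of every pair of the block can therefore be realised.\<close>

lemma const_tangent_family_zero:
  assumes "const_tangent V e p q E n s" "soc_pair e p q" "p \<in> V" "q \<in> V"
  shows "tangent_family V e 0 0 p q E n s"
  unfolding tangent_family_def
proof (intro conjI allI impI)
  fix \<epsilon> y' g' dy dg
  assume h: "\<forall>k::nat. 0 < \<epsilon> k \<and> y' k \<in> V \<and> g' k \<in> V \<and> soc_pair e (y' k) (g' k)" "\<epsilon> \<longlonglongrightarrow> 0"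
    "(\<lambda>k. (1 / (\<epsilon> k)\<^sup>2) *\<^sub>R (y' k - (0 + \<epsilon> k *\<^sub>R p))) \<longlonglongrightarrow> dy"
    "(\<lambda>k. (1 / (\<epsilon> k)\<^sup>2) *\<^sub>R (g' k - (0 + \<epsilon> k *\<^sub>R q))) \<longlonglongrightarrow> dg"
  define y1 g1 where "y1 k = (1 / \<epsilon> k) *\<^sub>R y' k" and "g1 k = (1 / \<epsilon> k) *\<^sub>R g' k" for k
  have "(1 / (\<epsilon> k)\<^sup>2) *\<^sub>R (y' k - (0 + \<epsilon> k *\<^sub>R p)) = (1 / \<epsilon> k) *\<^sub>R (y1 k - p)"
    "(1 / (\<epsilon> k)\<^sup>2) *\<^sub>R (g' k - (0 + \<epsilon> k *\<^sub>R q)) = (1 / \<epsilon> k) *\<^sub>R (g1 k - q)" for k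
    using h(1)[rule_format, of k]
    by (simp_all add: y1_def g1_def scaleR_diff_right power2_eq_square)
  then have "(\<lambda>k. (1 / \<epsilon> k) *\<^sub>R (y1 k - p)) \<longlonglongrightarrow> dy" "(\<lambda>k. (1 / \<epsilon> k) *\<^sub>R (g1 k - q)) \<longlonglongrightarrow> dg"
    using h(3,4) by simp_all
  moreover have "\<forall>k. 0 < \<epsilon> k \<and> y1 k \<in> V \<and> g1 k \<in> V \<and> soc_pair e (y1 k) (g1 k)"
    using h(1) V soc_pair_scaleR[OF e]
    by (simp add: y1_def g1_def subspace_scale less_imp_le)
  ultimately show "block_rel e E n s dy dg"
    using assms(1) h(2) unfolding const_tangent_def by blast
qed (use assms soc_pair_scaleR[OF e] in \<open>auto simp: less_imp_le\<close>)

text \<open>Nearby \<open>g'\<close> are nonnegative multiples of R y' with a factor tending to 0,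
  so only the ray of R y remains to first order. The inequality for \<open>dy\<close> says that
  \<open>y'\<close> stays in the cone, R y being the inner normal at \<open>y\<close>.\<close>

lemma const_tangent_outward:
  assumes y: "y \<noteq> 0" "y \<in> qcone e" "y \<bullet> rfl e y = 0"
  shows "const_tangent V e y 0 {0} (rfl e y) 0"
  unfolding const_tangent_def
proof (intro allI impI)
  fix t y' g' dy dg
  assume h: "\<forall>k::nat. 0 < t k \<and> y' k \<in> V \<and> g' k \<in> V \<and> soc_pair e (y' k) (g' k)" "t \<longlonglongrightarrow> 0"
    and dy: "(\<lambda>k. (1 / t k) *\<^sub>R (y' k - y)) \<longlonglongrightarrow> dy" and dg: "(\<lambda>k. (1 / t k) *\<^sub>R (g' k - 0)) \<longlonglongrightarrow> dg"
  have t: "\<And>k. 0 < t k" and p: "\<And>k. soc_pair e (y' k) (g' k)" using h by auto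
  have y': "y' \<longlonglongrightarrow> y" and g': "g' \<longlonglongrightarrow> 0"
    by (rule tendsto_of_quotient[OF t h(2) dy tendsto_const] tendsto_of_quotient[OF t h(2) dg tendsto_const])+
  have dg_eq: "dg = ((dg \<bullet> e) / (y \<bullet> e)) *\<^sub>R rfl e y"
    using quotient_nonzero[OF e t tendsto_const tendsto_const y' g' dy dg _ p y(1)] y(2) e by simp
  have "0 \<le> dg \<bullet> e"
    by (rule tendsto_lowerbound[OF tendsto_inner[OF dg tendsto_const]])
      (use p t in \<open>auto simp: soc_pair_def qcone_def less_imp_le intro!: always_eventually\<close>)
  moreover have "0 < y \<bullet> e" using y qcone_head_pos[OF e] by blast
  moreover have "0 \<le> dy \<bullet> rfl e y"
  proof (rule tendsto_lowerbound[OF tendsto_inner[OF dy tendsto_const]])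
    have "0 \<le> y' k \<bullet> rfl e y" for k
      using p[of k] y e by (intro qcone_inner_nonneg[OF e]) (auto simp: soc_pair_def)
    then show "\<forall>\<^sub>F k in sequentially. 0 \<le> (1 / t k) *\<^sub>R (y' k - y) \<bullet> rfl e y"
      using t y(3) by (intro always_eventually allI) (simp add: inner_simps less_imp_le)
  qed simp
  ultimately show "block_rel e {0} (rfl e y) 0 dy dg"
    unfolding block_rel_def using dg_eq by (auto intro!: exI[of _ "(dg \<bullet> e) / (y \<bullet> e)"])
qed

text \<open>The mirror image of \<open>const_tangent_outward\<close> under exchange of
  \<open>y\<close> and \<open>g\<close>. The inequality for \<open>dg\<close> becomes its splitting
  into a tangential part and a nonnegative multiple of the inner normal R g.\<close>

lemma const_tangent_inward:
  assumes g: "g \<noteq> 0" "g \<in> qcone e" "g \<bullet> rfl e g = 0" "g \<in> V"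
  shows "const_tangent V e 0 g (V \<inter> {w. w \<bullet> rfl e g = 0}) (rfl e g) 0"
  unfolding const_tangent_def
proof (intro allI impI)
  fix t y' g' dy dg
  assume h: "\<forall>k::nat. 0 < t k \<and> y' k \<in> V \<and> g' k \<in> V \<and> soc_pair e (y' k) (g' k)" "t \<longlonglongrightarrow> 0"
    and dy: "(\<lambda>k. (1 / t k) *\<^sub>R (y' k - 0)) \<longlonglongrightarrow> dy" and dg: "(\<lambda>k. (1 / t k) *\<^sub>R (g' k - g)) \<longlonglongrightarrow> dg"
  have t: "\<And>k. 0 < t k" by (use h in auto)
  have "const_tangent V e g 0 {0} (rfl e g) 0" using const_tangent_outward g by blast
  then have "block_rel e {0} (rfl e g) 0 dg dy"
    unfolding const_tangent_def
    by (elim allE[of _ t] allE[of _ g'] allE[of _ y'] allE[of _ dg] allE[of _ dy])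
      (use h dy dg in \<open>simp add: soc_pair_commute[OF e, of "y' _"]\<close>)
  then obtain \<sigma> where \<sigma>: "0 \<le> \<sigma>" "dy = \<sigma> *\<^sub>R rfl e g" and d: "0 \<le> dg \<bullet> rfl e g"
    by (auto simp: block_rel_def)
  have dgV: "dg \<in> V"
    by (rule limit_quotient_in_subspace[OF _ _ dg]) (use h g in auto)
  have gg: "rfl e g \<bullet> rfl e g = g \<bullet> g" "0 < g \<bullet> g"
    using rfl_inner_rfl[OF e, of g g] g(1) by auto
  define \<tau> where "\<tau> = (dg \<bullet> rfl e g) / (g \<bullet> g)"
  have "0 \<le> \<tau>" using d gg by (simp add: \<tau>_def)
  moreover have "dg - \<tau> *\<^sub>R rfl e g \<in> V \<inter> {w. w \<bullet> rfl e g = 0}"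
    using dgV gg V rfl_in_subspace[OF g(4)]
    by (simp add: inner_simps \<tau>_def subspace_diff subspace_scale)
  ultimately show "block_rel e (V \<inter> {w. w \<bullet> rfl e g = 0}) (rfl e g) 0 dy dg"
    unfolding block_rel_def using \<sigma> gg by (auto simp: inner_commute)
qed

lemma strict_middle:
  fixes t :: "nat \<Rightarrow> real"
  assumes t: "\<And>k. 0 < t k"
    and y1: "y1 \<longlonglongrightarrow> y" and g1: "g1 \<longlonglongrightarrow> g" and y2: "y2 \<longlonglongrightarrow> y" and g2: "g2 \<longlonglongrightarrow> g"
    and dy: "(\<lambda>k. (1 / t k) *\<^sub>R (y2 k - y1 k)) \<longlonglongrightarrow> dy"
    and dg: "(\<lambda>k. (1 / t k) *\<^sub>R (g2 k - g1 k)) \<longlonglongrightarrow> dg"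
    and p1: "\<And>k. soc_pair e (y1 k) (g1 k)" and p2: "\<And>k. soc_pair e (y2 k) (g2 k)"
    and ne: "y \<noteq> 0" "g \<noteq> 0" and p: "soc_pair e y g"
  shows "dg \<bullet> rfl e g = 0" "\<exists>\<rho>. dy = \<rho> *\<^sub>R rfl e g + ((y \<bullet> e) / (g \<bullet> e)) *\<^sub>R rfl e dg"
proof -
  show "dg \<bullet> rfl e g = 0"
    by (rule quotient_boundary[OF e t g1 y1 g2 y2 dg dy])
      (use p1 p2 soc_pair_commute[OF e] eventually_nonzero[OF e t g1 y1 g2 y2 dg dy _ _ ne(1)] in auto)
  show "\<exists>\<rho>. dy = \<rho> *\<^sub>R rfl e g + ((y \<bullet> e) / (g \<bullet> e)) *\<^sub>R rfl e dg"
    by (rule exI, rule quotient_nonzero[OF e t g1 y1 g2 y2 dg dy _ _ ne(2)])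
      (use p1 p2 soc_pair_commute[OF e] in auto)
qed

text \<open>Strict complementarity on the boundary: \<open>dg\<close> is tangential to the boundary
  at \<open>g\<close>, and differentiating y = s R g gives \<open>dy\<close> as s R dg plus a
  multiple of the normal R g. The ratio \<open>s\<close> of the heads is the multiplier that scales
  the boundary curvature.\<close>

lemma const_tangent_middle:
  assumes p: "soc_pair e y g" and ne: "y \<noteq> 0" "g \<noteq> 0" and gV: "g \<in> V"
  shows "const_tangent V e y g (V \<inter> {w. w \<bullet> rfl e g = 0}) 0 ((y \<bullet> e) / (g \<bullet> e))"
  unfolding const_tangent_def
proof (intro allI impI)
  fix t y' g' dy dg
  assume h: "\<forall>k::nat. 0 < t k \<and> y' k \<in> V \<and> g' k \<in> V \<and> soc_pair e (y' k) (g' k)" "t \<longlonglongrightarrow> 0"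
    and dy: "(\<lambda>k. (1 / t k) *\<^sub>R (y' k - y)) \<longlonglongrightarrow> dy" and dg: "(\<lambda>k. (1 / t k) *\<^sub>R (g' k - g)) \<longlonglongrightarrow> dg"
  have t: "\<And>k. 0 < t k" and p': "\<And>k. soc_pair e (y' k) (g' k)" using h by auto
  have y': "y' \<longlonglongrightarrow> y" and g': "g' \<longlonglongrightarrow> g"
    by (rule tendsto_of_quotient[OF t h(2) dy tendsto_const] tendsto_of_quotient[OF t h(2) dg tendsto_const])+
  note sm = strict_middle[OF t tendsto_const tendsto_const y' g' dy dg p p' ne p]
  have "dg \<in> V"
    by (rule limit_quotient_in_subspace[OF _ _ dg]) (use h gV in auto)
  then show "block_rel e (V \<inter> {w. w \<bullet> rfl e g = 0}) 0 ((y \<bullet> e) / (g \<bullet> e)) dy dg"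
    unfolding block_rel_def using sm by (auto simp: inner_simps inner_commute)
qed

lemma const_tangent_interior:
  assumes "g \<in> qcone e" "0 < g \<bullet> rfl e g" "g \<in> V"
  shows "const_tangent V e 0 g V 0 0"
  unfolding const_tangent_def
proof (intro allI impI)
  fix t y' g' dy dg
  assume h: "\<forall>k::nat. 0 < t k \<and> y' k \<in> V \<and> g' k \<in> V \<and> soc_pair e (y' k) (g' k)" "t \<longlonglongrightarrow> 0"
    and dy: "(\<lambda>k. (1 / t k) *\<^sub>R (y' k - 0)) \<longlonglongrightarrow> dy" and dg: "(\<lambda>k. (1 / t k) *\<^sub>R (g' k - g)) \<longlonglongrightarrow> dg"
  have t: "\<And>k. 0 < t k" and p': "\<And>k. soc_pair e (y' k) (g' k)" using h by auto
  have y': "y' \<longlonglongrightarrow> 0" and g': "g' \<longlonglongrightarrow> g"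
    by (rule tendsto_of_quotient[OF t h(2) dy tendsto_const] tendsto_of_quotient[OF t h(2) dg tendsto_const])+
  have "dy = 0"
    by (rule quotient_interior[OF e t tendsto_const tendsto_const g' y' dg dy _ _ assms(2)])
      (use p' soc_pair_commute[OF e] assms(1) e in auto)
  moreover have "dg \<in> V"
    by (rule limit_quotient_in_subspace[OF _ _ dg]) (use h assms(3) in auto)
  ultimately show "block_rel e V 0 0 dy dg" by (auto simp: block_rel_def)
qed

text \<open>The block is one-dimensional (\<open>r j = 0\<close>) and its cone a half-line, so a
  single jump leads from {0} to the whole block.\<close>

lemma const_tangent_zero_line:
  assumes "V \<subseteq> range (\<lambda>c. c *\<^sub>R e)"
  shows "const_tangent V e 0 0 {0} e 0"
  unfolding const_tangent_def
proof (intro allI impI)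
  fix t y' g' dy dg
  assume h: "\<forall>k::nat. 0 < t k \<and> y' k \<in> V \<and> g' k \<in> V \<and> soc_pair e (y' k) (g' k)" "t \<longlonglongrightarrow> 0"
    and dy: "(\<lambda>k. (1 / t k) *\<^sub>R (y' k - 0)) \<longlonglongrightarrow> dy" and dg: "(\<lambda>k. (1 / t k) *\<^sub>R (g' k - 0)) \<longlonglongrightarrow> dg"
  have "0 \<le> dy \<bullet> e"
    by (rule tendsto_lowerbound[OF tendsto_inner[OF dy tendsto_const]])
      (use h in \<open>auto simp: soc_pair_def qcone_def less_imp_le intro!: always_eventually\<close>)
  moreover have dge: "0 \<le> dg \<bullet> e"
    by (rule tendsto_lowerbound[OF tendsto_inner[OF dg tendsto_const]])
      (use h in \<open>auto simp: soc_pair_def qcone_def less_imp_le intro!: always_eventually\<close>)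
  moreover have "dg \<in> V"
    by (rule limit_quotient_in_subspace[OF _ _ dg]) (use h V in \<open>auto simp: subspace_0\<close>)
  then have "dg = (dg \<bullet> e) *\<^sub>R e" using assms inner_unit[OF e] by auto
  ultimately show "block_rel e {0} e 0 dy dg"
    unfolding block_rel_def by (auto intro!: exI[of _ "dg \<bullet> e"])
qed

text \<open>The shift of order \<epsilon> along the axis outweighs the increments of order
  \<epsilon>^2: with y' = y + \<epsilon> w and \<open>w\<close> tending to \<open>e\<close>, all
  terms of the expanded Lorentz form are nonnegative and the last one is positive.\<close>

lemma eventually_interior:
  fixes \<epsilon> :: "nat \<Rightarrow> real"
  assumes "y \<in> qcone e" "\<And>k. 0 < \<epsilon> k" "\<epsilon> \<longlonglongrightarrow> 0"
    and dy: "(\<lambda>k. (1 / (\<epsilon> k)\<^sup>2) *\<^sub>R (y' k - (y + \<epsilon> k *\<^sub>R e))) \<longlonglongrightarrow> dy"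
  shows "\<forall>\<^sub>F k in sequentially. 0 < y' k \<bullet> rfl e (y' k)"
proof -
  define w where "w k = e + \<epsilon> k *\<^sub>R ((1 / (\<epsilon> k)\<^sup>2) *\<^sub>R (y' k - (y + \<epsilon> k *\<^sub>R e)))" for k
  have y': "y' k = y + \<epsilon> k *\<^sub>R w k" for k
    using assms(2)[of k] by (simp add: w_def scaleR_add_right power2_eq_square)
  have "w \<longlonglongrightarrow> e + 0 *\<^sub>R dy" unfolding w_def by (intro tendsto_intros assms)
  then have w: "w \<longlonglongrightarrow> e" by simp
  have "(\<lambda>k. w k \<bullet> rfl e (w k)) \<longlonglongrightarrow> e \<bullet> rfl e e" "(\<lambda>k. w k \<bullet> e) \<longlonglongrightarrow> e \<bullet> e"
    by (intro tendsto_intros w)+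
  then have "\<forall>\<^sub>F k in sequentially. 0 < w k \<bullet> rfl e (w k)" "\<forall>\<^sub>F k in sequentially. 0 < w k \<bullet> e"
    using e inner_unit[OF e] by (auto intro: order_tendstoD(1))
  then show ?thesis
  proof eventually_elim
    case (elim k)
    then have "w k \<in> qcone e" by (simp add: qcone_def)
    then have "0 \<le> y \<bullet> rfl e (w k)" using assms(1) e by (intro qcone_inner_nonneg[OF e]) auto
    moreover have "0 \<le> y \<bullet> rfl e y" using assms(1) by (simp add: qcone_def)
    moreover have "y' k \<bullet> rfl e (y' k) = y \<bullet> rfl e y + 2 * \<epsilon> k * (y \<bullet> rfl e (w k)) + \<epsilon> k * \<epsilon> k * (w k \<bullet> rfl e (w k))"
      unfolding y' using rfl_inner_commute[of e y "w k"]
      by (simp add: rfl_add rfl_scaleR inner_simps inner_commute algebra_simps)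
    ultimately show ?case using elim assms(2)[of k]
      by (simp add: add_nonneg_pos less_imp_le)
  qed
qed

lemma family_unit_shift:
  assumes "y \<in> qcone e" "y \<in> V"
  shows "tangent_family V e y 0 e 0 {0} 0 0"
  unfolding tangent_family_def
proof (intro conjI allI impI)
  fix \<epsilon> y' g' dy dg
  assume h: "\<forall>k::nat. 0 < \<epsilon> k \<and> y' k \<in> V \<and> g' k \<in> V \<and> soc_pair e (y' k) (g' k)" "\<epsilon> \<longlonglongrightarrow> 0"
    and dy: "(\<lambda>k. (1 / (\<epsilon> k)\<^sup>2) *\<^sub>R (y' k - (y + \<epsilon> k *\<^sub>R e))) \<longlonglongrightarrow> dy"
    and dg: "(\<lambda>k. (1 / (\<epsilon> k)\<^sup>2) *\<^sub>R (g' k - (0 + \<epsilon> k *\<^sub>R 0))) \<longlonglongrightarrow> dg"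
  have "\<forall>\<^sub>F k in sequentially. 0 < y' k \<bullet> rfl e (y' k)"
    by (rule eventually_interior[OF assms(1) _ h(2) dy]) (use h in auto)
  then have "\<forall>\<^sub>F k in sequentially. (1 / (\<epsilon> k)\<^sup>2) *\<^sub>R (g' k - (0 + \<epsilon> k *\<^sub>R 0)) = 0"
    by eventually_elim (use h(1) soc_pair_interior[OF e] in fastforce)
  from Lim_transform_eventually[OF dg this] have "dg = 0" by (simp add: LIMSEQ_const_iff)
  then show "block_rel e {0} 0 0 dy dg" by (auto simp: block_rel_def)
qed (use assms e V eV qcone_add[OF e assms(1) qcone_scaleR[OF e unit_in_qcone[OF e]]] in \<open>auto simp: subspace_0\<close>)

text \<open>Shifting the vanishing partner along R y makes the pair strictly complementary, and
  increments of order \<epsilon>^2 cannot undo this. As the head of the shift tends to 0, the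
  curvature term disappears from the limit, which leaves a linear relation with
  \<open>s = 0\<close>.\<close>

lemma family_boundary_shift:
  assumes y: "y \<noteq> 0" "y \<in> qcone e" "y \<bullet> rfl e y = 0" "y \<in> V"
  shows "tangent_family V e y 0 0 (rfl e y) (range (\<lambda>c. c *\<^sub>R rfl e y)) 0 0"
    and "tangent_family V e 0 y (rfl e y) 0 (V \<inter> {w. w \<bullet> rfl e y = 0}) 0 0"
proof -
  have main: "dy \<bullet> rfl e y = 0 \<and> (\<exists>\<rho>. dg = \<rho> *\<^sub>R rfl e y) \<and> dy \<in> V"
    if h: "\<forall>k::nat. 0 < \<epsilon> k \<and> y' k \<in> V \<and> g' k \<in> V \<and> soc_pair e (y' k) (g' k)" "\<epsilon> \<longlonglongrightarrow> 0"
      and dy: "(\<lambda>k. (1 / (\<epsilon> k)\<^sup>2) *\<^sub>R (y' k - (y + \<epsilon> k *\<^sub>R 0))) \<longlonglongrightarrow> dy"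
      and dg: "(\<lambda>k. (1 / (\<epsilon> k)\<^sup>2) *\<^sub>R (g' k - (0 + \<epsilon> k *\<^sub>R rfl e y))) \<longlonglongrightarrow> dg"
    for \<epsilon> y' g' dy dg
  proof -
    have t: "\<And>k. 0 < (\<epsilon> k)\<^sup>2" and p': "\<And>k. soc_pair e (y' k) (g' k)"
      by (rule zero_less_power; use h(1) in blast) (use h(1) in blast)
    have t0: "(\<lambda>k. (\<epsilon> k)\<^sup>2) \<longlonglongrightarrow> 0" using tendsto_power[OF h(2), of 2] by simp
    define g1 where "g1 k = \<epsilon> k *\<^sub>R rfl e y" for k
    have "g1 \<longlonglongrightarrow> 0 *\<^sub>R rfl e y" unfolding g1_def by (intro tendsto_intros h)
    then have g1: "g1 \<longlonglongrightarrow> 0" by simp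
    have p1: "soc_pair e y (g1 k)" for k
      unfolding g1_def using y h(1) by (intro soc_pair_rfl[OF e]) (auto simp: less_imp_le)
    have dg1: "(\<lambda>k. (1 / (\<epsilon> k)\<^sup>2) *\<^sub>R (g' k - g1 k)) \<longlonglongrightarrow> dg" using dg by (simp add: g1_def)
    have dy1: "(\<lambda>k. (1 / (\<epsilon> k)\<^sup>2) *\<^sub>R (y' k - y)) \<longlonglongrightarrow> dy" using dy by simp
    have y': "y' \<longlonglongrightarrow> y" and g': "g' \<longlonglongrightarrow> 0"
      by (rule tendsto_of_quotient[OF t t0 dy1 tendsto_const] tendsto_of_quotient[OF t t0 dg1 g1])+
    have "\<exists>\<rho>. dg = \<rho> *\<^sub>R rfl e y"
      using quotient_nonzero[OF e t tendsto_const g1 y' g' dy1 dg1 p1 p' y(1)] by auto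
    moreover have "dy \<bullet> rfl e y = 0"
    proof (rule quotient_boundary[OF e t tendsto_const g1 y' g' dy1 dg1 p1 p'])
      have "(\<lambda>k. rfl e y + \<epsilon> k *\<^sub>R ((1 / (\<epsilon> k)\<^sup>2) *\<^sub>R (g' k - g1 k))) \<longlonglongrightarrow> rfl e y + 0 *\<^sub>R dg"
        by (intro tendsto_intros dg1 h)
      moreover have "rfl e y \<noteq> 0" using y(1) e by (metis rfl_rfl rfl_zero)
      ultimately have "\<forall>\<^sub>F k in sequentially. rfl e y + \<epsilon> k *\<^sub>R ((1 / (\<epsilon> k)\<^sup>2) *\<^sub>R (g' k - g1 k)) \<noteq> 0"
        by (intro tendsto_imp_eventually_ne) auto
      then show "\<forall>\<^sub>F k in sequentially. y \<bullet> rfl e y = 0 \<and> y' k \<bullet> rfl e (y' k) = 0"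
      proof eventually_elim
        case (elim k)
        have "g' k \<noteq> 0"
        proof
          assume "g' k = 0"
          then show False using elim h(1)[rule_format, of k] by (simp add: g1_def power2_eq_square)
        qed
        then show ?case using y(3) p'[of k] soc_pair_boundary[OF e] by blast
      qed
    qed
    moreover have "dy \<in> V"
      by (rule limit_quotient_in_subspace[OF _ _ dy1]) (use h y in auto)
    ultimately show ?thesis by blast
  qed
  have pair: "soc_pair e y (\<epsilon> *\<^sub>R rfl e y)" if "0 < \<epsilon>" for \<epsilon>
    using y that by (intro soc_pair_rfl[OF e]) (auto simp: less_imp_le)
  show "tangent_family V e y 0 0 (rfl e y) (range (\<lambda>c. c *\<^sub>R rfl e y)) 0 0"
    unfolding tangent_family_def
  proof (intro conjI allI impI)
    fix \<epsilon> y' g' dy dg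
    assume h: "\<forall>k::nat. 0 < \<epsilon> k \<and> y' k \<in> V \<and> g' k \<in> V \<and> soc_pair e (y' k) (g' k)" "\<epsilon> \<longlonglongrightarrow> 0"
      and dy: "(\<lambda>k. (1 / (\<epsilon> k)\<^sup>2) *\<^sub>R (y' k - (y + \<epsilon> k *\<^sub>R 0))) \<longlonglongrightarrow> dy"
      and dg: "(\<lambda>k. (1 / (\<epsilon> k)\<^sup>2) *\<^sub>R (g' k - (0 + \<epsilon> k *\<^sub>R rfl e y))) \<longlonglongrightarrow> dg"
    show "block_rel e (range (\<lambda>c. c *\<^sub>R rfl e y)) 0 0 dy dg"
      using main[OF h dy dg] by (auto simp: block_rel_def intro: exI[of _ 0])
  qed (use pair V rfl_in_subspace[OF y(4)] in \<open>auto simp: subspace_0\<close>)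
  show "tangent_family V e 0 y (rfl e y) 0 (V \<inter> {w. w \<bullet> rfl e y = 0}) 0 0"
    unfolding tangent_family_def
  proof (intro conjI allI impI)
    fix \<epsilon> y' g' dy dg
    assume h: "\<forall>k::nat. 0 < \<epsilon> k \<and> y' k \<in> V \<and> g' k \<in> V \<and> soc_pair e (y' k) (g' k)" "\<epsilon> \<longlonglongrightarrow> 0"
      and dy: "(\<lambda>k. (1 / (\<epsilon> k)\<^sup>2) *\<^sub>R (y' k - (0 + \<epsilon> k *\<^sub>R rfl e y))) \<longlonglongrightarrow> dy"
      and dg: "(\<lambda>k. (1 / (\<epsilon> k)\<^sup>2) *\<^sub>R (g' k - (y + \<epsilon> k *\<^sub>R 0))) \<longlonglongrightarrow> dg"
    have "\<forall>k. 0 < \<epsilon> k \<and> g' k \<in> V \<and> y' k \<in> V \<and> soc_pair e (g' k) (y' k)"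
      using h(1) soc_pair_commute[OF e] by blast
    then show "block_rel e (V \<inter> {w. w \<bullet> rfl e y = 0}) 0 0 dy dg"
      using main[OF _ h(2) dg dy] by (auto simp: block_rel_def inner_commute intro: exI[of _ 0])
  qed (use pair V rfl_in_subspace[OF y(4)] soc_pair_commute[OF e] in \<open>auto simp: subspace_0\<close>)
qed

lemma family_unit_shift_dual:
  assumes "g \<in> qcone e" "g \<in> V"
  shows "tangent_family V e 0 g 0 e V 0 0"
  unfolding tangent_family_def
proof (intro conjI allI impI)
  fix \<epsilon> y' g' dy dg
  assume h: "\<forall>k::nat. 0 < \<epsilon> k \<and> y' k \<in> V \<and> g' k \<in> V \<and> soc_pair e (y' k) (g' k)" "\<epsilon> \<longlonglongrightarrow> 0"
    and dy: "(\<lambda>k. (1 / (\<epsilon> k)\<^sup>2) *\<^sub>R (y' k - (0 + \<epsilon> k *\<^sub>R 0))) \<longlonglongrightarrow> dy"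
    and dg: "(\<lambda>k. (1 / (\<epsilon> k)\<^sup>2) *\<^sub>R (g' k - (g + \<epsilon> k *\<^sub>R e))) \<longlonglongrightarrow> dg"
  have "\<forall>k. 0 < \<epsilon> k \<and> g' k \<in> V \<and> y' k \<in> V \<and> soc_pair e (g' k) (y' k)"
    using h(1) soc_pair_commute[OF e] by blast
  then have "block_rel e {0} 0 0 dg dy"
    using family_unit_shift[OF assms] h(2) dy dg unfolding tangent_family_def by blast
  moreover have "dg \<in> V"
    by (rule limit_quotient_in_subspace[OF _ _ dg])
      (use h assms V eV in \<open>auto simp: subspace_add subspace_scale\<close>)
  ultimately show "block_rel e V 0 0 dy dg" by (auto simp: block_rel_def)
qed (use assms e V eV qcone_add[OF e assms(1) qcone_scaleR[OF e unit_in_qcone[OF e]]] in \<open>auto simp: subspace_0\<close>)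

end

section \<open>Initial and final tangent spaces\<close>

text \<open>If the Lorentz form were nonnegative at a nonzero \<open>z\<close>, then
  \<open>z\<close> or \<open>- z\<close> would be complementary to \<open>y\<close>; this puts
  \<open>z\<close> on the line of R y and makes the form vanish there.\<close>

lemma qcone_orthogonal_boundary:
  assumes e: "norm e = 1" and y: "y \<noteq> 0" "y \<in> qcone e" and z: "z \<bullet> y = 0"
  shows "z \<bullet> rfl e z \<le> 0" and "z \<bullet> rfl e z = 0 \<Longrightarrow> z \<in> range (\<lambda>c. c *\<^sub>R rfl e y)"
proof -
  have *: "z \<in> range (\<lambda>c. c *\<^sub>R rfl e y) \<and> z \<bullet> rfl e z = 0" if nn: "0 \<le> z \<bullet> rfl e z"
  proof (cases "z = 0")
    case False
    define w where "w = (if 0 \<le> z \<bullet> e then z else - z)"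
    have "w \<in> qcone e" using nn by (auto simp: w_def qcone_def rfl_minus)
    moreover have "y \<bullet> w = 0" using z by (simp add: w_def inner_commute)
    ultimately have p: "soc_pair e y w" using y by (simp add: soc_pair_def)
    have "z = w \<or> z = - w" by (auto simp: w_def)
    then have "z \<in> range (\<lambda>c. c *\<^sub>R rfl e y)"
      using soc_pair_eq[OF e p y(1)] by (metis rangeI scaleR_minus_left)
    moreover have "w \<bullet> rfl e w = 0"
      using soc_pair_boundary[OF e, of w y] p y soc_pair_commute[OF e] by blast
    then have "z \<bullet> rfl e z = 0" using \<open>z = w \<or> z = - w\<close> by (auto simp: rfl_minus)
    ultimately show ?thesis by blast
  qed (auto intro!: image_eqI[of _ _ 0])
  show "z \<bullet> rfl e z \<le> 0" using * by force
  show "z \<in> range (\<lambda>c. c *\<^sub>R rfl e y)" if "z \<bullet> rfl e z = 0" using * that by simp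
qed

text \<open>For a complementary pair, the lineality space of the tangent cone at \<open>g\<close>,
  taken within the block \<open>V\<close>.\<close>

definition init_space :: "'b::real_inner set \<Rightarrow> 'b \<Rightarrow> 'b \<Rightarrow> 'b \<Rightarrow> 'b set" where
  "init_space V e y g = (if g = 0 then {0} else if y = 0 \<and> g \<bullet> rfl e g \<noteq> 0 then V
     else V \<inter> {w. w \<bullet> rfl e g = 0})"

text \<open>For a complementary pair, the span of the critical cone: of the tangent directions at
  \<open>g\<close> that are orthogonal to \<open>y\<close>.\<close>

definition final_space :: "'b::real_inner set \<Rightarrow> 'b \<Rightarrow> 'b \<Rightarrow> 'b \<Rightarrow> 'b set" where
  "final_space V e y g = (if y = 0 then V else if g \<noteq> 0 then V \<inter> {w. w \<bullet> rfl e g = 0}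
     else if y \<bullet> rfl e y = 0 then range (\<lambda>c. c *\<^sub>R rfl e y) else {0})"

text \<open>A shift of the multiplier only. The constraint value keeps its base point, so the
  solutions at unperturbed constraints are feasible and can be compared with the local
  minimum.\<close>

definition init_shift :: "'b::real_inner \<Rightarrow> 'b \<Rightarrow> 'b \<Rightarrow> 'b" where
  "init_shift e y g = (if g = 0 then e else if y = 0 \<and> g \<bullet> rfl e g = 0 then rfl e g else 0)"

text \<open>The factor \<open>\<dot>y / \<dot>g\<close> vanishes when \<open>g = 0\<close>, by the convention on division by zero.\<close>

definition curvature :: "'b::real_inner \<Rightarrow> 'b \<Rightarrow> 'b \<Rightarrow> real" where
  "curvature e y g = (y \<bullet> e) / (g \<bullet> e)"

lemma curvature_zero [simp]: "curvature e 0 g = 0" "curvature e y 0 = 0"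
  by (simp_all add: curvature_def)

lemma subspace_hyperplane_Int: "subspace V \<Longrightarrow> subspace (V \<inter> {w. w \<bullet> (a::'b::real_inner) = 0})"
  by (rule subspace_inter[OF _ subspace_hyperplane2])

lemma subspace_line: "subspace (range (\<lambda>c::real. c *\<^sub>R (a::'b::real_vector)))"
  by (auto simp: subspace_def image_iff simp flip: scaleR_add_left intro: exI[of _ 0])

context
  fixes V :: "'b::euclidean_space set" and e y g :: 'b
  assumes V: "subspace V" and eV: "e \<in> V" and e: "norm e = 1"
    and yV: "y \<in> V" and gV: "g \<in> V" and pair: "soc_pair e y g"
begin

lemma subspace_init: "subspace (init_space V e y g)"
  and subspace_final: "subspace (final_space V e y g)"
  using V by (simp_all add: init_space_def final_space_def subspace_hyperplane_Int subspace_line)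

lemma init_family:
  "tangent_family V e y g (init_shift e y g) 0 (init_space V e y g) 0 (curvature e y g)"
proof -
  have cone: "y \<in> qcone e" "g \<in> qcone e" using pair by (auto simp: soc_pair_def)
  consider "g = 0" | "g \<noteq> 0" "y \<noteq> 0" | "g \<noteq> 0" "y = 0" "g \<bullet> rfl e g = 0"
    | "g \<noteq> 0" "y = 0" "g \<bullet> rfl e g \<noteq> 0" by blast
  then show ?thesis
  proof cases
    case 1
    then show ?thesis using family_unit_shift[OF V eV e cone(1) yV] by (simp add: init_shift_def init_space_def)
  next
    case 2
    then show ?thesis
      using const_tangent_family[OF V eV e const_tangent_middle[OF V eV e pair 2(2,1) gV] pair]
      by (simp add: init_shift_def init_space_def curvature_def)
  next
    case 3
    then show ?thesis
      using family_boundary_shift(2)[OF V eV e 3(1) cone(2) 3(3) gV] by (simp add: init_shift_def init_space_def)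
  next
    case 4
    then have "0 < g \<bullet> rfl e g" using cone by (auto simp: qcone_def)
    then show ?thesis
      using const_tangent_family[OF V eV e const_tangent_interior[OF V eV e cone(2) _ gV]] pair 4
      by (simp add: init_shift_def init_space_def)
  qed
qed

lemma final_family:
  "\<exists>p q. tangent_family V e y g p q (final_space V e y g) 0 (curvature e y g)"
proof -
  have cone: "y \<in> qcone e" "g \<in> qcone e" using pair by (auto simp: soc_pair_def)
  consider "y = 0" | "y \<noteq> 0" "g \<noteq> 0" | "y \<noteq> 0" "g = 0" "y \<bullet> rfl e y = 0"
    | "y \<noteq> 0" "g = 0" "y \<bullet> rfl e y \<noteq> 0" by blast
  then show ?thesis
  proof cases
    case 1
    then show ?thesis using family_unit_shift_dual[OF V eV e cone(2) gV] by (auto simp: final_space_def)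
  next
    case 2
    then show ?thesis
      using const_tangent_family[OF V eV e const_tangent_middle[OF V eV e pair 2 gV] pair]
      by (auto simp: final_space_def curvature_def)
  next
    case 3
    then show ?thesis
      using family_boundary_shift(1)[OF V eV e 3(1) cone(1) 3(3) yV] by (auto simp: final_space_def)
  next
    case 4
    then show ?thesis
      using family_unit_shift[OF V eV e cone(1) yV] by (auto simp: final_space_def)
  qed
qed

text \<open>In the strict case \<open>y\<close> is a multiple of R g and \<open>g'\<close> stays on
  the boundary, so the Lorentz form of \<open>g' - g\<close> equals -2 times the pairing of R g with
  \<open>g'\<close>. When \<open>g = 0\<close>, the shift along the axis forces \<open>g'\<close> to
  vanish eventually. This limit supplies the curvature correction of the Hessian.\<close>

lemma init_curvature_limit:
  fixes \<epsilon> :: "nat \<Rightarrow> real"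
  assumes h: "\<And>k. 0 < \<epsilon> k \<and> y' k \<in> V \<and> g' k \<in> V \<and> soc_pair e (y' k) (g' k)" and \<epsilon>: "\<epsilon> \<longlonglongrightarrow> 0"
    and dy: "(\<lambda>k. (1 / (\<epsilon> k)\<^sup>2) *\<^sub>R (y' k - (y + \<epsilon> k *\<^sub>R init_shift e y g))) \<longlonglongrightarrow> dy"
    and dg: "(\<lambda>k. (1 / (\<epsilon> k)\<^sup>2) *\<^sub>R (g' k - g)) \<longlonglongrightarrow> dg"
  shows "(\<lambda>k. (y \<bullet> g' k) / ((\<epsilon> k)\<^sup>2)\<^sup>2) \<longlonglongrightarrow> - (1 / 2) * (curvature e y g * (dg \<bullet> rfl e dg))"
proof -
  have t: "\<And>k. 0 < (\<epsilon> k)\<^sup>2" by (rule zero_less_power) (use h in blast)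
  have t0: "(\<lambda>k. (\<epsilon> k)\<^sup>2) \<longlonglongrightarrow> 0" using tendsto_power[OF \<epsilon>, of 2] by simp
  have cone: "y \<in> qcone e" "g \<in> qcone e" using pair by (auto simp: soc_pair_def)
  consider "g = 0" | "y = 0" | "g \<noteq> 0" "y \<noteq> 0" by blast
  then show ?thesis
  proof cases
    case 1
    then have "\<forall>\<^sub>F k in sequentially. 0 < y' k \<bullet> rfl e (y' k)"
      using eventually_interior[OF V eV e cone(1) _ \<epsilon>, of y' dy] h dy by (simp add: init_shift_def)
    then have "\<forall>\<^sub>F k in sequentially. (y \<bullet> g' k) / ((\<epsilon> k)\<^sup>2)\<^sup>2 = 0"
      by eventually_elim (use h soc_pair_interior[OF e] in fastforce)
    then show ?thesis using 1 by (simp add: tendsto_eventually)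
  next
    case 2
    then show ?thesis by simp
  next
    case 3
    define c where "c = curvature e y g"
    have y_eq: "y = c *\<^sub>R rfl e g"
      unfolding c_def curvature_def using soc_pair_eq[OF e] pair 3 soc_pair_commute[OF e] by blast
    have gg: "g \<bullet> rfl e g = 0"
      using pair 3 soc_pair_commute[OF e] soc_pair_boundary[OF e] by blast
    have "(\<lambda>k. y + \<epsilon> k *\<^sub>R init_shift e y g) \<longlonglongrightarrow> y + 0 *\<^sub>R init_shift e y g"
      by (intro tendsto_intros \<epsilon>)
    then have y': "y' \<longlonglongrightarrow> y" by (intro tendsto_of_quotient[OF t t0 dy]) simp
    have "\<forall>\<^sub>F k in sequentially. y' k \<noteq> 0" by (rule tendsto_imp_eventually_ne[OF y' 3(2)])
    then have ev: "\<forall>\<^sub>F k in sequentially. - (1 / 2) * (c * ((1 / (\<epsilon> k)\<^sup>2) *\<^sub>R (g' k - g) \<bullet> rfl e ((1 / (\<epsilon> k)\<^sup>2) *\<^sub>R (g' k - g))))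
        = (y \<bullet> g' k) / ((\<epsilon> k)\<^sup>2)\<^sup>2"
    proof eventually_elim
      case (elim k)
      then have "g' k \<bullet> rfl e (g' k) = 0"
        using h[of k] soc_pair_commute[OF e] soc_pair_boundary[OF e] by blast
      then have "(g' k - g) \<bullet> rfl e (g' k - g) = - 2 * (rfl e g \<bullet> g' k)"
        using gg rfl_inner_commute[of e g "g' k"] by (simp add: rfl_diff inner_simps inner_commute)
      then show ?case
        by (simp add: y_eq rfl_scaleR power2_eq_square)
    qed
    show ?thesis
      unfolding c_def[symmetric]
      by (rule Lim_transform_eventually[OF _ ev]) (intro tendsto_intros dg)
  qed
qed

end

section \<open>Second-order systems over products of cones\<close>

text \<open>Mutually annihilating orthogonal projections of a single space stand for a product whose
  number and sizes of factors are no types.\<close>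

locale cone_blocks =
  fixes I :: "'i set" and pr :: "'i \<Rightarrow> 'b::euclidean_space \<Rightarrow> 'b" and e :: "'i \<Rightarrow> 'b"
  assumes finite_blocks: "finite I"
    and linear_pr: "j \<in> I \<Longrightarrow> linear (pr j)"
    and pr_commute: "j \<in> I \<Longrightarrow> pr j y \<bullet> z = y \<bullet> pr j z"
    and pr_pr: "j \<in> I \<Longrightarrow> pr j (pr j y) = pr j y"
    and pr_other: "i \<in> I \<Longrightarrow> j \<in> I \<Longrightarrow> i \<noteq> j \<Longrightarrow> pr i (pr j y) = 0"
    and pr_unit: "j \<in> I \<Longrightarrow> pr j (e j) = e j"
    and norm_unit: "j \<in> I \<Longrightarrow> norm (e j) = 1"
begin

text \<open>The projection onto the equality coordinates, where the constraint value must vanish and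
  the multiplier is free.\<close>

definition pr0 :: "'b \<Rightarrow> 'b" where "pr0 y = y - (\<Sum>j\<in>I. pr j y)"

definition compl :: "'b \<Rightarrow> 'b \<Rightarrow> bool" where
  "compl y g \<longleftrightarrow> pr0 g = 0 \<and> (\<forall>j\<in>I. soc_pair (e j) (pr j y) (pr j g))"

lemma pr_linear [simp]:
  assumes "j \<in> I"
  shows "pr j (x + y) = pr j x + pr j y" "pr j (x - y) = pr j x - pr j y"
    "pr j (c *\<^sub>R x) = c *\<^sub>R pr j x" "pr j 0 = 0"
  using linear_pr[OF assms] by (simp_all add: linear_add linear_diff linear_scale linear_0)

lemma linear_pr0: "linear pr0"
  unfolding pr0_def[abs_def]
  by (intro linear_compose_sub linear_compose_sum ballI linear_pr linear_id[unfolded id_def])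

lemma pr0_linear:
  "pr0 (x + y) = pr0 x + pr0 y" "pr0 (x - y) = pr0 x - pr0 y" "pr0 (c *\<^sub>R x) = c *\<^sub>R pr0 x" "pr0 0 = 0"
  using linear_pr0 by (simp_all add: linear_add linear_diff linear_scale linear_0)

lemma tendsto_pr: "j \<in> I \<Longrightarrow> (f \<longlongrightarrow> l) F \<Longrightarrow> ((\<lambda>x. pr j (f x)) \<longlongrightarrow> pr j l) F"
  using linear_pr linear_conv_bounded_linear bounded_linear.tendsto by blast

lemma subspace_range_pr: "j \<in> I \<Longrightarrow> subspace (range (pr j))"
  using linear_pr linear_subspace_image subspace_UNIV by blast

lemma range_pr_iff: "j \<in> I \<Longrightarrow> y \<in> range (pr j) \<longleftrightarrow> pr j y = y"
  by (metis pr_pr rangeE rangeI)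

lemma unit_in_range: "j \<in> I \<Longrightarrow> e j \<in> range (pr j)"
  by (metis pr_unit rangeI)

lemma inner_blocks: "y \<bullet> z = y \<bullet> pr0 z + (\<Sum>j\<in>I. pr j y \<bullet> pr j z)"
proof -
  have "(\<Sum>j\<in>I. pr j y \<bullet> pr j z) = (\<Sum>j\<in>I. y \<bullet> pr j z)"
    by (intro sum.cong) (simp_all add: pr_commute pr_pr)
  then show ?thesis by (simp add: pr0_def inner_diff_right inner_sum_right)
qed

lemma pr_sum:
  assumes "\<And>j. j \<in> I \<Longrightarrow> p j \<in> range (pr j)"
  shows "i \<in> I \<Longrightarrow> pr i (\<Sum>j\<in>I. p j) = p i" and "pr0 (\<Sum>j\<in>I. p j) = 0"
proof -
  have *: "pr i (\<Sum>j\<in>I. p j) = p i" if "i \<in> I" for i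
  proof -
    have "pr i (\<Sum>j\<in>I. p j) = (\<Sum>j\<in>I. pr i (p j))" using linear_sum[OF linear_pr[OF that]] by simp
    also have "\<dots> = (\<Sum>j\<in>I. if j = i then p i else 0)"
      by (intro sum.cong) (use assms that pr_other range_pr_iff in \<open>auto simp: image_iff, metis\<close>)
    also have "\<dots> = p i" using that finite_blocks by simp
    finally show ?thesis .
  qed
  then show "i \<in> I \<Longrightarrow> pr i (\<Sum>j\<in>I. p j) = p i" by blast
  show "pr0 (\<Sum>j\<in>I. p j) = 0" unfolding pr0_def using * by simp
qed

end

text \<open>Here \<open>A\<close>, \<open>At\<close> and \<open>H\<close> are the constraint Jacobian, its adjoint and the Hessian of the
  Lagrangian at a KKT point with multiplier \<open>ys\<close> and constraint value \<open>gs\<close>. The last assumption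
  is what the Aubin property yields at perturbed base points \<open>(ys + \<epsilon> p, gs + \<epsilon> q)\<close>; its last
  clause reflects that unperturbed constraints produce feasible points.\<close>

locale solvable_system = cone_blocks I pr e
  for I :: "'i set" and pr :: "'i \<Rightarrow> 'b::euclidean_space \<Rightarrow> 'b" and e +
  fixes H :: "'a::euclidean_space \<Rightarrow> 'a" and A :: "'a \<Rightarrow> 'b" and At :: "'b \<Rightarrow> 'a" and ys gs :: 'b
  assumes linear_H: "linear H" and H_sym: "x \<bullet> H z = z \<bullet> H x"
    and linear_A: "linear A" and linear_At: "linear At" and adjoint: "A x \<bullet> y = x \<bullet> At y"
    and base: "compl ys gs"
    and solvable: "\<forall>\<epsilon>>0. compl (ys + \<epsilon> *\<^sub>R p) (gs + \<epsilon> *\<^sub>R q) \<Longrightarrow>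
      \<exists>\<epsilon> y' g' x dy. (\<forall>k::nat. 0 < \<epsilon> k \<and> compl (y' k) (g' k)) \<and> \<epsilon> \<longlonglongrightarrow> 0 \<and>
        (\<lambda>k. (1 / (\<epsilon> k)\<^sup>2) *\<^sub>R (y' k - (ys + \<epsilon> k *\<^sub>R p))) \<longlonglongrightarrow> dy \<and>
        (\<lambda>k. (1 / (\<epsilon> k)\<^sup>2) *\<^sub>R (g' k - (gs + \<epsilon> k *\<^sub>R q))) \<longlonglongrightarrow> A x - b \<and>
        a = H x - At dy \<and>
        (q = 0 \<and> b = 0 \<longrightarrow> (\<forall>l. (\<lambda>k. (ys \<bullet> g' k) / ((\<epsilon> k)\<^sup>2)\<^sup>2) \<longlonglongrightarrow> l \<longrightarrow> 0 \<le> (1 / 2) * (x \<bullet> H x) + l))"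
begin

abbreviation "family j \<equiv> tangent_family (range (pr j)) (e j) (pr j ys) (pr j gs)"
abbreviation "spaceI j \<equiv> init_space (range (pr j)) (e j) (pr j ys) (pr j gs)"
abbreviation "spaceF j \<equiv> final_space (range (pr j)) (e j) (pr j ys) (pr j gs)"
abbreviation "curv j \<equiv> curvature (e j) (pr j ys) (pr j gs)"

text \<open>The Hessian of the Lagrangian with the curvature terms of the blocks; for
  \<open>s = curv\<close> it represents the form of the second-order conditions, sigma term
  included.\<close>

definition B :: "('i \<Rightarrow> real) \<Rightarrow> 'a \<Rightarrow> 'a" where
  "B s x = H x - At (\<Sum>j\<in>I. s j *\<^sub>R rfl (e j) (pr j (A x)))"

text \<open>Directions whose linearized constraint lies at level \<tau> along \<open>n\<close> over
  the spaces \<open>E\<close>. Levels add and scale with the directions, which is the grading used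
  by \<open>definite_jump\<close>.\<close>

definition M :: "('i \<Rightarrow> 'b set) \<Rightarrow> ('i \<Rightarrow> 'b) \<Rightarrow> real \<Rightarrow> 'a set" where
  "M E n \<tau> = {d. pr0 (A d) = 0 \<and> (\<forall>j\<in>I. pr j (A d) - \<tau> *\<^sub>R n j \<in> E j)}"

lemma pair_blocks: "j \<in> I \<Longrightarrow> soc_pair (e j) (pr j ys) (pr j gs)"
  using base by (simp add: compl_def)

lemma A_linear [simp]: "A (x + y) = A x + A y" "A (x - y) = A x - A y" "A (c *\<^sub>R x) = c *\<^sub>R A x" "A 0 = 0"
  using linear_A by (simp_all add: linear_add linear_diff linear_scale linear_0)

lemma inner_B: "d \<bullet> B s x = d \<bullet> H x - (\<Sum>j\<in>I. s j * (rfl (e j) (pr j (A x)) \<bullet> pr j (A d)))"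
proof -
  have "(\<Sum>j\<in>I. s j * (A d \<bullet> rfl (e j) (pr j (A x)))) = (\<Sum>j\<in>I. s j * (rfl (e j) (pr j (A x)) \<bullet> pr j (A d)))"
  proof (intro sum.cong refl)
    fix j assume j: "j \<in> I"
    have "rfl (e j) (pr j (A x)) \<in> range (pr j)"
      using rfl_in_subspace[OF subspace_range_pr[OF j] unit_in_range[OF j] norm_unit[OF j]] by simp
    then have "A d \<bullet> rfl (e j) (pr j (A x)) = A d \<bullet> pr j (rfl (e j) (pr j (A x)))"
      using range_pr_iff[OF j] by metis
    also have "\<dots> = rfl (e j) (pr j (A x)) \<bullet> pr j (A d)"
      using pr_commute[OF j] by (metis inner_commute)
    finally show "s j * (A d \<bullet> rfl (e j) (pr j (A x))) = s j * (rfl (e j) (pr j (A x)) \<bullet> pr j (A d))" by simp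
  qed
  then show ?thesis
    by (simp add: B_def inner_diff_right adjoint[symmetric] inner_sum_right)
qed

lemma linear_B: "linear (B s)"
proof -
  define T where "T x = (\<Sum>j\<in>I. s j *\<^sub>R rfl (e j) (pr j (A x)))" for x
  have "linear T"
    by (rule linearI)
      (simp_all add: T_def rfl_add rfl_scaleR scaleR_add_right sum.distrib scaleR_sum_right mult.commute)
  then have "linear (\<lambda>x. H x - At (T x))"
    using linear_compose_sub[OF linear_H linear_compose[OF _ linear_At]] by (simp add: o_def)
  then show ?thesis by (simp add: B_def[abs_def] T_def)
qed

lemma B_sym: "x \<bullet> B s z = z \<bullet> B s x"
proof -
  have "rfl (e j) (pr j (A z)) \<bullet> pr j (A x) = rfl (e j) (pr j (A x)) \<bullet> pr j (A z)" for j
    using rfl_inner_commute inner_commute by metis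
  then show ?thesis unfolding inner_B using H_sym[of x z] by simp
qed

lemma subspace_M: "(\<And>j. j \<in> I \<Longrightarrow> subspace (E j)) \<Longrightarrow> subspace (M E n 0)"
  by (auto simp: M_def subspace_def pr0_linear)

lemma M_add:
  "(\<And>j. j \<in> I \<Longrightarrow> subspace (E j)) \<Longrightarrow> x \<in> M E n s \<Longrightarrow> z \<in> M E n t \<Longrightarrow> x + z \<in> M E n (s + t)"
proof -
  assume E: "\<And>j. j \<in> I \<Longrightarrow> subspace (E j)" and x: "x \<in> M E n s" and z: "z \<in> M E n t"
  have "pr j (A (x + z)) - (s + t) *\<^sub>R n j = (pr j (A x) - s *\<^sub>R n j) + (pr j (A z) - t *\<^sub>R n j)" if "j \<in> I" for j
    using that by (simp add: algebra_simps)
  then show ?thesis using x z E unfolding M_def by (simp add: pr0_linear subspace_add del: A_linear pr_linear) (simp add: pr0_linear)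
qed

lemma M_scale:
  "(\<And>j. j \<in> I \<Longrightarrow> subspace (E j)) \<Longrightarrow> x \<in> M E n s \<Longrightarrow> c *\<^sub>R x \<in> M E n (c * s)"
proof -
  assume E: "\<And>j. j \<in> I \<Longrightarrow> subspace (E j)" and x: "x \<in> M E n s"
  have "pr j (A (c *\<^sub>R x)) - (c * s) *\<^sub>R n j = c *\<^sub>R (pr j (A x) - s *\<^sub>R n j)" if "j \<in> I" for j
    using that by (simp add: algebra_simps)
  then show ?thesis using x E unfolding M_def by (simp add: pr0_linear subspace_scale del: A_linear pr_linear) (simp add: pr0_linear)
qed

text \<open>Shifts chosen independently in the blocks add up to one shift of the whole base point,
  so every combination of blockwise tangent relations is available.\<close>

lemma solve_families:
  assumes fam: "\<And>j. j \<in> I \<Longrightarrow> family j (p j) (q j) (E j) (n j) (s j)"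
  obtains \<epsilon> y' g' x dy where "\<And>k::nat. 0 < \<epsilon> k \<and> compl (y' k) (g' k)" "\<epsilon> \<longlonglongrightarrow> 0"
    "\<And>j. j \<in> I \<Longrightarrow> (\<lambda>k. (1 / (\<epsilon> k)\<^sup>2) *\<^sub>R (pr j (y' k) - (pr j ys + \<epsilon> k *\<^sub>R p j))) \<longlonglongrightarrow> pr j dy"
    "\<And>j. j \<in> I \<Longrightarrow> (\<lambda>k. (1 / (\<epsilon> k)\<^sup>2) *\<^sub>R (pr j (g' k) - (pr j gs + \<epsilon> k *\<^sub>R q j))) \<longlonglongrightarrow> pr j (A x - b)"
    "pr0 (A x - b) = 0" "\<And>j. j \<in> I \<Longrightarrow> block_rel (e j) (E j) (n j) (s j) (pr j dy) (pr j (A x - b))"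
    "a = H x - At dy"
    "\<And>l. (\<And>j. j \<in> I \<Longrightarrow> q j = 0) \<Longrightarrow> b = 0 \<Longrightarrow> (\<lambda>k. (ys \<bullet> g' k) / ((\<epsilon> k)\<^sup>2)\<^sup>2) \<longlonglongrightarrow> l \<Longrightarrow> 0 \<le> (1 / 2) * (x \<bullet> H x) + l"
proof -
  define P Q where "P = (\<Sum>j\<in>I. p j)" and "Q = (\<Sum>j\<in>I. q j)"
  have pq: "p j \<in> range (pr j)" "q j \<in> range (pr j)" if "j \<in> I" for j
    using fam[OF that] by (auto simp: tangent_family_def)
  have P: "pr j P = p j" and Q: "pr j Q = q j" if "j \<in> I" for j
    unfolding P_def Q_def using pr_sum(1) pq that by blast+
  have Q0: "pr0 Q = 0" unfolding Q_def using pr_sum(2) pq by blast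
  have "\<forall>\<epsilon>>0. compl (ys + \<epsilon> *\<^sub>R P) (gs + \<epsilon> *\<^sub>R Q)"
    unfolding compl_def using base fam by (simp add: pr0_linear Q0 P Q compl_def tangent_family_def)
  from solvable[OF this, of b a] obtain \<epsilon> y' g' x dy where
    c0: "\<forall>k::nat. 0 < \<epsilon> k \<and> compl (y' k) (g' k)" and \<epsilon>: "\<epsilon> \<longlonglongrightarrow> 0"
    and dy: "(\<lambda>k. (1 / (\<epsilon> k)\<^sup>2) *\<^sub>R (y' k - (ys + \<epsilon> k *\<^sub>R P))) \<longlonglongrightarrow> dy"
    and dg: "(\<lambda>k. (1 / (\<epsilon> k)\<^sup>2) *\<^sub>R (g' k - (gs + \<epsilon> k *\<^sub>R Q))) \<longlonglongrightarrow> A x - b"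
    and a: "a = H x - At dy"
    and so: "Q = 0 \<and> b = 0 \<longrightarrow> (\<forall>l. (\<lambda>k. (ys \<bullet> g' k) / ((\<epsilon> k)\<^sup>2)\<^sup>2) \<longlonglongrightarrow> l \<longrightarrow> 0 \<le> (1 / 2) * (x \<bullet> H x) + l)"
    by (elim exE conjE) (rule that; assumption)
  from c0 have c: "\<And>k::nat. 0 < \<epsilon> k \<and> compl (y' k) (g' k)" by blast
  have dyj: "(\<lambda>k. (1 / (\<epsilon> k)\<^sup>2) *\<^sub>R (pr j (y' k) - (pr j ys + \<epsilon> k *\<^sub>R p j))) \<longlonglongrightarrow> pr j dy"
    and dgj: "(\<lambda>k. (1 / (\<epsilon> k)\<^sup>2) *\<^sub>R (pr j (g' k) - (pr j gs + \<epsilon> k *\<^sub>R q j))) \<longlonglongrightarrow> pr j (A x - b)"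
    if j: "j \<in> I" for j
    using tendsto_pr[OF j dy] tendsto_pr[OF j dg] j by (simp_all add: P Q)
  show thesis
  proof (rule that[OF c \<epsilon> dyj dgj _ _ a])
    show "pr0 (A x - b) = 0"
    proof -
      have "(\<lambda>k. pr0 ((1 / (\<epsilon> k)\<^sup>2) *\<^sub>R (g' k - (gs + \<epsilon> k *\<^sub>R Q)))) \<longlonglongrightarrow> pr0 (A x - b)"
        using bounded_linear.tendsto[OF linear_pr0[unfolded linear_conv_bounded_linear] dg] .
      moreover have "pr0 ((1 / (\<epsilon> k)\<^sup>2) *\<^sub>R (g' k - (gs + \<epsilon> k *\<^sub>R Q))) = 0" for k
        using c[of k] base Q0 by (simp add: pr0_linear compl_def)
      ultimately show ?thesis by (simp add: LIMSEQ_const_iff)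
    qed
    show "block_rel (e j) (E j) (n j) (s j) (pr j dy) (pr j (A x - b))" if j: "j \<in> I" for j
    proof -
      have "\<forall>k. 0 < \<epsilon> k \<and> pr j (y' k) \<in> range (pr j) \<and> pr j (g' k) \<in> range (pr j) \<and>
          soc_pair (e j) (pr j (y' k)) (pr j (g' k))"
        using c j by (simp add: compl_def)
      from fam[OF j, unfolded tangent_family_def, THEN conjunct2, THEN conjunct2, THEN conjunct2,
        THEN spec, THEN spec, THEN spec, THEN spec, THEN spec, THEN mp, THEN mp, THEN mp, THEN mp,
        OF this \<epsilon> dyj[OF j] dgj[OF j]]
      show ?thesis .
    qed
    show "0 \<le> (1 / 2) * (x \<bullet> H x) + l" if "\<And>j. j \<in> I \<Longrightarrow> q j = 0" "b = 0"
      "(\<lambda>k. (ys \<bullet> g' k) / ((\<epsilon> k)\<^sup>2)\<^sup>2) \<longlonglongrightarrow> l" for l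
    proof -
      have "Q = 0" unfolding Q_def using that(1) by (rule sum.neutral[OF ballI])
      then show ?thesis using so that(2,3) by blast
    qed
  qed
qed

text \<open>Testing stationarity with \<open>d\<close> turns the multiplier term into the curvature
  terms, because \<open>dy - s R dg\<close> is orthogonal to \<open>E\<close> in each block; only
  the component of \<open>d\<close> along \<open>n\<close> leaves a remainder.\<close>

lemma relation_inner:
  assumes rel: "\<And>j. j \<in> I \<Longrightarrow> block_rel (e j) (E j) (n j) (s j) (pr j dy) (pr j (A x))"
    and a: "a = H x - At dy" and d: "d \<in> M E n \<tau>" and E: "\<And>j. j \<in> I \<Longrightarrow> subspace (E j)"
  shows "a \<bullet> d = d \<bullet> B s x - \<tau> * (\<Sum>j\<in>I. (pr j dy - s j *\<^sub>R rfl (e j) (pr j (A x))) \<bullet> n j)"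
proof -
  have blk: "pr j dy \<bullet> pr j (A d) = s j * (rfl (e j) (pr j (A x)) \<bullet> pr j (A d))
      + \<tau> * ((pr j dy - s j *\<^sub>R rfl (e j) (pr j (A x))) \<bullet> n j)" if j: "j \<in> I" for j
  proof -
    define z where "z = pr j dy - s j *\<^sub>R rfl (e j) (pr j (A x))"
    have "z \<bullet> (pr j (A d) - \<tau> *\<^sub>R n j) = 0"
      using rel[OF j] d j by (simp add: block_rel_def z_def M_def)
    then have "z \<bullet> pr j (A d) = \<tau> * (z \<bullet> n j)" by (simp add: inner_simps)
    then show ?thesis unfolding z_def[symmetric] by (simp add: z_def inner_simps)
  qed
  have "a \<bullet> d = d \<bullet> H x - dy \<bullet> A d"
    using adjoint[of d dy] by (simp add: a inner_simps inner_commute)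
  also have "dy \<bullet> A d = (\<Sum>j\<in>I. pr j dy \<bullet> pr j (A d))"
    using inner_blocks[of dy "A d"] d by (simp add: M_def)
  also have "\<dots> = (\<Sum>j\<in>I. s j * (rfl (e j) (pr j (A x)) \<bullet> pr j (A d)))
      + \<tau> * (\<Sum>j\<in>I. (pr j dy - s j *\<^sub>R rfl (e j) (pr j (A x))) \<bullet> n j)"
    by (simp add: blk sum.distrib sum_distrib_left)
  finally show ?thesis by (simp add: inner_B)
qed

text \<open>With a jump direction in block \<open>i\<close> alone, all blocks share one level
  \<sigma>, and the solvability of the system becomes the one-dimensional complementarity condition
  of \<open>definite_jump\<close>.\<close>

lemma config_jump:
  assumes E: "\<And>j. j \<in> I \<Longrightarrow> subspace (E j)"
    and fam: "\<And>j. j \<in> I \<Longrightarrow> \<exists>p q. family j p q (E j) (n j) (s j)"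
    and n: "\<And>j. j \<in> I \<Longrightarrow> j \<noteq> i \<Longrightarrow> n j = 0"
    and nonneg: "\<And>d. d \<in> M E n 0 \<Longrightarrow> 0 \<le> d \<bullet> B s d"
    and d: "d \<in> M E n \<tau>" "d \<noteq> 0"
  shows "0 < d \<bullet> B s d"
proof (rule definite_jump[OF linear_B B_sym subspace_M[OF E] M_add[OF E] M_scale[OF E] nonneg _ d])
  fix a
  obtain p q where pq: "\<And>j. j \<in> I \<Longrightarrow> family j (p j) (q j) (E j) (n j) (s j)"
    using fam by metis
  obtain x dy where x0: "pr0 (A x - 0) = 0"
    and rel: "\<And>j. j \<in> I \<Longrightarrow> block_rel (e j) (E j) (n j) (s j) (pr j dy) (pr j (A x - 0))"
    and a: "a = H x - At dy"
    by (rule solve_families[OF pq, of 0 a]) (assumption, (rule that; assumption))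
  have rel': "\<And>j. j \<in> I \<Longrightarrow> block_rel (e j) (E j) (n j) (s j) (pr j dy) (pr j (A x))"
    using rel by simp
  define R where "R = (\<Sum>j\<in>I. (pr j dy - s j *\<^sub>R rfl (e j) (pr j (A x))) \<bullet> n j)"
  have R: "0 \<le> R" unfolding R_def using rel' by (intro sum_nonneg) (simp add: block_rel_def)
  obtain \<sigma> where \<sigma>: "0 \<le> \<sigma>" "\<And>j. j \<in> I \<Longrightarrow> pr j (A x) - \<sigma> *\<^sub>R n j \<in> E j"
  proof (cases "i \<in> I")
    case True
    then obtain \<sigma> where s: "0 \<le> \<sigma>" "pr i (A x) - \<sigma> *\<^sub>R n i \<in> E i"
      using rel'[OF True] by (auto simp: block_rel_def)
    show thesis
    proof (rule that[OF s(1)])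
      fix j assume j: "j \<in> I"
      show "pr j (A x) - \<sigma> *\<^sub>R n j \<in> E j"
        using rel'[OF j] n[OF j] s(2) by (cases "j = i") (auto simp: block_rel_def)
    qed
  next
    case False
    show thesis
    proof (rule that[of 0])
      fix j assume j: "j \<in> I"
      then have "n j = 0" using n False by blast
      then show "pr j (A x) - 0 *\<^sub>R n j \<in> E j"
        using rel'[OF j] by (auto simp: block_rel_def)
    qed simp
  qed
  have "x \<in> M E n \<sigma>" using \<sigma> x0 by (simp add: M_def)
  moreover have "a \<bullet> d = d \<bullet> B s x" if "d \<in> M E n 0" for d
    using relation_inner[OF rel' a that E] by simp
  moreover have "a \<bullet> d \<le> d \<bullet> B s x" if "d \<in> M E n 1" for d
    using relation_inner[OF rel' a that E] R by (simp add: R_def)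
  ultimately show "\<exists>\<sigma>\<ge>0. \<exists>x\<in>M E n \<sigma>. (\<forall>d\<in>M E n 0. a \<bullet> d = d \<bullet> B s x) \<and> (\<forall>d\<in>M E n 1. a \<bullet> d \<le> d \<bullet> B s x)"
    using \<sigma>(1) by blast
qed

section \<open>Definiteness on the initial spaces and nondegeneracy\<close>

lemma block_facts:
  assumes "j \<in> I"
  shows "subspace (spaceI j)" "subspace (spaceF j)"
    "family j (init_shift (e j) (pr j ys) (pr j gs)) 0 (spaceI j) 0 (curv j)"
    "\<exists>p q. family j p q (spaceF j) 0 (curv j)"
  by (rule subspace_init subspace_final init_family final_family;
      rule subspace_range_pr[OF assms] unit_in_range[OF assms] norm_unit[OF assms] pair_blocks[OF assms] rangeI)+

text \<open>Optimality gives a sign only at the solutions \<open>x\<close> which the system returns,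
  not at a prescribed direction. Solvability shows that every direction of the space is such a
  solution.\<close>

lemma init_definite:
  assumes "d \<in> M spaceI (\<lambda>_. 0) 0" "d \<noteq> 0"
  shows "0 < d \<bullet> B curv d"
proof (rule config_jump[where i = undefined, OF block_facts(1) _ refl _ assms])
  show "\<exists>p q. family j p q (spaceI j) 0 (curv j)" if "j \<in> I" for j
    using block_facts(3)[OF that] by blast
  let ?F = "M spaceI (\<lambda>_. 0) 0"
  have solve: "\<exists>x\<in>?F. (\<forall>d\<in>?F. a \<bullet> d = d \<bullet> B curv x) \<and> 0 \<le> x \<bullet> B curv x" for a
  proof -
    obtain \<epsilon> y' g' x dy where c: "\<And>k::nat. 0 < \<epsilon> k \<and> compl (y' k) (g' k)" and \<epsilon>: "\<epsilon> \<longlonglongrightarrow> 0"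
      and dy: "\<And>j. j \<in> I \<Longrightarrow> (\<lambda>k. (1 / (\<epsilon> k)\<^sup>2) *\<^sub>R (pr j (y' k) - (pr j ys + \<epsilon> k *\<^sub>R init_shift (e j) (pr j ys) (pr j gs)))) \<longlonglongrightarrow> pr j dy"
      and dg: "\<And>j. j \<in> I \<Longrightarrow> (\<lambda>k. (1 / (\<epsilon> k)\<^sup>2) *\<^sub>R (pr j (g' k) - (pr j gs + \<epsilon> k *\<^sub>R 0))) \<longlonglongrightarrow> pr j (A x - 0)"
      and x0: "pr0 (A x - 0) = 0"
      and rel: "\<And>j. j \<in> I \<Longrightarrow> block_rel (e j) (spaceI j) 0 (curv j) (pr j dy) (pr j (A x - 0))"
      and a: "a = H x - At dy"
      and so: "\<And>l. \<lbrakk>\<And>j. j \<in> I \<Longrightarrow> (0::'b) = 0; (0::'b) = 0; (\<lambda>k. (ys \<bullet> g' k) / ((\<epsilon> k)\<^sup>2)\<^sup>2) \<longlonglongrightarrow> l\<rbrakk> \<Longrightarrow> 0 \<le> (1 / 2) * (x \<bullet> H x) + l"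
      by (rule solve_families[OF block_facts(3), where b = 0 and a = a]) (assumption, (rule that; assumption))
    have rel': "\<And>j. j \<in> I \<Longrightarrow> block_rel (e j) (spaceI j) ((\<lambda>_. 0) j) (curv j) (pr j dy) (pr j (A x))"
      using rel by simp
    have "x \<in> ?F" using x0 rel' by (auto simp: M_def block_rel_def)
    moreover have "a \<bullet> d = d \<bullet> B curv x" if "d \<in> ?F" for d
      using relation_inner[OF rel' a that block_facts(1)] by simp
    moreover have "0 \<le> x \<bullet> B curv x"
    proof -
      have "(\<lambda>k. (pr j ys \<bullet> pr j (g' k)) / ((\<epsilon> k)\<^sup>2)\<^sup>2) \<longlonglongrightarrow>
          - (1 / 2) * (curv j * (pr j (A x) \<bullet> rfl (e j) (pr j (A x))))" if j: "j \<in> I" for j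
        by (rule init_curvature_limit[OF subspace_range_pr[OF j] unit_in_range[OF j] norm_unit[OF j] rangeI rangeI
              pair_blocks[OF j] _ \<epsilon> dy[OF j]])
           (use c dg[OF j] j in \<open>auto simp: compl_def\<close>)
      then have "(\<lambda>k. \<Sum>j\<in>I. (pr j ys \<bullet> pr j (g' k)) / ((\<epsilon> k)\<^sup>2)\<^sup>2) \<longlonglongrightarrow>
          (\<Sum>j\<in>I. - (1 / 2) * (curv j * (pr j (A x) \<bullet> rfl (e j) (pr j (A x)))))"
        by (intro tendsto_sum)
      moreover have "(\<Sum>j\<in>I. (pr j ys \<bullet> pr j (g' k)) / ((\<epsilon> k)\<^sup>2)\<^sup>2) = (ys \<bullet> g' k) / ((\<epsilon> k)\<^sup>2)\<^sup>2" for k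
        using inner_blocks[of ys "g' k"] c[of k] by (simp add: compl_def sum_divide_distrib)
      ultimately have "0 \<le> (1 / 2) * (x \<bullet> H x) + (\<Sum>j\<in>I. - (1 / 2) * (curv j * (pr j (A x) \<bullet> rfl (e j) (pr j (A x)))))"
        using so by simp
      then show ?thesis
        by (simp add: inner_B sum_negf sum_distrib_left[symmetric] sum_divide_distrib[symmetric] inner_commute)
    qed
    ultimately show ?thesis by blast
  qed
  fix d assume d: "d \<in> ?F"
  \<comment> \<open>For the right-hand side \<open>B curv d\<close> the solution \<open>x\<close>
    has the same pairings as \<open>d\<close>. Solving once more, with \<open>d - x\<close> on the
    right, shows by symmetry that \<open>d - x\<close> is orthogonal to itself.\<close>
  obtain x where x: "x \<in> ?F" "\<And>z. z \<in> ?F \<Longrightarrow> B curv d \<bullet> z = z \<bullet> B curv x" "0 \<le> x \<bullet> B curv x"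
    using solve[of "B curv d"] by blast
  have w: "d - x \<in> ?F" using subspace_diff[OF subspace_M[OF block_facts(1)] d x(1)] .
  obtain x2 where x2: "x2 \<in> ?F" "\<And>z. z \<in> ?F \<Longrightarrow> (d - x) \<bullet> z = z \<bullet> B curv x2"
    using solve[of "d - x"] by blast
  have "(d - x) \<bullet> (d - x) = (d - x) \<bullet> B curv x2" using x2(2)[OF w] .
  also have "\<dots> = x2 \<bullet> B curv d - x2 \<bullet> B curv x"
    by (subst B_sym) (simp add: linear_diff[OF linear_B] inner_diff_right)
  also have "\<dots> = 0" using x(2)[OF x2(1)] by (simp add: inner_commute)
  finally have "d = x" by simp
  then show "0 \<le> d \<bullet> B curv d" using x(3) by simp
qed

text \<open>With \<open>dy\<close> as perturbation \<open>b\<close> of the constraints, solvability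
  puts \<open>A x - dy\<close> into the initial spaces, to which \<open>dy\<close> is orthogonal;
  and \<open>dy\<close> is orthogonal to \<open>A x\<close> because
  \<open>At dy = 0\<close>.\<close>

lemma nondegenerate:
  assumes "At dy = 0" and "\<And>j w. j \<in> I \<Longrightarrow> w \<in> spaceI j \<Longrightarrow> pr j dy \<bullet> w = 0"
  shows "dy = 0"
proof -
  obtain x z where x0: "pr0 (A x - dy) = 0"
    and rel: "\<And>j. j \<in> I \<Longrightarrow> block_rel (e j) (spaceI j) 0 (curv j) (pr j z) (pr j (A x - dy))"
    by (rule solve_families[OF block_facts(3), where b = dy and a = 0]) (assumption, (rule that; assumption))
  have "dy \<bullet> (A x - dy) = (\<Sum>j\<in>I. pr j dy \<bullet> pr j (A x - dy))"
    using inner_blocks[of dy "A x - dy"] x0 by simp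
  also have "\<dots> = 0"
  proof (intro sum.neutral ballI)
    fix j assume j: "j \<in> I"
    then have "pr j (A x - dy) \<in> spaceI j" using rel[OF j] by (auto simp: block_rel_def)
    then show "pr j dy \<bullet> pr j (A x - dy) = 0" by (rule assms(2)[OF j])
  qed
  finally have "dy \<bullet> dy = A x \<bullet> dy" by (simp add: inner_diff_right inner_commute)
  then show ?thesis using assms(1) by (simp add: adjoint)
qed

section \<open>Enlarging the spaces, block by block\<close>

lemma block_extension:
  assumes i: "i \<in> I" and E: "\<And>j. j \<in> I \<Longrightarrow> j \<noteq> i \<Longrightarrow> subspace (E j)"
    and fam: "\<And>j. j \<in> I \<Longrightarrow> j \<noteq> i \<Longrightarrow> \<exists>p q. family j p q (E j) 0 (s j)"
    and Ei: "subspace Ei" and fami: "family i p q Ei n c"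
    and nonneg: "\<And>d. d \<in> M (E(i := Ei)) (\<lambda>_. 0) 0 \<Longrightarrow> 0 \<le> d \<bullet> B (s(i := c)) d"
    and E': "\<And>z. z \<in> E' \<Longrightarrow> \<exists>\<tau>. z - \<tau> *\<^sub>R n \<in> Ei"
    and d: "d \<in> M (E(i := E')) (\<lambda>_. 0) 0" "d \<noteq> 0"
  shows "0 < d \<bullet> B (s(i := c)) d"
proof -
  have "pr i (A d) \<in> E'" using d(1) i by (auto simp: M_def split: if_splits)
  then obtain \<tau> where \<tau>: "pr i (A d) - \<tau> *\<^sub>R n \<in> Ei" using E' by blast
  show ?thesis
  proof (rule config_jump[where i = i and E = "E(i := Ei)" and n = "(\<lambda>_. 0)(i := n)" and \<tau> = \<tau>])
    show "0 \<le> d \<bullet> B (s(i := c)) d" if "d \<in> M (E(i := Ei)) ((\<lambda>_. 0)(i := n)) 0" for d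
      using that nonneg by (simp add: M_def)
    show "d \<in> M (E(i := Ei)) ((\<lambda>_. 0)(i := n)) \<tau>"
      using d(1) \<tau> by (auto simp: M_def)
    show "subspace ((E(i := Ei)) j)" if "j \<in> I" for j using E[OF that] Ei by simp
    show "\<exists>p q. family j p q ((E(i := Ei)) j) (((\<lambda>_. 0)(i := n)) j) ((s(i := c)) j)" if "j \<in> I" for j
      using fam[OF that] fami by (cases "j = i") auto
  qed (use d in simp_all)
qed

text \<open>If the two spaces differ, one jump suffices unless both vectors vanish in a block of
  dimension at least two. There the chain is {0}, the line of R u, the hyperplane orthogonal to
  \<open>u\<close>, the whole block, realised by the pairs (u, 0), (u, R u / c) and (0, R
  u).\<close>

lemma final_block_definite:
  assumes i: "i \<in> I" and E: "\<And>j. j \<in> I \<Longrightarrow> j \<noteq> i \<Longrightarrow> subspace (E j)"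
    and fam: "\<And>j. j \<in> I \<Longrightarrow> j \<noteq> i \<Longrightarrow> \<exists>p q. family j p q (E j) 0 (curv j)"
    and pd: "\<And>d. d \<in> M (E(i := spaceI i)) (\<lambda>_. 0) 0 \<Longrightarrow> d \<noteq> 0 \<Longrightarrow> 0 < d \<bullet> B curv d"
    and d: "d \<in> M (E(i := spaceF i)) (\<lambda>_. 0) 0" "d \<noteq> 0"
  shows "0 < d \<bullet> B curv d"
proof -
  let ?V = "range (pr i)" and ?y = "pr i ys" and ?g = "pr i gs" and ?e = "e i"
  note Vi = subspace_range_pr[OF i] unit_in_range[OF i] norm_unit[OF i]
  have pair: "soc_pair ?e ?y ?g" using pair_blocks[OF i] .
  then have cone: "?y \<in> qcone ?e" "?g \<in> qcone ?e" by (auto simp: soc_pair_def)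
  have curv_upd: "curv(i := curv i) = curv" by (rule ext) simp
  have nn: "0 \<le> d \<bullet> B curv d" if "d \<in> M (E(i := spaceI i)) (\<lambda>_. 0) 0" for d
    using pd[OF that] by (cases "d = 0") (auto simp: less_imp_le)
  have ext: "0 < d \<bullet> B curv d"
    if "subspace Ei" "family i p q Ei n (curv i)"
      "\<And>d. d \<in> M (E(i := Ei)) (\<lambda>_. 0) 0 \<Longrightarrow> 0 \<le> d \<bullet> B curv d"
      "\<And>z. z \<in> E' \<Longrightarrow> \<exists>\<tau>. z - \<tau> *\<^sub>R n \<in> Ei" "d \<in> M (E(i := E')) (\<lambda>_. 0) 0" "d \<noteq> 0" for Ei p q n E' d
  proof -
    have "0 < d \<bullet> B (curv(i := curv i)) d"
    proof (rule block_extension[where s = curv and E = E, OF i E fam that(1,2) _ that(4-6)])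
      show "0 \<le> d \<bullet> B (curv(i := curv i)) d" if "d \<in> M (E(i := Ei)) (\<lambda>_. 0) 0" for d
        unfolding curv_upd by (rule \<open>\<And>d. d \<in> M (E(i := Ei)) (\<lambda>_. 0) 0 \<Longrightarrow> 0 \<le> d \<bullet> B curv d\<close>[OF that])
    qed assumption+
    then show ?thesis unfolding curv_upd .
  qed
  have hyper: "\<exists>\<tau>. z - \<tau> *\<^sub>R n \<in> ?V \<inter> {w. w \<bullet> n = 0}" if "n \<noteq> 0" "n \<in> ?V" "z \<in> ?V" for n z
  proof -
    have "z - ((z \<bullet> n) / (n \<bullet> n)) *\<^sub>R n \<in> ?V"
      by (rule subspace_diff[OF Vi(1) that(3) subspace_scale[OF Vi(1) that(2)]])
    moreover have "(z \<bullet> n) / (n \<bullet> n) * (n \<bullet> n) = z \<bullet> n"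
      using that(1) by (metis inner_eq_zero_iff nonzero_eq_divide_eq)
    then have "(z - ((z \<bullet> n) / (n \<bullet> n)) *\<^sub>R n) \<bullet> n = 0"
      by (simp only: inner_diff_left inner_scaleR_left)
    ultimately show ?thesis by blast
  qed
  have "spaceF i = spaceI i \<or> (?y \<noteq> 0 \<and> ?g = 0 \<and> ?y \<bullet> rfl ?e ?y = 0)
      \<or> (?y = 0 \<and> ?g \<noteq> 0 \<and> ?g \<bullet> rfl ?e ?g = 0) \<or> (?y = 0 \<and> ?g = 0)"
    by (cases "?y = 0"; cases "?g = 0") (simp_all add: init_space_def final_space_def)
  then consider "spaceF i = spaceI i" | "?y \<noteq> 0" "?g = 0" "?y \<bullet> rfl ?e ?y = 0"
    | "?y = 0" "?g \<noteq> 0" "?g \<bullet> rfl ?e ?g = 0"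
    | "?y = 0" "?g = 0" "?V \<subseteq> range (\<lambda>c. c *\<^sub>R ?e)"
    | "?y = 0" "?g = 0" "\<not> ?V \<subseteq> range (\<lambda>c. c *\<^sub>R ?e)" by blast
  then show ?thesis
  proof cases
    case 1
    then show ?thesis using pd[OF _ d(2)] d(1) by metis
  next
    case 2
    have f: "family i 0 0 {0} (rfl ?e ?y) (curv i)"
      using const_tangent_family[OF Vi const_tangent_outward[OF Vi 2(1) cone(1) 2(3)]] cone Vi 2 by simp
    have I: "spaceI i = {0}" and F: "spaceF i = range (\<lambda>c. c *\<^sub>R rfl ?e ?y)"
      using 2 by (simp_all add: init_space_def final_space_def)
    show ?thesis
      by (rule ext[OF subspace_single_0 f nn[unfolded I] _ d(1)[unfolded F] d(2)]) auto
  next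
    case 3
    have f: "family i 0 0 (?V \<inter> {w. w \<bullet> rfl ?e ?g = 0}) (rfl ?e ?g) (curv i)"
      using const_tangent_family[OF Vi const_tangent_inward[OF Vi 3(2) cone(2) 3(3) rangeI]] pair Vi 3 by simp
    have I: "spaceI i = ?V \<inter> {w. w \<bullet> rfl ?e ?g = 0}" and F: "spaceF i = ?V"
      using 3 by (simp_all add: init_space_def final_space_def)
    have nz: "rfl ?e ?g \<noteq> 0" using 3(2) Vi(3) by (metis rfl_rfl rfl_zero)
    show ?thesis
      by (rule ext[OF subspace_hyperplane_Int[OF Vi(1)] f nn[unfolded I]
            hyper[OF nz rfl_in_subspace[OF Vi rangeI]] d(1)[unfolded F] d(2)])
  next
    case 4
    have f: "family i 0 0 {0} ?e (curv i)"
      using const_tangent_family[OF Vi const_tangent_zero_line[OF Vi 4(3)]] pair 4 by simp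
    have I: "spaceI i = {0}" and F: "spaceF i = ?V"
      using 4 by (simp_all add: init_space_def final_space_def)
    have line: "\<exists>\<tau>. z - \<tau> *\<^sub>R ?e \<in> {0}" if z: "z \<in> ?V" for z
    proof -
      obtain c where "z = c *\<^sub>R ?e" using 4(3) z by blast
      then show ?thesis by (intro exI[of _ c]) simp
    qed
    show ?thesis
      by (rule ext[OF subspace_single_0 f nn[unfolded I] line d(1)[unfolded F] d(2)])
  next
    case 5
    have I: "spaceI i = {0}" and F: "spaceF i = ?V" and c0: "curv i = 0"
      using 5 by (simp_all add: init_space_def final_space_def)
    \<comment> \<open>The block is not a line, so it contains a unit vector \<open>w\<close>
      orthogonal to the axis; then \<open>?e + w\<close> lies on the boundary of the cone, and its
      reflection is \<open>?e - w\<close>.\<close>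
    obtain z where z: "z \<in> ?V" "z \<notin> range (\<lambda>c. c *\<^sub>R ?e)" using 5 by blast
    define w0 where "w0 = z - (z \<bullet> ?e) *\<^sub>R ?e"
    have w0: "w0 \<noteq> 0" "w0 \<in> ?V" "w0 \<bullet> ?e = 0"
      using z Vi inner_unit[OF Vi(3)] by (auto simp: w0_def subspace_diff subspace_scale inner_simps)
    define w where "w = (1 / norm w0) *\<^sub>R w0"
    have w: "w \<in> ?V" "w \<bullet> ?e = 0" "w \<bullet> w = 1"
      using w0 Vi(1) by (auto simp: w_def subspace_scale dot_square_norm power2_eq_square)
    define u where "u = ?e + w"
    have uV: "u \<in> ?V" using w Vi by (simp add: u_def subspace_add)
    have ue: "u \<bullet> ?e = 1" using w inner_unit[OF Vi(3)] by (simp add: u_def inner_simps)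
    have ru: "rfl ?e u = ?e - w" using ue by (simp add: rfl_def u_def scaleR_2)
    have u0: "u \<bullet> rfl ?e u = 0"
      using w inner_unit[OF Vi(3)] unfolding ru by (simp add: u_def inner_simps inner_commute)
    have uq: "u \<in> qcone ?e" using ue u0 by (simp add: qcone_def)
    have un: "u \<noteq> 0" using ue by auto
    have ruV: "rfl ?e u \<in> ?V" using rfl_in_subspace[OF Vi uV] .
    have run: "rfl ?e u \<noteq> 0" using un Vi(3) by (metis rfl_rfl rfl_zero)
    let ?P = "?V \<inter> {w. w \<bullet> u = 0}"
    have zy: "?y = 0" "?g = 0" using 5 by auto
    have f1: "family i u 0 {0} (rfl ?e u) (curv i)"
      unfolding zy c0 curvature_zero
      by (rule const_tangent_family_zero[OF Vi const_tangent_outward[OF Vi un uq u0]])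
        (use uq uV Vi in \<open>auto simp: subspace_0\<close>)
    have pd1: "0 < d \<bullet> B curv d" if "d \<in> M (E(i := range (\<lambda>c. c *\<^sub>R rfl ?e u))) (\<lambda>_. 0) 0" "d \<noteq> 0" for d
      by (rule ext[OF subspace_single_0 f1 nn[unfolded I] _ that]) auto
    \<comment> \<open>The pair (u, R u / c) has \<open>c\<close> as ratio of heads, so any positive
      curvature can be prescribed in this block.\<close>
    have f2: "family i u ((1 / c) *\<^sub>R rfl ?e u) ?P 0 c" if c: "0 < c" for c
    proof -
      have pr: "soc_pair ?e u ((1 / c) *\<^sub>R rfl ?e u)"
        using soc_pair_rfl[OF Vi(3) uq u0] c by simp
      have gV: "(1 / c) *\<^sub>R rfl ?e u \<in> ?V" using ruV Vi(1) by (simp add: subspace_scale)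
      have "const_tangent ?V ?e u ((1 / c) *\<^sub>R rfl ?e u) ?P 0 c"
        using const_tangent_middle[OF Vi pr un _ gV] run c ue Vi(3) by (simp add: rfl_scaleR)
      then show ?thesis unfolding zy using const_tangent_family_zero[OF Vi _ pr uV gV] by blast
    qed
    define q where "q d = d \<bullet> B curv d" for d
    define \<phi> where "\<phi> d = - (pr i (A d) \<bullet> rfl ?e (pr i (A d)))" for d
    have B_upd: "d \<bullet> B (curv(i := c)) d = q d + c * \<phi> d" for c d
    proof -
      have "(\<Sum>j\<in>I. (curv(i := c)) j * (rfl (e j) (pr j (A d)) \<bullet> pr j (A d)))
          = (\<Sum>j\<in>I. curv j * (rfl (e j) (pr j (A d)) \<bullet> pr j (A d))) + c * (rfl ?e (pr i (A d)) \<bullet> pr i (A d))"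
        unfolding sum.remove[OF finite_blocks i] by (simp add: c0)
      then show ?thesis by (simp add: q_def \<phi>_def inner_B inner_commute)
    qed
    \<comment> \<open>On the hyperplane the penalty \<phi> vanishes only along R u, where
      \<open>pd1\<close> gives positivity. By \<open>f2\<close>, each form
      \<open>q + c * \<phi>\<close> with c > 0 is definite once it is nonnegative, so no critical
      penalty exists.\<close>
    have nonneg: "0 \<le> q d" if dZ: "d \<in> M (E(i := ?P)) (\<lambda>_. 0) 0" for d
    proof (rule nonneg_of_penalized_definite[where q = q and \<phi> = \<phi>, OF _ _ _ _ _ _ _ _ dZ])
      show "subspace (M (E(i := ?P)) (\<lambda>_. 0) 0)"
        using subspace_M[of "E(i := ?P)"] E subspace_hyperplane_Int[OF Vi(1)] by simp
      have lin: "continuous_on UNIV f" if "linear f" for f :: "'a \<Rightarrow> 'c::euclidean_space"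
        using that by (rule linear_continuous_on[OF linear_conv_bounded_linear[THEN iffD1]])
      show "continuous_on UNIV q" unfolding q_def by (intro continuous_intros lin linear_B)
      have "linear (\<lambda>d. pr i (A d))" "linear (\<lambda>d. rfl ?e (pr i (A d)))"
        using linear_compose[OF linear_A linear_pr[OF i]] linear_compose[OF linear_compose[OF linear_A linear_pr[OF i]] rfl_linear]
        by (simp_all add: o_def)
      then show "continuous_on UNIV \<phi>" unfolding \<phi>_def by (intro continuous_intros lin)
      show "q (c *\<^sub>R x) = c\<^sup>2 * q x" "\<phi> (c *\<^sub>R x) = c\<^sup>2 * \<phi> x" for c x
        using i by (simp_all add: q_def \<phi>_def linear_scale[OF linear_B] rfl_scaleR power2_eq_square)
      have inP: "pr i (A x) \<bullet> u = 0" if "x \<in> M (E(i := ?P)) (\<lambda>_. 0) 0" for x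
        using that i by (auto simp: M_def)
      show "0 \<le> \<phi> x" if "x \<in> M (E(i := ?P)) (\<lambda>_. 0) 0" for x
        using qcone_orthogonal_boundary(1)[OF Vi(3) un uq inP[OF that]] by (simp add: \<phi>_def)
      show "0 < q x" if x: "x \<in> M (E(i := ?P)) (\<lambda>_. 0) 0" "\<phi> x = 0" "x \<noteq> 0" for x
      proof -
        have "pr i (A x) \<in> range (\<lambda>c. c *\<^sub>R rfl ?e u)"
          using qcone_orthogonal_boundary(2)[OF Vi(3) un uq inP[OF x(1)]] x(2) by (simp add: \<phi>_def)
        then have "x \<in> M (E(i := range (\<lambda>c. c *\<^sub>R rfl ?e u))) (\<lambda>_. 0) 0"
          using x(1) by (auto simp: M_def)
        then show ?thesis using pd1 x(3) by (simp add: q_def)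
      qed
      show "0 < q x + c * \<phi> x" if "0 < c" "\<And>z. z \<in> M (E(i := ?P)) (\<lambda>_. 0) 0 \<Longrightarrow> 0 \<le> q z + c * \<phi> z"
        "x \<in> M (E(i := ?P)) (\<lambda>_. 0) 0" "x \<noteq> 0" for c x
        unfolding B_upd[symmetric]
        by (rule block_extension[OF i E fam _ f2[OF that(1)] _ _ that(3,4)])
          (use that(2) subspace_hyperplane_Int[OF Vi(1)] in \<open>auto simp: B_upd\<close>)
    qed
    \<comment> \<open>Since R (R u) = u, the jump direction is the normal \<open>u\<close> of the
      hyperplane, and the two together span the block.\<close>
    have f3: "family i 0 (rfl ?e u) ?P u (curv i)"
      unfolding zy c0 curvature_zero
      by (rule const_tangent_family_zero[OF Vi])
        (use const_tangent_inward[OF Vi run _ _ ruV] uq u0 Vi ruV in \<open>auto simp: subspace_0 inner_commute\<close>)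
    show ?thesis
      by (rule ext[OF subspace_hyperplane_Int[OF Vi(1)] f3 nonneg[unfolded q_def] hyper[OF un uV]
            d(1)[unfolded F] d(2)])
  qed
qed

lemma final_definite:
  assumes "d \<in> M spaceF (\<lambda>_. 0) 0" "d \<noteq> 0"
  shows "0 < d \<bullet> B curv d"
proof -
  define E where "E S j = (if j \<in> S then spaceF j else spaceI j)" for S j
  have sub: "subspace (E S j)" and fam: "\<exists>p q. family j p q (E S j) 0 (curv j)" if "j \<in> I" for S j
    using block_facts[OF that] by (auto simp: E_def)
  have "S \<subseteq> I \<Longrightarrow> d \<in> M (E S) (\<lambda>_. 0) 0 \<Longrightarrow> d \<noteq> 0 \<Longrightarrow> 0 < d \<bullet> B curv d" if "finite S" for S d
    using that
  proof (induction S arbitrary: d rule: finite_induct)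
    case empty
    then show ?case using init_definite by (simp add: E_def[abs_def])
  next
    case (insert i S)
    have i: "i \<in> I" using insert by simp
    have eq: "E (insert i S) = (E S)(i := spaceF i)" "(E S)(i := spaceI i) = E S"
      by (rule ext, use insert(2) in \<open>simp add: E_def\<close>)+
    show ?case
      by (rule final_block_definite[where E = "E S", OF i sub fam])
        (use insert.IH insert.prems in \<open>simp_all only: eq insert_subset simp_thms\<close>)
  qed
  moreover have "M (E I) (\<lambda>_. 0) 0 = M spaceF (\<lambda>_. 0) 0" by (auto simp: M_def E_def)
  ultimately show ?thesis using assms finite_blocks by blast
qed

end

section \<open>Consequences of the Aubin property\<close>

lemma derivative_quotient:
  fixes F :: "'a::real_normed_vector \<Rightarrow> 'c::real_normed_vector" and t :: "nat \<Rightarrow> real"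
  assumes F: "(F has_derivative D) (at x0)" and t: "\<And>k. 0 < t k" "t \<longlonglongrightarrow> 0"
    and x: "(\<lambda>k. (1 / t k) *\<^sub>R (x k - x0)) \<longlonglongrightarrow> d"
  shows "(\<lambda>k. (1 / t k) *\<^sub>R (F (x k) - F x0)) \<longlonglongrightarrow> D d"
proof -
  define w where "w k = (1 / t k) *\<^sub>R (x k - x0)" for k
  have w: "w \<longlonglongrightarrow> d" using x by (simp add: w_def[abs_def])
  have bl: "bounded_linear D" by (rule has_derivative_bounded_linear[OF F])
  have xw: "x k - x0 = t k *\<^sub>R w k" for k using t(1)[of k] by (simp add: w_def)
  have "(\<lambda>k. (1 / t k) *\<^sub>R (F (x k) - F x0) - D (w k)) \<longlonglongrightarrow> 0"
  proof (rule LIMSEQ_I)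
    fix \<epsilon> :: real assume \<epsilon>: "0 < \<epsilon>"
    define N where "N = norm d + 1"
    have N: "0 < N" by (simp add: N_def add_nonneg_pos)
    define \<eta> where "\<eta> = \<epsilon> / (2 * N)"
    have \<eta>: "0 < \<eta>" using \<epsilon> N by (simp add: \<eta>_def)
    obtain \<delta> where \<delta>: "0 < \<delta>"
      and r: "\<And>x. norm (x - x0) \<le> \<delta> \<Longrightarrow> norm (F x - F x0 - D (x - x0)) \<le> \<eta> * norm (x - x0)"
      using derivative_bound_ball[OF F \<eta>] by blast
    have "(\<lambda>k. norm (t k *\<^sub>R w k)) \<longlonglongrightarrow> norm (0 *\<^sub>R d)" by (intro tendsto_intros t w)
    then have "\<forall>\<^sub>F k in sequentially. norm (t k *\<^sub>R w k) < \<delta>"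
      using \<delta> by (simp add: order_tendstoD(2))
    moreover have "(\<lambda>k. norm (w k)) \<longlonglongrightarrow> norm d" by (intro tendsto_intros w)
    then have "\<forall>\<^sub>F k in sequentially. norm (w k) < N" by (simp add: N_def order_tendstoD(2))
    ultimately have "\<forall>\<^sub>F k in sequentially. norm ((1 / t k) *\<^sub>R (F (x k) - F x0) - D (w k) - 0) < \<epsilon>"
    proof eventually_elim
      case (elim k)
      have "norm (F (x k) - F x0 - t k *\<^sub>R D (w k)) \<le> \<eta> * norm (t k *\<^sub>R w k)"
        using r[of "x k"] elim(1) xw[of k] bl by (simp add: bounded_linear.linear linear_scale)
      then have "t k * norm ((1 / t k) *\<^sub>R (F (x k) - F x0) - D (w k)) \<le> t k * (\<eta> * norm (w k))"
      proof -
        have "F (x k) - F x0 - t k *\<^sub>R D (w k) = t k *\<^sub>R ((1 / t k) *\<^sub>R (F (x k) - F x0) - D (w k))"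
          using t(1)[of k] by (simp add: scaleR_diff_right)
        moreover have "\<bar>t k\<bar> = t k" using t(1)[of k] by simp
        ultimately show ?thesis
          using \<open>norm (F (x k) - F x0 - t k *\<^sub>R D (w k)) \<le> \<eta> * norm (t k *\<^sub>R w k)\<close>
          by (simp add: mult.left_commute)
      qed
      then have "norm ((1 / t k) *\<^sub>R (F (x k) - F x0) - D (w k)) \<le> \<eta> * norm (w k)"
        using t(1)[of k] by simp
      also have "\<dots> \<le> \<eta> * N" using elim(2) \<eta> by (intro mult_left_mono) auto
      also have "\<dots> = \<epsilon> / 2" using N by (simp add: \<eta>_def)
      also have "\<dots> < \<epsilon>" using \<epsilon> by simp
      finally show ?case by simp
    qed
    then show "\<exists>no. \<forall>n\<ge>no. norm ((1 / t n) *\<^sub>R (F (x n) - F x0) - D (w n) - 0) < \<epsilon>"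
      by (simp add: eventually_sequentially)
  qed
  from tendsto_add[OF this bounded_linear.tendsto[OF bl w]] show ?thesis by simp
qed

locale smooth_system = cone_blocks I pr e
  for I :: "'i set" and pr :: "'i \<Rightarrow> 'b::euclidean_space \<Rightarrow> 'b" and e +
  fixes f :: "'a::euclidean_space \<Rightarrow> real" and gf :: "'a \<Rightarrow> 'a" and f2 :: "'a \<Rightarrow> 'a \<Rightarrow>\<^sub>L 'a"
    and G :: "'a \<Rightarrow> 'b" and \<gamma> :: "'b \<Rightarrow> 'a \<Rightarrow> 'a" and \<gamma>2 :: "'b \<Rightarrow> 'a \<Rightarrow> 'a \<Rightarrow>\<^sub>L 'a"
    and xs :: 'a and ys :: 'b
  assumes f_deriv: "(f has_derivative (\<lambda>h. gf x \<bullet> h)) (at x)"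
    and gf_deriv: "(gf has_derivative blinfun_apply (f2 x)) (at x)"
    and f2_cont: "continuous_on UNIV f2"
    and G_deriv: "b \<in> Basis \<Longrightarrow> ((\<lambda>x. G x \<bullet> b) has_derivative (\<lambda>h. \<gamma> b x \<bullet> h)) (at x)"
    and \<gamma>_deriv: "b \<in> Basis \<Longrightarrow> (\<gamma> b has_derivative blinfun_apply (\<gamma>2 b x)) (at x)"
    and \<gamma>2_cont: "b \<in> Basis \<Longrightarrow> continuous_on UNIV (\<gamma>2 b)"
begin

definition Jac :: "'a \<Rightarrow> 'a \<Rightarrow> 'b" where "Jac x h = (\<Sum>b\<in>Basis. (\<gamma> b x \<bullet> h) *\<^sub>R b)"
definition Adj :: "'a \<Rightarrow> 'b \<Rightarrow> 'a" where "Adj x y = (\<Sum>b\<in>Basis. (y \<bullet> b) *\<^sub>R \<gamma> b x)"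
definition gL :: "'a \<Rightarrow> 'b \<Rightarrow> 'a" where "gL x y = gf x - Adj x y"
definition Hess :: "'a \<Rightarrow> 'a" where "Hess h = f2 xs h - (\<Sum>b\<in>Basis. (ys \<bullet> b) *\<^sub>R \<gamma>2 b xs h)"

definition KKT :: "'a \<times> 'b \<Rightarrow> ('a \<times> 'b) set" where
  "KKT p = {z. fst p = gL (fst z) (snd z) \<and> compl (snd z) (G (fst z) - snd p)}"

definition KKT_lin :: "'a \<times> 'b \<Rightarrow> ('a \<times> 'b) set" where
  "KKT_lin p = {z. fst p = gL xs ys + Hess (fst z - xs) - Adj xs (snd z - ys)
     \<and> compl (snd z) (G xs + Jac xs (fst z - xs) - snd p)}"

definition feasible :: "'a set" where
  "feasible = {x. pr0 (G x) = 0 \<and> (\<forall>j\<in>I. pr j (G x) \<in> qcone (e j))}"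

lemma linear_Jac: "linear (Jac x)"
  by (rule linearI) (simp_all add: Jac_def inner_add_right scaleR_add_left sum.distrib scaleR_sum_right)

lemma linear_Adj: "linear (Adj x)"
  by (rule linearI) (simp_all add: Adj_def inner_add_left scaleR_add_left sum.distrib scaleR_sum_right)

lemma Jac_Adj: "Jac x h \<bullet> y = h \<bullet> Adj x y"
  by (simp add: Jac_def Adj_def inner_sum_left inner_sum_right inner_commute mult.commute)

lemma G_has_derivative: "(G has_derivative Jac x) (at x)"
  unfolding has_derivative_componentwise_within[of G "Jac x" x UNIV]
proof
  fix b :: 'b assume b: "b \<in> Basis"
  have "Jac x h \<bullet> b = \<gamma> b x \<bullet> h" for h
    by (simp add: Jac_def inner_sum_left inner_Basis b if_distrib cong: if_cong)
  then show "((\<lambda>x. G x \<bullet> b) has_derivative (\<lambda>h. Jac x h \<bullet> b)) (at x)"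
    using G_deriv[OF b] by simp
qed

lemma gL_has_derivative: "((\<lambda>x. gL x ys) has_derivative Hess) (at xs)"
  unfolding gL_def Adj_def Hess_def[abs_def]
  by (intro has_derivative_diff gf_deriv has_derivative_sum has_derivative_scaleR_right \<gamma>_deriv)

lemma lagrangian_has_derivative: "((\<lambda>x. f x - y \<bullet> G x) has_derivative (\<lambda>h. gL x y \<bullet> h)) (at x)"
proof -
  have "((\<lambda>x. f x - y \<bullet> G x) has_derivative (\<lambda>h. gf x \<bullet> h - y \<bullet> Jac x h)) (at x)"
    by (intro has_derivative_diff f_deriv has_derivative_inner_right G_has_derivative)
  moreover have "gf x \<bullet> h - y \<bullet> Jac x h = gL x y \<bullet> h" for h
    using Jac_Adj[of x h y] by (simp add: gL_def inner_diff_left inner_diff_right inner_commute)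
  ultimately show ?thesis by simp
qed

lemma linear_Hess: "linear Hess"
  using has_derivative_linear[OF gL_has_derivative] .

lemma Hess_sym: "x \<bullet> Hess z = z \<bullet> Hess x"
  using hessian_symmetric[OF lagrangian_has_derivative gL_has_derivative, of z x] by (simp add: inner_commute)

lemma gL_diff: "gL x (y + z) = gL x y - Adj x z"
  using linear_add[OF linear_Adj[of x]] by (simp add: gL_def)

lemma continuous_\<gamma>: "b \<in> Basis \<Longrightarrow> x \<longlonglongrightarrow> x0 \<Longrightarrow> (\<lambda>k. \<gamma> b (x k)) \<longlonglongrightarrow> \<gamma> b x0"
  using has_derivative_continuous[OF \<gamma>_deriv] isCont_tendsto_compose by blast

lemma tendsto_Adj: "x \<longlonglongrightarrow> x0 \<Longrightarrow> y \<longlonglongrightarrow> y0 \<Longrightarrow> (\<lambda>k. Adj (x k) (y k)) \<longlonglongrightarrow> Adj x0 y0"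
  unfolding Adj_def by (intro tendsto_intros continuous_\<gamma>)

context
  assumes aubin: "aubin_property KKT 0 (xs, ys)" and kkt: "(xs, ys) \<in> KKT 0"
    and locmin: "local_minimizer f feasible xs"
begin

lemma kkt_base: "gL xs ys = 0" "compl ys (G xs)"
  using kkt by (simp_all add: KKT_def)

text \<open>The shifted point \<open>(xs, ys + \<epsilon> p)\<close> solves the system for a
  parameter of order \<epsilon>, and one constant \<kappa> serves all these base points. Changing
  the parameter by \<epsilon>^2 (a, b) thus moves a solution by O(\<epsilon>^2) only.\<close>

lemma aubin_step:
  assumes base: "\<forall>\<epsilon>>0. compl (ys + \<epsilon> *\<^sub>R p) (G xs + \<epsilon> *\<^sub>R q)"
  obtains \<delta> C where "0 < \<delta>" "\<And>\<epsilon>. 0 < \<epsilon> \<Longrightarrow> \<epsilon> \<le> \<delta> \<Longrightarrow>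
    \<exists>z\<in>KKT (gL xs (ys + \<epsilon> *\<^sub>R p) + \<epsilon>\<^sup>2 *\<^sub>R a, - \<epsilon> *\<^sub>R q + \<epsilon>\<^sup>2 *\<^sub>R b). norm (z - (xs, ys + \<epsilon> *\<^sub>R p)) \<le> C * \<epsilon>\<^sup>2"
proof -
  obtain \<kappa> U V where \<kappa>: "0 < \<kappa>" and U: "open U" "0 \<in> U" and V: "open V" "(xs, ys) \<in> V"
    and au: "\<forall>p\<in>U. \<forall>p'\<in>U.
      KKT p' \<inter> V \<subseteq> {s + (\<kappa> * norm (p' - p)) *\<^sub>R u | s u. s \<in> KKT p \<and> u \<in> cball 0 1}"
    using aubin unfolding aubin_property_def by (elim exE conjE) (rule that; assumption)
  define P where "P \<epsilon> = (gL xs (ys + \<epsilon> *\<^sub>R p), - \<epsilon> *\<^sub>R q)" for \<epsilon>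
  define P' where "P' \<epsilon> = (gL xs (ys + \<epsilon> *\<^sub>R p) + \<epsilon>\<^sup>2 *\<^sub>R a, - \<epsilon> *\<^sub>R q + \<epsilon>\<^sup>2 *\<^sub>R b)" for \<epsilon>
  define Z where "Z \<epsilon> = (xs, ys + \<epsilon> *\<^sub>R p)" for \<epsilon> :: real
  have gL\<epsilon>: "gL xs (ys + \<epsilon> *\<^sub>R p) = - \<epsilon> *\<^sub>R Adj xs p" for \<epsilon>
    using gL_diff[of xs ys "\<epsilon> *\<^sub>R p"] linear_scale[OF linear_Adj] kkt_base by simp
  have "(P \<longlongrightarrow> (- 0 *\<^sub>R Adj xs p, - 0 *\<^sub>R q)) (at_right 0)"
    unfolding P_def gL\<epsilon> by (intro tendsto_intros)
  moreover have "(P' \<longlongrightarrow> (- 0 *\<^sub>R Adj xs p + 0\<^sup>2 *\<^sub>R a, - 0 *\<^sub>R q + 0\<^sup>2 *\<^sub>R b)) (at_right 0)"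
    unfolding P'_def gL\<epsilon> by (intro tendsto_intros)
  moreover have "(Z \<longlongrightarrow> (xs, ys + 0 *\<^sub>R p)) (at_right 0)"
    unfolding Z_def by (intro tendsto_intros)
  ultimately have "\<forall>\<^sub>F \<epsilon> in at_right 0. P \<epsilon> \<in> U" "\<forall>\<^sub>F \<epsilon> in at_right 0. P' \<epsilon> \<in> U" "\<forall>\<^sub>F \<epsilon> in at_right 0. Z \<epsilon> \<in> V"
    using U V by (auto intro: topological_tendstoD simp: zero_prod_def)
  then have "\<forall>\<^sub>F \<epsilon> in at_right 0. P \<epsilon> \<in> U \<and> P' \<epsilon> \<in> U \<and> Z \<epsilon> \<in> V"
    by (simp add: eventually_conj_iff)
  then obtain d where d: "0 < d" "\<And>\<epsilon>. 0 < \<epsilon> \<Longrightarrow> \<epsilon> < d \<Longrightarrow> P \<epsilon> \<in> U \<and> P' \<epsilon> \<in> U \<and> Z \<epsilon> \<in> V"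
    unfolding eventually_at_right_field by auto
  show thesis
  proof (rule that[of "d / 2" "\<kappa> * norm (a, b)"])
    fix \<epsilon> :: real assume \<epsilon>: "0 < \<epsilon>" "\<epsilon> \<le> d / 2"
    then have h: "P \<epsilon> \<in> U" "P' \<epsilon> \<in> U" "Z \<epsilon> \<in> V" using d by auto
    have "Z \<epsilon> \<in> KKT (P \<epsilon>)" using base \<epsilon> by (simp add: Z_def P_def KKT_def)
    then have "Z \<epsilon> \<in> {s + (\<kappa> * norm (P \<epsilon> - P' \<epsilon>)) *\<^sub>R u | s u. s \<in> KKT (P' \<epsilon>) \<and> u \<in> cball 0 1}"
      by (rule subsetD[OF au[rule_format, OF h(2,1)] IntI[OF _ h(3)]])
    then obtain s u where s: "s \<in> KKT (P' \<epsilon>)" "u \<in> cball 0 1" "Z \<epsilon> = s + (\<kappa> * norm (P \<epsilon> - P' \<epsilon>)) *\<^sub>R u"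
      unfolding mem_Collect_eq by (elim exE conjE) (rule that; assumption)
    have "P' \<epsilon> - P \<epsilon> = \<epsilon>\<^sup>2 *\<^sub>R (a, b)" by (simp add: P_def P'_def scaleR_Pair)
    then have n: "norm (P \<epsilon> - P' \<epsilon>) = \<epsilon>\<^sup>2 * norm (a, b)" by (metis abs_power2 norm_minus_commute norm_scaleR)
    have "norm (s - Z \<epsilon>) = \<bar>\<kappa> * norm (P \<epsilon> - P' \<epsilon>)\<bar> * norm u"
      by (subst s(3)) simp
    also have "\<dots> \<le> \<kappa> * norm (P \<epsilon> - P' \<epsilon>)"
      using s(2) \<kappa> by (simp add: mult_left_le abs_mult)
    finally show "\<exists>z\<in>KKT (gL xs (ys + \<epsilon> *\<^sub>R p) + \<epsilon>\<^sup>2 *\<^sub>R a, - \<epsilon> *\<^sub>R q + \<epsilon>\<^sup>2 *\<^sub>R b).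
        norm (z - (xs, ys + \<epsilon> *\<^sub>R p)) \<le> \<kappa> * norm (a, b) * \<epsilon>\<^sup>2"
      using s(1) n unfolding P'_def Z_def by (intro bexI[of _ s]) (simp_all add: mult_ac)
  qed (use d in simp)
qed

lemma aubin_solvable:
  assumes base: "\<forall>\<epsilon>>0. compl (ys + \<epsilon> *\<^sub>R p) (G xs + \<epsilon> *\<^sub>R q)"
  shows "\<exists>\<epsilon> y' g' x dy. (\<forall>k::nat. 0 < \<epsilon> k \<and> compl (y' k) (g' k)) \<and> \<epsilon> \<longlonglongrightarrow> 0 \<and>
        (\<lambda>k. (1 / (\<epsilon> k)\<^sup>2) *\<^sub>R (y' k - (ys + \<epsilon> k *\<^sub>R p))) \<longlonglongrightarrow> dy \<and>
        (\<lambda>k. (1 / (\<epsilon> k)\<^sup>2) *\<^sub>R (g' k - (G xs + \<epsilon> k *\<^sub>R q))) \<longlonglongrightarrow> Jac xs x - b \<and>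
        a = Hess x - Adj xs dy \<and>
        (q = 0 \<and> b = 0 \<longrightarrow> (\<forall>l. (\<lambda>k. (ys \<bullet> g' k) / ((\<epsilon> k)\<^sup>2)\<^sup>2) \<longlonglongrightarrow> l \<longrightarrow> 0 \<le> (1 / 2) * (x \<bullet> Hess x) + l))"
proof -
  obtain \<delta> C where \<delta>: "0 < \<delta>" and step: "\<And>\<epsilon>. 0 < \<epsilon> \<Longrightarrow> \<epsilon> \<le> \<delta> \<Longrightarrow>
    \<exists>z\<in>KKT (gL xs (ys + \<epsilon> *\<^sub>R p) + \<epsilon>\<^sup>2 *\<^sub>R a, - \<epsilon> *\<^sub>R q + \<epsilon>\<^sup>2 *\<^sub>R b). norm (z - (xs, ys + \<epsilon> *\<^sub>R p)) \<le> C * \<epsilon>\<^sup>2"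
    by (rule aubin_step[OF base]) (rule that; assumption)
  define \<epsilon>0 where "\<epsilon>0 k = \<delta> * inverse (real (Suc k))" for k
  have \<epsilon>0: "0 < \<epsilon>0 k" "\<epsilon>0 k \<le> \<delta>" for k using \<delta> by (simp_all add: \<epsilon>0_def field_simps)
  have "\<epsilon>0 \<longlonglongrightarrow> \<delta> * 0" unfolding \<epsilon>0_def by (intro tendsto_intros LIMSEQ_inverse_real_of_nat)
  then have \<epsilon>0_lim: "\<epsilon>0 \<longlonglongrightarrow> 0" by simp
  have "\<forall>k. \<exists>z. z \<in> KKT (gL xs (ys + \<epsilon>0 k *\<^sub>R p) + (\<epsilon>0 k)\<^sup>2 *\<^sub>R a, - \<epsilon>0 k *\<^sub>R q + (\<epsilon>0 k)\<^sup>2 *\<^sub>R b)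
      \<and> norm (z - (xs, ys + \<epsilon>0 k *\<^sub>R p)) \<le> C * (\<epsilon>0 k)\<^sup>2"
    by (rule allI, rule step[OF \<epsilon>0, unfolded Bex_def])
  from choice[OF this] obtain Z where Z0: "\<forall>k. Z k \<in> KKT (gL xs (ys + \<epsilon>0 k *\<^sub>R p) + (\<epsilon>0 k)\<^sup>2 *\<^sub>R a, - \<epsilon>0 k *\<^sub>R q + (\<epsilon>0 k)\<^sup>2 *\<^sub>R b)
      \<and> norm (Z k - (xs, ys + \<epsilon>0 k *\<^sub>R p)) \<le> C * (\<epsilon>0 k)\<^sup>2"
    by (elim exE) (rule that; assumption)
  note Z = Z0[rule_format, THEN conjunct1] Z0[rule_format, THEN conjunct2]
  define W where "W k = (1 / (\<epsilon>0 k)\<^sup>2) *\<^sub>R (Z k - (xs, ys + \<epsilon>0 k *\<^sub>R p))" for k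
  have "norm (W k) \<le> C" for k
    using Z(2)[of k] \<epsilon>0(1)[of k] by (simp add: W_def divide_le_eq)
  then have "bounded (range W)" by (auto simp: bounded_iff)
  then obtain d r where r: "strict_mono r" and d: "(W \<circ> r) \<longlonglongrightarrow> d"
    using bounded_imp_convergent_subsequence by blast
  define \<epsilon> where "\<epsilon> k = \<epsilon>0 (r k)" for k
  define x' where "x' k = fst (Z (r k))" for k
  define y' where "y' k = snd (Z (r k))" for k
  define g' where "g' k = G (x' k) - (- \<epsilon> k *\<^sub>R q + (\<epsilon> k)\<^sup>2 *\<^sub>R b)" for k
  define dx dy where "dx = fst d" and "dy = snd d"
  have \<epsilon>: "\<And>k. 0 < \<epsilon> k" by (simp add: \<epsilon>_def \<epsilon>0)
  have \<epsilon>_lim: "\<epsilon> \<longlonglongrightarrow> 0" using LIMSEQ_subseq_LIMSEQ[OF \<epsilon>0_lim r] by (simp add: \<epsilon>_def[abs_def] o_def)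
  define t where "t k = (\<epsilon> k)\<^sup>2" for k
  have t: "0 < t k" for k unfolding t_def by (rule zero_less_power[OF \<epsilon>])
  have t_lim: "t \<longlonglongrightarrow> 0" using tendsto_power[OF \<epsilon>_lim, of 2] by (simp add: t_def[abs_def])
  have comp: "compl (y' k) (g' k)" and stat: "gL xs (ys + \<epsilon> k *\<^sub>R p) + t k *\<^sub>R a = gL (x' k) (y' k)" for k
    using Z(1)[of "r k"] by (simp_all add: KKT_def y'_def g'_def x'_def \<epsilon>_def t_def)
  have dx: "(\<lambda>k. (1 / t k) *\<^sub>R (x' k - xs)) \<longlonglongrightarrow> dx"
    using tendsto_fst[OF d] by (simp add: dx_def W_def o_def \<epsilon>_def t_def x'_def)
  have dy: "(\<lambda>k. (1 / t k) *\<^sub>R (y' k - (ys + \<epsilon> k *\<^sub>R p))) \<longlonglongrightarrow> dy"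
    using tendsto_snd[OF d] by (simp add: dy_def W_def o_def \<epsilon>_def t_def y'_def)
  have x'_lim: "x' \<longlonglongrightarrow> xs" by (rule tendsto_of_quotient[OF t t_lim dx tendsto_const])
  have dG: "(\<lambda>k. (1 / t k) *\<^sub>R (G (x' k) - G xs)) \<longlonglongrightarrow> Jac xs dx"
    by (rule derivative_quotient[OF G_has_derivative t t_lim dx])
  have "(\<lambda>k. (1 / t k) *\<^sub>R (G (x' k) - G xs) - b) \<longlonglongrightarrow> Jac xs dx - b"
    by (intro tendsto_intros dG)
  moreover have "(1 / t k) *\<^sub>R (g' k - (G xs + \<epsilon> k *\<^sub>R q)) = (1 / t k) *\<^sub>R (G (x' k) - G xs) - b" for k
  proof -
    have eq: "g' k - (G xs + \<epsilon> k *\<^sub>R q) = (G (x' k) - G xs) - t k *\<^sub>R b" by (simp add: g'_def t_def algebra_simps)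
    show ?thesis unfolding eq using t[of k] by (simp add: scaleR_diff_right)
  qed
  ultimately have dg: "(\<lambda>k. (1 / t k) *\<^sub>R (g' k - (G xs + \<epsilon> k *\<^sub>R q))) \<longlonglongrightarrow> Jac xs dx - b" by simp
  \<comment> \<open>The shift \<open>p\<close> enters stationarity through \<open>Adj\<close> at
    both \<open>x' k\<close> and \<open>xs\<close>. The difference has an extra factor \<epsilon>
    after division by \<open>t k\<close>, so its limit is 0.\<close>
  have "(\<lambda>k. (1 / t k) *\<^sub>R (gL (x' k) ys - gL xs ys) - Adj (x' k) ((1 / t k) *\<^sub>R (y' k - (ys + \<epsilon> k *\<^sub>R p)))
      - (\<Sum>b\<in>Basis. (\<epsilon> k * (p \<bullet> b)) *\<^sub>R ((1 / t k) *\<^sub>R (\<gamma> b (x' k) - \<gamma> b xs))))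
    \<longlonglongrightarrow> Hess dx - Adj xs dy - (\<Sum>b\<in>Basis. (0 * (p \<bullet> b)) *\<^sub>R blinfun_apply (\<gamma>2 b xs) dx)"
    by (intro tendsto_diff tendsto_sum tendsto_scaleR tendsto_mult tendsto_const \<epsilon>_lim tendsto_Adj x'_lim dy
        derivative_quotient[OF gL_has_derivative t t_lim dx] derivative_quotient[OF \<gamma>_deriv t t_lim dx])
  moreover have "(1 / t k) *\<^sub>R (gL (x' k) ys - gL xs ys) - Adj (x' k) ((1 / t k) *\<^sub>R (y' k - (ys + \<epsilon> k *\<^sub>R p)))
      - (\<Sum>b\<in>Basis. (\<epsilon> k * (p \<bullet> b)) *\<^sub>R ((1 / t k) *\<^sub>R (\<gamma> b (x' k) - \<gamma> b xs))) = a" for k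
  proof -
    have 1: "(\<Sum>b\<in>Basis. (\<epsilon> k * (p \<bullet> b)) *\<^sub>R ((1 / t k) *\<^sub>R (\<gamma> b (x' k) - \<gamma> b xs)))
        = (1 / t k) *\<^sub>R (Adj (x' k) (\<epsilon> k *\<^sub>R p) - Adj xs (\<epsilon> k *\<^sub>R p))"
      unfolding Adj_def sum_subtractf[symmetric] scaleR_sum_right
      by (intro sum.cong refl) (simp add: scaleR_diff_right mult.commute)
    have 2: "Adj (x' k) ((1 / t k) *\<^sub>R (y' k - (ys + \<epsilon> k *\<^sub>R p)))
        = (1 / t k) *\<^sub>R (Adj (x' k) (y' k - ys) - Adj (x' k) (\<epsilon> k *\<^sub>R p))"
      by (simp only: linear_scale[OF linear_Adj] diff_diff_eq[symmetric] linear_diff[OF linear_Adj])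
    have ly: "gL (x' k) (y' k) = gL (x' k) ys - Adj (x' k) (y' k - ys)"
      using gL_diff[of "x' k" ys "y' k - ys"] by simp
    have "t k *\<^sub>R a = gL (x' k) (y' k) - gL xs (ys + \<epsilon> k *\<^sub>R p)"
      using stat[of k] by (metis add_diff_cancel_left')
    then have 3: "t k *\<^sub>R a = (gL (x' k) ys - gL xs ys) - Adj (x' k) (y' k - ys) + Adj xs (\<epsilon> k *\<^sub>R p)"
      unfolding ly gL_diff by simp
    have "a = (1 / t k) *\<^sub>R (t k *\<^sub>R a)" using t[of k] by simp
    then show ?thesis unfolding 1 2 3 by (simp add: algebra_simps)
  qed
  ultimately have "(\<lambda>k::nat. a) \<longlonglongrightarrow> Hess dx - Adj xs dy" by simp
  then have a: "a = Hess dx - Adj xs dy" by (simp add: LIMSEQ_const_iff)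
  \<comment> \<open>With \<open>q = 0\<close> and \<open>b = 0\<close> the points
    \<open>x' k\<close> are feasible, and the increment of \<open>f\<close> is that of the
    Lagrangian plus \<open>ys \<bullet> g' k\<close>, because
    \<open>ys \<bullet> G xs = 0\<close>.\<close>
  have so: "0 \<le> (1 / 2) * (dx \<bullet> Hess dx) + l"
    if q: "q = 0" "b = 0" and l: "(\<lambda>k. (ys \<bullet> g' k) / (t k)\<^sup>2) \<longlonglongrightarrow> l" for l
  proof -
    have g': "g' k = G (x' k)" for k using q by (simp add: g'_def)
    obtain \<rho> where \<rho>: "0 < \<rho>" "\<And>x. x \<in> feasible \<Longrightarrow> x \<in> ball xs \<rho> \<Longrightarrow> f xs \<le> f x"
      using locmin unfolding local_minimizer_def by blast
    have feas: "x' k \<in> feasible" for k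
      using comp[of k] by (auto simp: feasible_def compl_def g' soc_pair_def)
    have ys0: "ys \<bullet> G xs = 0"
      using kkt_base(2) inner_blocks[of ys "G xs"] by (simp add: compl_def soc_pair_def)
    have "(\<lambda>k. ((f (x' k) - ys \<bullet> G (x' k)) - (f xs - ys \<bullet> G xs)) / (t k)\<^sup>2 + (ys \<bullet> g' k) / (t k)\<^sup>2)
        \<longlonglongrightarrow> (1 / 2) * (Hess dx \<bullet> dx) + l"
      by (intro tendsto_add l second_order_limit[OF lagrangian_has_derivative gL_has_derivative kkt_base(1) t t_lim dx])
    moreover have "((f (x' k) - ys \<bullet> G (x' k)) - (f xs - ys \<bullet> G xs)) / (t k)\<^sup>2 + (ys \<bullet> g' k) / (t k)\<^sup>2
        = (f (x' k) - f xs) / (t k)\<^sup>2" for k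
      by (simp add: g' ys0 flip: add_divide_distrib)
    ultimately have lim: "(\<lambda>k. (f (x' k) - f xs) / (t k)\<^sup>2) \<longlonglongrightarrow> (1 / 2) * (Hess dx \<bullet> dx) + l" by simp
    have "\<forall>\<^sub>F k in sequentially. x' k \<in> ball xs \<rho>"
      using topological_tendstoD[OF x'_lim open_ball, of xs \<rho>] \<rho>(1) by simp
    then have "\<forall>\<^sub>F k in sequentially. 0 \<le> (f (x' k) - f xs) / (t k)\<^sup>2"
      by eventually_elim (use \<rho>(2) feas in auto)
    from tendsto_lowerbound[OF lim this] show ?thesis by (simp add: inner_commute)
  qed
  show ?thesis
  proof (rule exI[of _ \<epsilon>], rule exI[of _ y'], rule exI[of _ g'], rule exI[of _ dx], rule exI[of _ dy],
      intro conjI allI impI)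
    show "(\<lambda>k. (1 / (\<epsilon> k)\<^sup>2) *\<^sub>R (y' k - (ys + \<epsilon> k *\<^sub>R p))) \<longlonglongrightarrow> dy"
      "(\<lambda>k. (1 / (\<epsilon> k)\<^sup>2) *\<^sub>R (g' k - (G xs + \<epsilon> k *\<^sub>R q))) \<longlonglongrightarrow> Jac xs dx - b"
      using dy dg unfolding t_def .
    show "0 \<le> (1 / 2) * (dx \<bullet> Hess dx) + l" if "q = 0 \<and> b = 0" "(\<lambda>k. (ys \<bullet> g' k) / ((\<epsilon> k)\<^sup>2)\<^sup>2) \<longlonglongrightarrow> l" for l
      using so[unfolded t_def] that by blast
  qed (fact \<epsilon> comp \<epsilon>_lim a)+
qed

lemma aubin_solvable_system: "solvable_system I pr e Hess (Jac xs) (Adj xs) ys (G xs)"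
proof (intro solvable_system.intro solvable_system_axioms.intro cone_blocks_axioms)
  show "linear Hess" "linear (Jac xs)" "linear (Adj xs)" "compl ys (G xs)"
    by (fact linear_Hess linear_Jac linear_Adj kkt_base(2))+
  show "x \<bullet> Hess z = z \<bullet> Hess x" for x z by (rule Hess_sym)
  show "Jac xs x \<bullet> y = x \<bullet> Adj xs y" for x y by (rule Jac_Adj)
qed (rule aubin_solvable)

end

end

section \<open>Strong regularity of the linearization\<close>

context cone_blocks
begin

definition C :: "'b set" where "C = {y. \<forall>j\<in>I. pr j y \<in> qcone (e j)}"

lemma pr_pr0: "j \<in> I \<Longrightarrow> pr j (pr0 y) = 0"
proof -
  assume j: "j \<in> I"
  have "pr j (\<Sum>i\<in>I. pr i y) = pr j y" by (rule pr_sum(1)) (use j in auto)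
  then show ?thesis using j by (simp add: pr0_def)
qed

lemma pr0_commute: "pr0 y \<bullet> z = y \<bullet> pr0 z"
  by (simp add: pr0_def inner_diff_left inner_diff_right inner_sum_left inner_sum_right pr_commute)

lemma pr0_pr0: "pr0 (pr0 y) = pr0 y"
  by (simp add: pr0_def[of "pr0 y"] pr_pr0)

lemma closed_C: "closed C"
proof -
  have "closed {y. pr j y \<in> qcone (e j)}" if "j \<in> I" for j
    using continuous_closed_vimage[OF closed_qcone[OF norm_unit[OF that]], of "pr j"]
      linear_continuous_at[of "pr j"] linear_pr[OF that]
    by (simp add: vimage_def linear_conv_bounded_linear)
  moreover have "C = (\<Inter>j\<in>I. {y. pr j y \<in> qcone (e j)})" by (auto simp: C_def)
  ultimately show ?thesis by auto
qed

lemma C_add: "y \<in> C \<Longrightarrow> z \<in> C \<Longrightarrow> y + z \<in> C"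
  and C_scaleR: "y \<in> C \<Longrightarrow> 0 \<le> c \<Longrightarrow> c *\<^sub>R y \<in> C"
  by (simp_all add: C_def qcone_add norm_unit qcone_scaleR)

lemma C_zero: "0 \<in> C"
  by (simp add: C_def qcone_def)

lemma convex_C: "convex C"
  by (rule convexI) (simp add: C_add C_scaleR)

text \<open>Complementarity means that \<open>- g\<close> is normal to the closed convex cone
  \<open>C\<close> at \<open>y\<close>. For the converse the inequality is tested with 2 y and 0,
  with \<open>- pr0 g\<close>, and in each block with the axis and a boundary vector whose tail is
  opposite to that of \<open>g\<close>.\<close>

lemma compl_iff_normal: "compl y g \<longleftrightarrow> y \<in> C \<and> (\<forall>z\<in>C. 0 \<le> g \<bullet> (z - y))"
proof
  assume c: "compl y g"
  have "0 \<le> g \<bullet> (z - y)" if z: "z \<in> C" for z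
  proof -
    have "g \<bullet> z = (\<Sum>j\<in>I. pr j z \<bullet> pr j g)" "g \<bullet> y = (\<Sum>j\<in>I. pr j y \<bullet> pr j g)"
      using c inner_blocks[of z g] inner_blocks[of y g] by (simp_all add: compl_def inner_commute)
    moreover have "(\<Sum>j\<in>I. pr j y \<bullet> pr j g) = 0"
      using c by (intro sum.neutral) (simp add: compl_def soc_pair_def)
    moreover have "0 \<le> (\<Sum>j\<in>I. pr j z \<bullet> pr j g)"
      using c z by (intro sum_nonneg qcone_inner_nonneg[OF norm_unit]) (auto simp: compl_def soc_pair_def C_def)
    ultimately show ?thesis by (simp add: inner_diff_right)
  qed
  then show "y \<in> C \<and> (\<forall>z\<in>C. 0 \<le> g \<bullet> (z - y))" using c by (auto simp: C_def compl_def soc_pair_def)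
next
  assume h: "y \<in> C \<and> (\<forall>z\<in>C. 0 \<le> g \<bullet> (z - y))"
  have "0 \<le> g \<bullet> (2 *\<^sub>R y - y)" "0 \<le> g \<bullet> (0 - y)" using h C_scaleR[of y 2] C_zero by auto
  then have gy: "g \<bullet> y = 0" by (simp add: scaleR_2)
  have gz: "0 \<le> g \<bullet> z" if "z \<in> C" for z
  proof -
    have "0 \<le> g \<bullet> (z - y)" using h that by blast
    then show ?thesis using gy by (simp add: inner_diff_right)
  qed
  have "- pr0 g \<in> C" using linear_neg[OF linear_pr] by (simp add: C_def pr_pr0 qcone_def)
  then have "0 \<le> g \<bullet> - pr0 g" by (rule gz)
  then have "pr0 g \<bullet> pr0 g \<le> 0" by (simp add: pr0_commute pr0_pr0)
  then have p0: "pr0 g = 0" by (metis inner_gt_zero_iff not_le)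
  have gj: "pr j g \<in> qcone (e j)" if j: "j \<in> I" for j
  proof -
    note ej = norm_unit[OF j]
    define \<alpha> w where "\<alpha> = pr j g \<bullet> e j" and "w = pr j g - \<alpha> *\<^sub>R e j"
    have embed: "z \<in> C" if "z \<in> qcone (e j)" "pr j z = z" for z
    proof -
      have "pr i z \<in> qcone (e i)" if "i \<in> I" for i
      proof (cases "i = j")
        case False
        then have "pr i z = 0" using pr_other[OF that j, of z] \<open>pr j z = z\<close> by simp
        then show ?thesis by (simp add: qcone_def)
      qed (use \<open>z \<in> qcone (e j)\<close> \<open>pr j z = z\<close> in simp)
      then show ?thesis by (simp add: C_def)
    qed
    have dot: "g \<bullet> z = pr j g \<bullet> z" if "pr j z = z" for z using pr_commute[OF j, of g z] that by simp
    have we: "w \<bullet> e j = 0" using inner_unit[OF ej] by (simp add: w_def \<alpha>_def inner_simps)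
    have wj: "pr j w = w" using j by (simp add: w_def pr_pr pr_unit)
    have \<alpha>0: "0 \<le> \<alpha>" using gz[OF embed[OF unit_in_qcone[OF ej] pr_unit[OF j]]] dot[OF pr_unit[OF j]] by (simp add: \<alpha>_def)
    show ?thesis
    proof (cases "w = 0")
      case True
      then show ?thesis unfolding qcone_iff[OF ej] using \<alpha>0 by (simp add: w_def \<alpha>_def)
    next
      case False
      define z where "z = norm w *\<^sub>R e j - w"
      have ze: "z \<bullet> e j = norm w" using we inner_unit[OF ej] by (simp add: z_def inner_simps)
      have zj: "pr j z = z" using j wj by (simp add: z_def pr_unit)
      have "z \<in> qcone (e j)" unfolding qcone_iff[OF ej] ze by (simp add: z_def)
      then have "0 \<le> pr j g \<bullet> z" using gz[OF embed[OF _ zj]] dot[OF zj] by simp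
      also have "pr j g \<bullet> z = (\<alpha> *\<^sub>R e j + w) \<bullet> z" by (simp add: w_def)
      also have "\<dots> = \<alpha> * norm w - norm w * norm w"
        using we ze by (simp add: inner_add_left inner_commute[of "e j"])
           (simp add: z_def inner_diff_right norm_eq_sqrt_inner)
      finally have "norm w * norm w \<le> \<alpha> * norm w" by simp
      then have "norm w \<le> \<alpha>" using False by (simp add: mult_le_cancel_right)
      then show ?thesis unfolding qcone_iff[OF ej] by (simp add: w_def \<alpha>_def)
    qed
  qed
  have yj: "pr j y \<in> qcone (e j)" if "j \<in> I" for j using h that by (simp add: C_def)
  have "(\<Sum>j\<in>I. pr j y \<bullet> pr j g) = 0" using inner_blocks[of y g] p0 gy by (simp add: inner_commute)
  then have "\<forall>j\<in>I. pr j y \<bullet> pr j g = 0"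
    using sum_nonneg_eq_0_iff[OF finite_blocks, of "\<lambda>j. pr j y \<bullet> pr j g"] qcone_inner_nonneg[OF norm_unit yj gj] by blast
  then show "compl y g" using p0 gj yj by (simp add: compl_def soc_pair_def)
qed

section \<open>Projection onto the cone\<close>

definition proj :: "'b \<Rightarrow> 'b" where "proj = closest_point C"

lemma proj_in: "proj u \<in> C"
  unfolding proj_def using closest_point_in_set[OF closed_C] C_zero by blast

lemma compl_proj: "compl (proj u) (proj u - u)"
  unfolding compl_iff_normal
proof (intro conjI ballI proj_in)
  fix z assume "z \<in> C"
  then have "(u - proj u) \<bullet> (z - proj u) \<le> 0"
    unfolding proj_def by (rule closest_point_dot[OF convex_C closed_C])
  then show "0 \<le> (proj u - u) \<bullet> (z - proj u)" by (simp add: inner_diff_left)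
qed

text \<open>Together with \<open>compl_proj\<close> this is the Moreau decomposition: u = y - g with
  complementary \<open>y\<close> and \<open>g\<close> exactly when \<open>y\<close> is the
  projection of \<open>u\<close> and \<open>g = y - u\<close>.\<close>

lemma proj_eq: "compl y g \<Longrightarrow> proj (y - g) = y"
proof -
  assume c: "compl y g"
  define w where "w = proj (y - g)"
  have "0 \<le> g \<bullet> (w - y)" using c proj_in unfolding compl_iff_normal w_def by blast
  moreover have "0 \<le> (w - (y - g)) \<bullet> (y - w)"
    using compl_proj[of "y - g"] c unfolding compl_iff_normal w_def[symmetric] by blast
  moreover have "(w - (y - g)) \<bullet> (y - w) + g \<bullet> (w - y) = - ((w - y) \<bullet> (w - y))"
    by (simp add: inner_simps inner_commute)
  ultimately have "(w - y) \<bullet> (w - y) \<le> 0" by linarith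
  then show ?thesis by (metis eq_iff_diff_eq_0 inner_gt_zero_iff not_le w_def)
qed

lemma proj_lipschitz: "norm (proj u - proj v) \<le> norm (u - v)"
  using closest_point_lipschitz[OF convex_C closed_C, of u v] C_zero by (auto simp: proj_def dist_norm)

lemma continuous_proj: "continuous_on UNIV proj"
  unfolding proj_def using continuous_on_closest_point[OF convex_C closed_C] C_zero by blast

end

section \<open>The Minty map of the linearized system\<close>

context solvable_system
begin

text \<open>Two arbitrary solution sequences are compared, as a Lipschitz bound is wanted and not
  just an isolated solution. In every case \<open>dx\<close> belongs to the final spaces and has
  nonpositive form, so it vanishes by definiteness; then \<open>dy\<close> is orthogonal to the
  initial spaces and vanishes by nondegeneracy.\<close>

lemma no_kernel_direction:
  fixes y1 y2 g1 g2 :: "nat \<Rightarrow> 'b" and t :: "nat \<Rightarrow> real"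
  assumes t: "\<And>k. 0 < t k"
    and y1: "y1 \<longlonglongrightarrow> ys" and g1: "g1 \<longlonglongrightarrow> gs" and y2: "y2 \<longlonglongrightarrow> ys" and g2: "g2 \<longlonglongrightarrow> gs"
    and dy: "(\<lambda>k. (1 / t k) *\<^sub>R (y2 k - y1 k)) \<longlonglongrightarrow> dy"
    and dg: "(\<lambda>k. (1 / t k) *\<^sub>R (g2 k - g1 k)) \<longlonglongrightarrow> A dx"
    and c1: "\<And>k. compl (y1 k) (g1 k)" and c2: "\<And>k. compl (y2 k) (g2 k)"
    and st: "H dx = At dy"
  shows "dx = 0 \<and> dy = 0"
proof -
  have g0: "pr0 (A dx) = 0"
  proof -
    have "(\<lambda>k. pr0 ((1 / t k) *\<^sub>R (g2 k - g1 k))) \<longlonglongrightarrow> pr0 (A dx)"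
      using bounded_linear.tendsto[OF linear_pr0[unfolded linear_conv_bounded_linear] dg] .
    moreover have "pr0 ((1 / t k) *\<^sub>R (g2 k - g1 k)) = 0" for k
      using c1[of k] c2[of k] by (simp add: pr0_linear compl_def)
    ultimately show ?thesis by (simp add: LIMSEQ_const_iff)
  qed
  have blk: "pr j (A dx) \<in> spaceF j \<and> pr j dy \<bullet> pr j (A dx) \<le> curv j * (rfl (e j) (pr j (A dx)) \<bullet> pr j (A dx))
      \<and> (A dx = 0 \<longrightarrow> (\<forall>w\<in>spaceI j. pr j dy \<bullet> w = 0))" if j: "j \<in> I" for j
  proof -
    let ?V = "range (pr j)" and ?y = "pr j ys" and ?g = "pr j gs" and ?e = "e j" and ?dy = "pr j dy" and ?dg = "pr j (A dx)"
    note Vi = subspace_range_pr[OF j] unit_in_range[OF j] norm_unit[OF j]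
    note e = norm_unit[OF j]
    have yl1: "(\<lambda>k. pr j (y1 k)) \<longlonglongrightarrow> ?y" and yl2: "(\<lambda>k. pr j (y2 k)) \<longlonglongrightarrow> ?y"
      and gl1: "(\<lambda>k. pr j (g1 k)) \<longlonglongrightarrow> ?g" and gl2: "(\<lambda>k. pr j (g2 k)) \<longlonglongrightarrow> ?g"
      using tendsto_pr[OF j] y1 y2 g1 g2 by blast+
    have dyl: "(\<lambda>k. (1 / t k) *\<^sub>R (pr j (y2 k) - pr j (y1 k))) \<longlonglongrightarrow> ?dy"
      and dgl: "(\<lambda>k. (1 / t k) *\<^sub>R (pr j (g2 k) - pr j (g1 k))) \<longlonglongrightarrow> ?dg"
      using tendsto_pr[OF j dy] tendsto_pr[OF j dg] j by simp_all
    have p1: "\<And>k. soc_pair ?e (pr j (y1 k)) (pr j (g1 k))" and p2: "\<And>k. soc_pair ?e (pr j (y2 k)) (pr j (g2 k))"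
      using c1 c2 j by (simp_all add: compl_def)
    have q1: "\<And>k. soc_pair ?e (pr j (g1 k)) (pr j (y1 k))" and q2: "\<And>k. soc_pair ?e (pr j (g2 k)) (pr j (y2 k))"
      using p1 p2 soc_pair_commute[OF e] by blast+
    note pair = pair_blocks[OF j]
    have cone: "?y \<in> qcone ?e" "?g \<in> qcone ?e" using pair by (auto simp: soc_pair_def)
    have mono: "?dy \<bullet> ?dg \<le> 0"
      by (rule quotient_monotone[OF e t yl1 gl1 yl2 gl2 dyl dgl p1 p2])
    have dy_eq: "?dy = ((?dy \<bullet> ?e - (?y \<bullet> ?e) / (?g \<bullet> ?e) * (?dg \<bullet> ?e)) / (?g \<bullet> ?e)) *\<^sub>R rfl ?e ?g
        + ((?y \<bullet> ?e) / (?g \<bullet> ?e)) *\<^sub>R rfl ?e ?dg" if "?g \<noteq> 0"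
      by (rule quotient_nonzero[OF e t gl1 yl1 gl2 yl2 dgl dyl q1 q2 that])
    have F: "?dg \<in> spaceF j"
    proof -
      have "0 < ?y \<bullet> rfl ?e ?y \<or> ?y \<bullet> rfl ?e ?y = 0" using cone(1) by (auto simp: qcone_def)
      then consider "?y = 0" | "?y \<noteq> 0" "?g \<noteq> 0" | "?y \<noteq> 0" "?g = 0" "?y \<bullet> rfl ?e ?y = 0"
        | "?y \<noteq> 0" "?g = 0" "0 < ?y \<bullet> rfl ?e ?y" by blast
      then show ?thesis
      proof cases
        case 1
        then show ?thesis by (simp add: final_space_def)
      next
        case 2
        then show ?thesis
          using strict_middle(1)[OF Vi t yl1 gl1 yl2 gl2 dyl dgl p1 p2 2 pair] by (simp add: final_space_def)
      next
        case 3
        have "?dg = ((?dg \<bullet> ?e) / (?y \<bullet> ?e)) *\<^sub>R rfl ?e ?y"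
          using quotient_nonzero[OF e t yl1 gl1 yl2 gl2 dyl dgl p1 p2 3(1)] 3(2) by simp
        then have "?dg \<in> range (\<lambda>c. c *\<^sub>R rfl ?e ?y)" by (metis rangeI)
        then show ?thesis using 3 by (simp add: final_space_def)
      next
        case 4
        then show ?thesis
          using quotient_interior[OF e t yl1 gl1 yl2 gl2 dyl dgl p1 p2 4(3)] by (simp add: final_space_def)
      qed
    qed
    \<comment> \<open>If one of the two vectors vanishes, so does the curvature and monotonicity is
      enough; at a strict pair equality holds.\<close>
    moreover have "?dy \<bullet> ?dg \<le> curv j * (rfl ?e ?dg \<bullet> ?dg)"
    proof (cases "?y = 0 \<or> ?g = 0")
      case True
      then show ?thesis using mono by auto
    next
      case False
      then have ne: "?y \<noteq> 0" "?g \<noteq> 0" by auto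
      note sm = strict_middle[OF Vi t yl1 gl1 yl2 gl2 dyl dgl p1 p2 ne pair]
      obtain \<rho> where \<rho>: "?dy = \<rho> *\<^sub>R rfl ?e ?g + ((?y \<bullet> ?e) / (?g \<bullet> ?e)) *\<^sub>R rfl ?e ?dg" using sm(2) by blast
      have "?dy \<bullet> ?dg = curv j * (rfl ?e ?dg \<bullet> ?dg)"
      proof -
        have "rfl ?e ?g \<bullet> ?dg = 0" using sm(1) by (simp add: inner_commute)
        then show ?thesis unfolding curvature_def by (subst \<rho>) (simp add: inner_add_left)
      qed
      then show ?thesis by simp
    qed
    moreover have "?dy \<bullet> w = 0" if z: "A dx = 0" and w: "w \<in> spaceI j" for w
    proof (cases "?g = 0")
      case True
      then show ?thesis using w by (simp add: init_space_def)
    next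
      case False
      have dg0: "?dg = 0" using z j by simp
      show ?thesis
      proof (cases "?y = 0 \<and> ?g \<bullet> rfl ?e ?g \<noteq> 0")
        case True
        then have "0 < ?g \<bullet> rfl ?e ?g" using cone(2) by (auto simp: qcone_def)
        then have "?dy = 0" by (rule quotient_interior[OF e t gl1 yl1 gl2 yl2 dgl dyl q1 q2])
        then show ?thesis by simp
      next
        case F: False
        then have "w \<bullet> rfl ?e ?g = 0" using w unfolding init_space_def if_not_P[OF False] if_not_P[OF F] by blast
        then show ?thesis
          using arg_cong[OF dy_eq[OF False], of "\<lambda>v. v \<bullet> w"] dg0 by (simp add: inner_commute)
      qed
    qed
    ultimately show ?thesis by blast
  qed
  have "dx \<in> M spaceF (\<lambda>_. 0) 0" using g0 blk by (simp add: M_def)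
  moreover have "dx \<bullet> B curv dx \<le> 0"
  proof -
    have "dx \<bullet> H dx = A dx \<bullet> dy" by (simp add: st adjoint)
    also have "\<dots> = (\<Sum>j\<in>I. pr j dy \<bullet> pr j (A dx))"
      using inner_blocks[of dy "A dx"] g0 by (simp add: inner_commute)
    also have "\<dots> \<le> (\<Sum>j\<in>I. curv j * (rfl (e j) (pr j (A dx)) \<bullet> pr j (A dx)))"
      using blk by (intro sum_mono) blast
    finally show ?thesis by (simp add: inner_B)
  qed
  ultimately have dx: "dx = 0" using final_definite by fastforce
  have "At dy = 0" using st dx linear_0[OF linear_H] by simp
  moreover have "pr j dy \<bullet> w = 0" if "j \<in> I" "w \<in> spaceI j" for j w
    using blk[OF that(1)] that(2) dx by simp
  ultimately have "dy = 0" by (rule nondegenerate)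
  then show ?thesis using dx by blast
qed

context
  fixes xs :: 'a
begin

definition lin_sol :: "'a \<times> 'b \<Rightarrow> ('a \<times> 'b) set" where
  "lin_sol p = {z. fst p = H (fst z - xs) - At (snd z - ys) \<and> compl (snd z) (gs + A (fst z - xs) - snd p)}"

text \<open>Minty's parametrization of the graph of the normal cone mapping.\<close>

definition Phi :: "'a \<times> 'b \<Rightarrow> 'a \<times> 'b" where
  "Phi w = (H (fst w - xs) - At (proj (snd w) - ys), gs + A (fst w - xs) + snd w - proj (snd w))"

definition w0 :: "'a \<times> 'b" where "w0 = (xs, ys - gs)"

lemma proj_w0: "proj (snd w0) = ys"
  using proj_eq[OF base] by (simp add: w0_def)

lemma Phi_w0: "Phi w0 = 0"
  using proj_w0 linear_0[OF linear_H] linear_0[OF linear_At] by (simp add: Phi_def w0_def zero_prod_def)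

lemma lin_sol_iff_Phi:
  "z \<in> lin_sol p \<longleftrightarrow> (\<exists>u. Phi (fst z, u) = p \<and> snd z = proj u)"
proof
  assume z: "z \<in> lin_sol p"
  define u where "u = snd z - (gs + A (fst z - xs) - snd p)"
  have pu: "proj u = snd z" using z proj_eq by (simp add: lin_sol_def u_def)
  have "Phi (fst z, u) = p"
    using z pu by (simp add: Phi_def lin_sol_def u_def prod_eq_iff)
  then show "\<exists>u. Phi (fst z, u) = p \<and> snd z = proj u" using pu by (intro exI[of _ u]) simp
next
  assume "\<exists>u. Phi (fst z, u) = p \<and> snd z = proj u"
  then obtain u where u: "Phi (fst z, u) = p" "snd z = proj u" by blast
  have "gs + A (fst z - xs) - snd p = proj u - u" by (simp add: u(1)[symmetric] Phi_def)
  then have "compl (snd z) (gs + A (fst z - xs) - snd p)" unfolding u(2) by (simp only: compl_proj)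
  moreover have "fst p = H (fst z - xs) - At (snd z - ys)" unfolding u(2) u(1)[symmetric] Phi_def by simp
  ultimately show "z \<in> lin_sol p" by (simp add: lin_sol_def)
qed

text \<open>By compactness a failing bound yields a limit of normalised differences in the kernel.
  As \<open>proj\<close> is only Lipschitz, its difference quotients need not converge along with
  those of the argument; they are therefore part of the bounded sequence \<open>D\<close>.\<close>

lemma Phi_lower_bound:
  obtains c r where "0 < c" "0 < r" "\<And>w w'. w \<in> ball w0 r \<Longrightarrow> w' \<in> ball w0 r \<Longrightarrow> c * norm (w' - w) \<le> norm (Phi w' - Phi w)"
proof (rule ccontr)
  assume neg: "\<not> thesis"
  note obt = that
  have ex: "\<exists>w w'. w \<in> ball w0 r \<and> w' \<in> ball w0 r \<and> norm (Phi w' - Phi w) < c * norm (w' - w)"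
    if "0 < c" "0 < r" for c r
    using neg obt[OF that] by (meson not_le)
  define \<epsilon> where "\<epsilon> k = inverse (real (Suc k))" for k
  have \<epsilon>: "0 < \<epsilon> k" for k by (simp add: \<epsilon>_def)
  have \<epsilon>_lim: "\<epsilon> \<longlonglongrightarrow> 0" unfolding \<epsilon>_def by (rule LIMSEQ_inverse_real_of_nat)
  have "\<forall>k. \<exists>v. fst v \<in> ball w0 (\<epsilon> k) \<and> snd v \<in> ball w0 (\<epsilon> k)
      \<and> norm (Phi (snd v) - Phi (fst v)) < \<epsilon> k * norm (snd v - fst v)"
    using ex[OF \<epsilon> \<epsilon>] by simp
  from choice[OF this] obtain v where v: "\<forall>k. fst (v k) \<in> ball w0 (\<epsilon> k) \<and> snd (v k) \<in> ball w0 (\<epsilon> k)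
      \<and> norm (Phi (snd (v k)) - Phi (fst (v k))) < \<epsilon> k * norm (snd (v k) - fst (v k))"
    by (elim exE) (rule that; assumption)
  define w w' t where "w k = fst (v k)" and "w' k = snd (v k)" and "t k = norm (snd (v k) - fst (v k))" for k
  have wl: "w \<longlonglongrightarrow> w0"
    by (rule metric_LIMSEQ_I, rule metric_LIMSEQ_D[OF \<epsilon>_lim, THEN exE], assumption)
      (use v in \<open>force simp: w_def dist_commute intro: order_less_trans\<close>)
  have w'l: "w' \<longlonglongrightarrow> w0"
    by (rule metric_LIMSEQ_I, rule metric_LIMSEQ_D[OF \<epsilon>_lim, THEN exE], assumption)
      (use v in \<open>force simp: w'_def dist_commute intro: order_less_trans\<close>)
  have small: "norm (Phi (w' k) - Phi (w k)) < \<epsilon> k * t k" for k using v by (simp add: w_def w'_def t_def)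
  have t: "0 < t k" for k
    using small[of k] \<epsilon>[of k] norm_ge_zero[of "Phi (w' k) - Phi (w k)"] by (smt (verit) mult_nonneg_nonpos)
  have tn: "t k = norm (w' k - w k)" for k by (simp add: t_def w_def w'_def)
  define y1 y2 g1 g2 where "y1 k = proj (snd (w k))" and "y2 k = proj (snd (w' k))"
    and "g1 k = y1 k - snd (w k)" and "g2 k = y2 k - snd (w' k)" for k
  define D where "D k = ((1 / t k) *\<^sub>R (w' k - w k), (1 / t k) *\<^sub>R (y2 k - y1 k))" for k
  have n1: "norm (fst (D k)) = 1" for k using t[of k] by (simp add: D_def tn)
  have "norm (snd (D k)) \<le> 1" for k
  proof -
    have "norm (y2 k - y1 k) \<le> norm (snd (w' k - w k))" using proj_lipschitz by (simp add: y1_def y2_def)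
    also have "\<dots> \<le> t k" unfolding tn by (metis norm_snd_le prod.collapse)
    finally show ?thesis using t[of k] by (simp add: D_def divide_le_eq)
  qed
  then have "norm (D k) \<le> 2" for k using n1[of k] norm_Pair_le[of "fst (D k)" "snd (D k)"] by (smt (verit) prod.collapse)
  then have "bounded (range D)" by (auto simp: bounded_iff)
  then obtain d r where r: "strict_mono r" and d: "(D \<circ> r) \<longlonglongrightarrow> d"
    using bounded_imp_convergent_subsequence by blast
  define dx du dy where "dx = fst (fst d)" and "du = snd (fst d)" and "dy = snd d"
  have fd: "(\<lambda>k. fst (D (r k))) \<longlonglongrightarrow> fst d" using tendsto_fst[OF d] by (simp add: o_def)
  then have nd: "norm (fst d) = 1"
    using tendsto_norm[OF fd] by (simp add: n1 LIMSEQ_const_iff)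
  have dx: "(\<lambda>k. (1 / t (r k)) *\<^sub>R (fst (w' (r k)) - fst (w (r k)))) \<longlonglongrightarrow> dx"
    and du: "(\<lambda>k. (1 / t (r k)) *\<^sub>R (snd (w' (r k)) - snd (w (r k)))) \<longlonglongrightarrow> du"
    using tendsto_fst[OF fd] tendsto_snd[OF fd] by (simp_all add: D_def dx_def du_def)
  have dy: "(\<lambda>k. (1 / t (r k)) *\<^sub>R (y2 (r k) - y1 (r k))) \<longlonglongrightarrow> dy"
    using tendsto_snd[OF d] by (simp add: D_def dy_def o_def)
  have dg: "(\<lambda>k. (1 / t (r k)) *\<^sub>R (g2 (r k) - g1 (r k))) \<longlonglongrightarrow> dy - du"
    using tendsto_diff[OF dy du] by (simp add: g1_def g2_def scaleR_diff_right algebra_simps)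
  have lim0: "(\<lambda>k. (1 / t (r k)) *\<^sub>R (Phi (w' (r k)) - Phi (w (r k)))) \<longlonglongrightarrow> 0"
  proof (rule Lim_null_comparison)
    show "(\<lambda>k. \<epsilon> (r k)) \<longlonglongrightarrow> 0" using LIMSEQ_subseq_LIMSEQ[OF \<epsilon>_lim r] by (simp add: o_def)
    show "\<forall>\<^sub>F k in sequentially. norm ((1 / t (r k)) *\<^sub>R (Phi (w' (r k)) - Phi (w (r k)))) \<le> \<epsilon> (r k)"
      using small t by (intro always_eventually allI) (simp add: divide_le_eq less_imp_le)
  qed
  have "(\<lambda>k. fst ((1 / t (r k)) *\<^sub>R (Phi (w' (r k)) - Phi (w (r k))))) \<longlonglongrightarrow> fst (0 :: 'a \<times> 'b)"
    by (rule tendsto_fst[OF lim0])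
  moreover have "(\<lambda>k. snd ((1 / t (r k)) *\<^sub>R (Phi (w' (r k)) - Phi (w (r k))))) \<longlonglongrightarrow> snd (0 :: 'a \<times> 'b)"
    by (rule tendsto_snd[OF lim0])
  moreover have "fst ((1 / t (r k)) *\<^sub>R (Phi (w' (r k)) - Phi (w (r k))))
      = H ((1 / t (r k)) *\<^sub>R (fst (w' (r k)) - fst (w (r k)))) - At ((1 / t (r k)) *\<^sub>R (y2 (r k) - y1 (r k)))" for k
    by (simp add: Phi_def y1_def y2_def linear_scale[OF linear_H] linear_scale[OF linear_At]
        linear_diff[OF linear_H] linear_diff[OF linear_At] scaleR_diff_right)
  moreover have "snd ((1 / t (r k)) *\<^sub>R (Phi (w' (r k)) - Phi (w (r k))))
      = A ((1 / t (r k)) *\<^sub>R (fst (w' (r k)) - fst (w (r k)))) - (1 / t (r k)) *\<^sub>R (g2 (r k) - g1 (r k))" for k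
    by (simp add: Phi_def y1_def y2_def g1_def g2_def algebra_simps)
  ultimately have P1: "(\<lambda>k. H ((1 / t (r k)) *\<^sub>R (fst (w' (r k)) - fst (w (r k)))) - At ((1 / t (r k)) *\<^sub>R (y2 (r k) - y1 (r k)))) \<longlonglongrightarrow> 0"
    and P2: "(\<lambda>k. A ((1 / t (r k)) *\<^sub>R (fst (w' (r k)) - fst (w (r k)))) - (1 / t (r k)) *\<^sub>R (g2 (r k) - g1 (r k))) \<longlonglongrightarrow> 0"
    by simp_all
  note bl = linear_H[unfolded linear_conv_bounded_linear] linear_At[unfolded linear_conv_bounded_linear]
    linear_A[unfolded linear_conv_bounded_linear]
  have HA: "H dx - At dy = 0"
    by (rule LIMSEQ_unique[OF _ P1]) (intro tendsto_diff bounded_linear.tendsto[OF bl(1) dx] bounded_linear.tendsto[OF bl(2) dy])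
  have Adx: "A dx - (dy - du) = 0"
    by (rule LIMSEQ_unique[OF _ P2]) (intro tendsto_diff bounded_linear.tendsto[OF bl(3) dx] dg)
  have wr: "(\<lambda>k. w (r k)) \<longlonglongrightarrow> w0" "(\<lambda>k. w' (r k)) \<longlonglongrightarrow> w0"
    using LIMSEQ_subseq_LIMSEQ[OF wl r] LIMSEQ_subseq_LIMSEQ[OF w'l r] by (simp_all add: o_def)
  have pc: "(\<lambda>k. proj (u k)) \<longlonglongrightarrow> proj u0" if "u \<longlonglongrightarrow> u0" for u u0
    using continuous_proj that by (simp add: continuous_on_eq_continuous_at isCont_tendsto_compose)
  have y1l: "(\<lambda>k. y1 (r k)) \<longlonglongrightarrow> ys" and y2l: "(\<lambda>k. y2 (r k)) \<longlonglongrightarrow> ys"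
    unfolding y1_def y2_def using pc[OF tendsto_snd[OF wr(1)]] pc[OF tendsto_snd[OF wr(2)]] proj_w0 by simp_all
  have g1l: "(\<lambda>k. g1 (r k)) \<longlonglongrightarrow> gs" and g2l: "(\<lambda>k. g2 (r k)) \<longlonglongrightarrow> gs"
    unfolding g1_def g2_def using tendsto_diff[OF y1l tendsto_snd[OF wr(1)]] tendsto_diff[OF y2l tendsto_snd[OF wr(2)]]
    by (simp_all add: w0_def)
  have "dx = 0 \<and> dy = 0"
  proof (rule no_kernel_direction[where t = "\<lambda>k. t (r k)", OF t y1l g1l y2l g2l dy])
    show "(\<lambda>k. (1 / t (r k)) *\<^sub>R (g2 (r k) - g1 (r k))) \<longlonglongrightarrow> A dx" using dg Adx by simp
    show "H dx = At dy" using HA by simp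
  qed (use compl_proj in \<open>simp_all add: g1_def g2_def y1_def y2_def\<close>)
  then have "fst d = 0" using Adx by (simp add: dx_def du_def prod_eq_iff)
  then show False using nd by simp
qed

lemma strongly_regular_linearization:
  "\<exists>U V. (0, 0) \<in> interior U \<and> (xs, ys) \<in> interior V \<and> (\<forall>p\<in>U. \<exists>!z. z \<in> lin_sol p \<inter> V) \<and>
     locally_lipschitz_on U (\<lambda>p. THE z. z \<in> lin_sol p \<inter> V)"
proof -
  obtain c r where c: "0 < c" and r: "0 < r"
    and lb: "\<And>w w'. w \<in> ball w0 r \<Longrightarrow> w' \<in> ball w0 r \<Longrightarrow> c * norm (w' - w) \<le> norm (Phi w' - Phi w)"
    by (rule Phi_lower_bound) (rule that; assumption)
  have inj: "inj_on Phi (ball w0 r)"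
  proof (rule inj_onI)
    fix w w' assume "w \<in> ball w0 r" "w' \<in> ball w0 r" "Phi w = Phi w'"
    then have "c * norm (w' - w) \<le> 0" using lb by fastforce
    then show "w = w'" using c by (simp add: mult_le_0_iff)
  qed
  have lin: "continuous_on S f" if "linear f" for f :: "'c::euclidean_space \<Rightarrow> 'd::euclidean_space" and S
    using that by (rule linear_continuous_on[OF linear_conv_bounded_linear[THEN iffD1]])
  have "continuous_on UNIV Phi"
    unfolding Phi_def
    by (intro continuous_intros continuous_on_compose2[OF continuous_proj] continuous_on_compose2[OF lin[OF linear_H, of UNIV]]
        continuous_on_compose2[OF lin[OF linear_At, of UNIV]] continuous_on_compose2[OF lin[OF linear_A, of UNIV]]) auto
  then have "open (Phi ` ball w0 r)"
    using inj by (intro invariance_of_domain) (auto intro: continuous_on_subset)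
  moreover have "0 \<in> Phi ` ball w0 r" using Phi_w0 r by (metis centre_in_ball imageI)
  ultimately obtain \<delta>1 where \<delta>1: "0 < \<delta>1" "ball 0 \<delta>1 \<subseteq> Phi ` ball w0 r" by (meson open_contains_ball)
  obtain K where K: "0 < K" "\<And>x. norm (A x) \<le> norm x * K"
    using linear_A[unfolded linear_conv_bounded_linear] bounded_linear.pos_bounded by blast
  \<comment> \<open>A solution in \<open>V\<close> for a parameter in \<open>U\<close> has its Minty
    parameter within (3 + K) \<rho> of \<open>w0\<close>, hence in the ball where \<open>Phi\<close>
    is injective. The bound \<delta> \<le> c \<rho> below conversely brings the preimages of
    \<open>U\<close> into \<open>V\<close>.\<close>
  define \<rho> where "\<rho> = r / (4 + K)"
  have \<rho>: "0 < \<rho>" using r K by (simp add: \<rho>_def)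
  define \<delta> where "\<delta> = min \<delta>1 (min \<rho> (c * \<rho>))"
  have \<delta>: "0 < \<delta>" "\<delta> \<le> \<delta>1" "\<delta> \<le> \<rho>" "\<delta> \<le> c * \<rho>" using \<delta>1 \<rho> c by (auto simp: \<delta>_def)
  define U :: "('a \<times> 'b) set" where "U = ball 0 \<delta>"
  define V where "V = ball (xs, ys) \<rho>"
  define Q where "Q w = (fst w, proj (snd w))" for w :: "'a \<times> 'b"
  have Q_lip: "norm (Q w' - Q w) \<le> norm (w' - w)" for w w'
  proof -
    have "(norm (proj (snd w') - proj (snd w)))\<^sup>2 \<le> (norm (snd w' - snd w))\<^sup>2"
      using proj_lipschitz by (intro power_mono) auto
    then show ?thesis by (simp add: Q_def norm_prod_def)
  qed
  have near: "(fst z, u) \<in> ball w0 r" if z: "z \<in> V" and p: "p \<in> U" and "Phi (fst z, u) = p" "snd z = proj u" for z u p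
  proof -
    have nz: "norm (z - (xs, ys)) < \<rho>" using z by (simp add: V_def dist_norm norm_minus_commute)
    have nx: "norm (fst z - xs) < \<rho>" and ny: "norm (snd z - ys) < \<rho>"
      using nz norm_fst_le[of "fst z - xs" "snd z - ys"] norm_snd_le[of "snd z - ys" "fst z - xs"]
      by (auto simp: minus_prod_def)
    have np: "norm (snd p) < \<rho>"
      using p \<delta>(3) norm_snd_le[of "snd p" "fst p"] by (auto simp: U_def)
    have eq: "u - (ys - gs) = (snd z - ys) - A (fst z - xs) + snd p"
      using that(3,4) by (auto simp: Phi_def)
    have "norm (u - (ys - gs)) \<le> norm (snd z - ys) + norm (A (fst z - xs)) + norm (snd p)"
      unfolding eq
      using norm_triangle_ineq[of "(snd z - ys) - A (fst z - xs)" "snd p"] norm_triangle_ineq4[of "snd z - ys" "A (fst z - xs)"]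
      by linarith
    also have "\<dots> \<le> \<rho> + \<rho> * K + \<rho>"
      using ny np K(2)[of "fst z - xs"] mult_right_mono[of "norm (fst z - xs)" \<rho> K] nx K(1) by linarith
    finally have "norm (fst z - xs) + norm (u - (ys - gs)) < \<rho> * (4 + K)"
      using nx \<rho> by (simp add: algebra_simps)
    also have "\<dots> = r" using K by (simp add: \<rho>_def)
    finally have "norm ((fst z, u) - w0) < r"
      using norm_Pair_le[of "fst z - xs" "u - (ys - gs)"] unfolding w0_def diff_Pair by linarith
    then show ?thesis by (simp add: dist_norm norm_minus_commute)
  qed
  have sol: "\<exists>w\<in>ball w0 r. Phi w = p \<and> Q w \<in> lin_sol p \<inter> V \<and> (\<forall>z. z \<in> lin_sol p \<inter> V \<longrightarrow> z = Q w)"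
    if p: "p \<in> U" for p
  proof -
    have "p \<in> ball 0 \<delta>1" using p \<delta>(2) by (simp add: U_def)
    then obtain w where w: "w \<in> ball w0 r" "Phi w = p" using \<delta>1(2) by blast
    have "c * norm (w - w0) \<le> norm p" using lb[of w0 w] r w Phi_w0 by simp
    also have "\<dots> < c * \<rho>" using p \<delta>(4) by (simp add: U_def)
    finally have "norm (w - w0) < \<rho>" using c by simp
    then have "norm (Q w - Q w0) < \<rho>" using Q_lip[of w w0] by linarith
    moreover have "Q w0 = (xs, ys)" unfolding Q_def proj_w0 by (simp add: w0_def)
    ultimately have QV: "Q w \<in> V" by (simp add: V_def dist_norm norm_minus_commute)
    have "Q w \<in> lin_sol p" unfolding lin_sol_iff_Phi using w(2) by (auto simp: Q_def intro: exI[of _ "snd w"])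
    moreover have "z = Q w" if z: "z \<in> lin_sol p \<inter> V" for z
    proof -
      obtain u where u: "Phi (fst z, u) = p" "snd z = proj u" using z lin_sol_iff_Phi by blast
      have "(fst z, u) \<in> ball w0 r" using near[OF _ p u] z by blast
      then have "w = (fst z, u)" using inj w u(1) by (simp add: inj_on_def)
      then show ?thesis using u(2) by (simp add: Q_def prod_eq_iff)
    qed
    ultimately show ?thesis using w QV by blast
  qed
  have ex1: "\<exists>!z. z \<in> lin_sol p \<inter> V" if "p \<in> U" for p using sol[OF that] by blast
  define S where "S p = (THE z. z \<in> lin_sol p \<inter> V)" for p
  have S_lip: "dist (S p) (S p') \<le> (1 / c) * dist p p'" if p: "p \<in> U" "p' \<in> U" for p p'
  proof -
    have S_eq: "S q = z" if "q \<in> U" "z \<in> lin_sol q \<inter> V" for q z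
      unfolding S_def using ex1[OF that(1)] that(2) by (rule the1_equality)
    obtain w w' where w: "w \<in> ball w0 r" "Phi w = p" "S p = Q w" "w' \<in> ball w0 r" "Phi w' = p'" "S p' = Q w'"
      using sol[OF p(1)] sol[OF p(2)] S_eq[OF p(1)] S_eq[OF p(2)] by metis
    have "norm (Q w - Q w') \<le> norm (w - w')" by (rule Q_lip)
    moreover have "c * norm (w - w') \<le> norm (p - p')" using lb[OF w(4,1)] w by simp
    then have "norm (w - w') \<le> (1 / c) * norm (p - p')" using c by (simp add: pos_le_divide_eq mult.commute)
    ultimately show ?thesis using w by (simp add: dist_norm)
  qed
  have "locally_lipschitz_on U S"
    unfolding locally_lipschitz_on_def
  proof
    fix p assume "p \<in> U"
    have "(1 / c)-lipschitz_on (U \<inter> ball p 1) S"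
      using S_lip c by (intro lipschitz_onI) auto
    then show "\<exists>\<epsilon>>0. \<exists>L. L-lipschitz_on (U \<inter> ball p \<epsilon>) S" by (intro exI[of _ 1]) auto
  qed
  moreover have "(0, 0) \<in> interior U" "(xs, ys) \<in> interior V"
    using \<delta>(1) \<rho> by (simp_all add: U_def V_def zero_prod_def[symmetric] interior_open)
  ultimately show ?thesis using ex1 unfolding S_def[abs_def] by blast
qed

end

end

section \<open>Strong regularity implies the Aubin property\<close>

text \<open>\<open>E\<close> controls the variation of the derivative and vanishes at
  \<open>z0\<close>; on a ball where it is below \<eta>, the mean value inequality applies to
  \<open>F\<close> minus its linear part.\<close>

lemma strict_derivative_bound:
  fixes F :: "'c::euclidean_space \<Rightarrow> 'd::euclidean_space" and DF :: "'c \<Rightarrow> 'c \<Rightarrow> 'd" and E :: "'c \<Rightarrow> real"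
  assumes F: "\<And>z. (F has_derivative DF z) (at z)"
    and E: "\<And>z w. norm (DF z w - DF z0 w) \<le> E z * norm w" and cont: "isCont E z0" and E0: "E z0 = 0"
    and \<eta>: "0 < \<eta>"
  obtains \<delta> where "0 < \<delta>" "\<And>z z'. z \<in> ball z0 \<delta> \<Longrightarrow> z' \<in> ball z0 \<delta> \<Longrightarrow>
    norm (F z - F z' - DF z0 (z - z')) \<le> \<eta> * norm (z - z')"
proof -
  obtain \<delta> where \<delta>: "0 < \<delta>" "\<And>z. dist z z0 < \<delta> \<Longrightarrow> dist (E z) (E z0) < \<eta>"
    using cont \<eta> unfolding continuous_at_eps_delta by blast
  have lin: "linear (DF z0)" using has_derivative_linear[OF F] .
  show thesis
  proof (rule that[OF \<delta>(1)])
    fix z z' assume z: "z \<in> ball z0 \<delta>" "z' \<in> ball z0 \<delta>"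
    have "norm ((F z - DF z0 z) - (F z' - DF z0 z')) \<le> \<eta> * norm (z - z')"
    proof (rule differentiable_bound[where S = "ball z0 \<delta>" and f = "\<lambda>z. F z - DF z0 z" and f' = "\<lambda>z w. DF z w - DF z0 w"])
      show "((\<lambda>z. F z - DF z0 z) has_derivative (\<lambda>w. DF x w - DF z0 w)) (at x within ball z0 \<delta>)" for x
        by (intro has_derivative_diff has_derivative_at_withinI[OF F]
            has_derivative_at_withinI[OF linear_imp_has_derivative[OF lin]])
      show "onorm (\<lambda>w. DF x w - DF z0 w) \<le> \<eta>" if x: "x \<in> ball z0 \<delta>" for x
      proof (rule onorm_le)
        fix w :: 'c
        have "E x \<le> \<eta>" using \<delta>(2)[of x] x E0 by (simp add: dist_commute dist_norm)
        then have "E x * norm w \<le> \<eta> * norm w" by (rule mult_right_mono) simp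
        then show "norm (DF x w - DF z0 w) \<le> \<eta> * norm w" using E[of x w] by linarith
      qed
    qed (use z in auto)
    moreover have "(F z - DF z0 z) - (F z' - DF z0 z') = F z - F z' - DF z0 (z - z')"
      using linear_diff[OF lin] by simp
    ultimately show "norm (F z - F z' - DF z0 (z - z')) \<le> \<eta> * norm (z - z')" by simp
  qed
qed

lemma aubin_propertyI:
  assumes "0 < \<kappa>" "open U" "p0 \<in> U" "open V" "q0 \<in> V"
    and near: "\<And>p p' z'. p \<in> U \<Longrightarrow> p' \<in> U \<Longrightarrow> z' \<in> S p' \<Longrightarrow> z' \<in> V \<Longrightarrow>
      \<exists>z\<in>S p. norm (z' - z) \<le> \<kappa> * norm (p' - p)"
  shows "aubin_property S p0 q0"
  unfolding aubin_property_def
proof (rule exI[of _ \<kappa>], rule conjI[OF assms(1)], rule exI[of _ U], rule exI[of _ V], intro conjI ballI subsetI)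
  fix p p' z' assume p: "p \<in> U" "p' \<in> U" and z': "z' \<in> S p' \<inter> V"
  then obtain z where z: "z \<in> S p" "norm (z' - z) \<le> \<kappa> * norm (p' - p)" using near by blast
  define c u where "c = \<kappa> * norm (p' - p)" and "u = (1 / c) *\<^sub>R (z' - z)"
  have "z' = z + c *\<^sub>R u \<and> u \<in> cball 0 1"
  proof (cases "c = 0")
    case True
    then show ?thesis using z(2) by (simp add: c_def[symmetric] u_def)
  next
    case False
    have "0 \<le> c" using assms(1) by (simp add: c_def)
    then show ?thesis using z(2) False by (simp add: c_def[symmetric] u_def divide_le_eq)
  qed
  then show "z' \<in> {s + (\<kappa> * norm (p' - p)) *\<^sub>R u | s u. s \<in> S p \<and> u \<in> cball 0 1}"
    unfolding c_def mem_Collect_eq using z(1) by (intro exI[of _ z] exI[of _ u]) simp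
qed (use assms in simp_all)

text \<open>Robinson's implicit function theorem: solutions of the perturbed system are the fixed points
  of \<open>z \<mapsto> q (p + \<psi> z)\<close>, where \<open>\<psi>\<close>, the linearization error, has a small Lipschitz constant.\<close>

lemma aubin_of_linearization:
  fixes S SL :: "('a::euclidean_space \<times> 'b::euclidean_space) \<Rightarrow> ('a \<times> 'b) set" and \<psi> :: "'a \<times> 'b \<Rightarrow> 'a \<times> 'b"
  assumes S: "\<And>p z. z \<in> S p \<longleftrightarrow> z \<in> SL (p + \<psi> z)"
    and \<psi>0: "\<psi> z0 = 0" and z0: "z0 \<in> SL 0"
    and \<psi>: "\<And>\<eta>. 0 < \<eta> \<Longrightarrow> \<exists>\<delta>>0. \<forall>z\<in>ball z0 \<delta>. \<forall>z'\<in>ball z0 \<delta>. norm (\<psi> z - \<psi> z') \<le> \<eta> * norm (z - z')"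
    and U: "0 \<in> interior U" and V: "z0 \<in> interior V"
    and uniq: "\<And>p. p \<in> U \<Longrightarrow> \<exists>!z. z \<in> SL p \<inter> V"
    and lip: "locally_lipschitz_on U (\<lambda>p. THE z. z \<in> SL p \<inter> V)"
  shows "aubin_property S 0 z0"
proof -
  define q where "q p = (THE z. z \<in> SL p \<inter> V)" for p
  have q_in: "q p \<in> SL p \<inter> V" if "p \<in> U" for p
    unfolding q_def by (rule theI'[OF uniq[OF that]])
  have q_eq: "q p = z" if "p \<in> U" "z \<in> SL p" "z \<in> V" for p z
    unfolding q_def by (rule the1_equality[OF uniq[OF that(1)]]) (use that in blast)
  have "0 \<in> U" using U interior_subset by blast
  then obtain \<epsilon> L where \<epsilon>: "0 < \<epsilon>" and L: "L-lipschitz_on (U \<inter> ball 0 \<epsilon>) q"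
    using lip unfolding locally_lipschitz_on_def q_def[abs_def] by blast
  obtain r where r: "0 < r" "ball 0 r \<subseteq> U" using U by (auto simp: mem_interior)
  define R where "R = min \<epsilon> r"
  have R: "0 < R" using \<epsilon> r by (simp add: R_def)
  \<comment> \<open>\<open>L\<close> may be 0, while the radii below divide by
    \<open>K\<close>.\<close>
  define K where "K = L + 1"
  have K: "0 < K" using lipschitz_on_nonneg[OF L] by (simp add: K_def)
  have inU: "p \<in> U" if "norm p < R" for p using r(2) that by (auto simp: R_def)
  have q_lip: "norm (q p - q p') \<le> K * norm (p - p')" if "norm p < R" "norm p' < R" for p p'
  proof -
    have "dist (q p) (q p') \<le> L * dist p p'"
      using lipschitz_onD[OF L, of p p'] inU[OF that(1)] inU[OF that(2)] that by (simp add: R_def)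
    also have "\<dots> \<le> K * dist p p'" by (rule mult_right_mono) (simp_all add: K_def)
    finally show ?thesis by (simp add: dist_norm)
  qed
  have q0: "q 0 = z0"
    by (rule q_eq[OF \<open>0 \<in> U\<close> z0]) (use V interior_subset in blast)
  \<comment> \<open>The composite map then has contraction constant K \<eta> = 1/2.\<close>
  define \<eta> where "\<eta> = 1 / (2 * K)"
  have \<eta>: "0 < \<eta>" and K\<eta>: "K * \<eta> = 1 / 2" using K by (simp_all add: \<eta>_def)
  obtain \<delta> where \<delta>: "0 < \<delta>" "\<And>z z'. z \<in> ball z0 \<delta> \<Longrightarrow> z' \<in> ball z0 \<delta> \<Longrightarrow> norm (\<psi> z - \<psi> z') \<le> \<eta> * norm (z - z')"
    using \<psi>[OF \<eta>] by blast
  obtain rV where rV: "0 < rV" "ball z0 rV \<subseteq> V" using V by (auto simp: mem_interior)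
  define \<rho> where "\<rho> = min (\<delta> / 2) (min (rV / 2) (R / (4 * \<eta>)))"
  have \<rho>: "0 < \<rho>" "\<rho> \<le> \<delta> / 2" "\<rho> \<le> rV / 2" "\<rho> \<le> R / (4 * \<eta>)" using \<delta>(1) rV(1) R \<eta> by (auto simp: \<rho>_def)
  have \<rho>R: "\<eta> * \<rho> < R / 2" using \<rho>(4) \<eta> R by (simp add: field_simps)
  have inV: "z \<in> V" if "z \<in> cball z0 \<rho>" for z
  proof -
    have "z \<in> ball z0 rV" using that \<rho>(3) rV(1) by simp
    then show ?thesis using rV(2) by blast
  qed
  have in\<delta>: "z \<in> ball z0 \<delta>" if "z \<in> cball z0 \<rho>" for z using that \<rho>(2) \<delta>(1) by simp
  \<comment> \<open>The half R / 2 leaves room for \<psi> in the domain of \<open>q\<close>; the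
    bound \<rho> / (2 K) makes the closed ball of radius \<rho> invariant.\<close>
  define s where "s = min (R / 2) (\<rho> / (2 * K))"
  have s: "0 < s" "s \<le> R / 2" "s \<le> \<rho> / (2 * K)" using R \<rho>(1) K by (simp_all add: s_def)
  have Ks: "K * s \<le> \<rho> / 2" using s(3) K by (simp add: field_simps)
  have z0in: "z0 \<in> cball z0 \<rho>" using \<rho>(1) by simp
  have \<psi>n: "norm (\<psi> z) \<le> \<eta> * \<rho>" if z: "z \<in> cball z0 \<rho>" for z
  proof -
    have "norm (\<psi> z - \<psi> z0) \<le> \<eta> * norm (z - z0)" by (rule \<delta>(2)[OF in\<delta>[OF z] in\<delta>[OF z0in]])
    also have "\<dots> \<le> \<eta> * \<rho>" using z \<eta> by (intro mult_left_mono) (auto simp: dist_norm norm_minus_commute)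
    finally show ?thesis by (simp add: \<psi>0)
  qed
  have arg: "norm (p + \<psi> z) < R" if "p \<in> ball 0 s" "z \<in> cball z0 \<rho>" for p z
    using norm_triangle_ineq[of p "\<psi> z"] \<psi>n[OF that(2)] that(1) s(2) \<rho>R by simp
  have contr: "norm (q (p + \<psi> z) - q (p' + \<psi> z')) \<le> K * norm (p - p') + norm (z - z') / 2"
    if "p \<in> ball 0 s" "p' \<in> ball 0 s" "z \<in> cball z0 \<rho>" "z' \<in> cball z0 \<rho>" for p p' z z'
  proof -
    have "norm (q (p + \<psi> z) - q (p' + \<psi> z')) \<le> K * norm ((p + \<psi> z) - (p' + \<psi> z'))"
      by (rule q_lip[OF arg[OF that(1,3)] arg[OF that(2,4)]])
    also have "\<dots> \<le> K * (norm (p - p') + \<eta> * norm (z - z'))"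
    proof (rule mult_left_mono)
      have eq: "(p + \<psi> z) - (p' + \<psi> z') = (p - p') + (\<psi> z - \<psi> z')" by simp
      show "norm ((p + \<psi> z) - (p' + \<psi> z')) \<le> norm (p - p') + \<eta> * norm (z - z')"
        unfolding eq
        using norm_triangle_ineq[of "p - p'" "\<psi> z - \<psi> z'"] \<delta>(2)[OF in\<delta>[OF that(3)] in\<delta>[OF that(4)]] by linarith
    qed (use K in simp)
    also have "\<dots> = K * norm (p - p') + (K * \<eta>) * norm (z - z')" by (simp add: algebra_simps)
    finally show ?thesis by (simp add: K\<eta>)
  qed
  show ?thesis
  proof (rule aubin_propertyI[of "2 * K" "ball 0 s" _ "ball z0 \<rho>"])
    fix p p' z' :: "'a \<times> 'b" assume p: "p \<in> ball 0 s" "p' \<in> ball 0 s" and z': "z' \<in> S p'" "z' \<in> ball z0 \<rho>"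
    have z'c: "z' \<in> cball z0 \<rho>" using z'(2) by simp
    have "\<exists>!z\<in>cball z0 \<rho>. q (p + \<psi> z) = z"
    proof (rule Banach_fix[where c = "1 / 2"])
      show "complete (cball z0 \<rho>)" by (simp add: complete_eq_closed)
      show "cball z0 \<rho> \<noteq> {}" using \<rho>(1) by simp
      show "(\<lambda>z. q (p + \<psi> z)) ` cball z0 \<rho> \<subseteq> cball z0 \<rho>"
      proof (rule image_subsetI)
        fix z assume z: "z \<in> cball z0 \<rho>"
        have "norm (q (p + \<psi> z) - q (0 + \<psi> z0)) \<le> K * norm (p - 0) + norm (z - z0) / 2"
          by (rule contr[OF p(1) _ z z0in]) (use s in simp)
        also have "K * norm (p - 0) \<le> K * s" using p(1) K by (intro mult_left_mono) auto
        also have "norm (z - z0) \<le> \<rho>" using z by (simp add: dist_norm norm_minus_commute)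
        finally have "norm (q (p + \<psi> z) - z0) \<le> \<rho>" using Ks by (simp add: \<psi>0 q0)
        then show "q (p + \<psi> z) \<in> cball z0 \<rho>" by (simp add: dist_norm norm_minus_commute)
      qed
      show "dist (q (p + \<psi> x)) (q (p + \<psi> y)) \<le> 1 / 2 * dist x y"
        if "x \<in> cball z0 \<rho>" "y \<in> cball z0 \<rho>" for x y
        using contr[OF p(1) p(1) that] by (simp add: dist_norm)
    qed simp_all
    then obtain z where z: "z \<in> cball z0 \<rho>" "q (p + \<psi> z) = z" by blast
    have zS: "z \<in> S p" unfolding S using q_in[OF inU[OF arg[OF p(1) z(1)]]] z(2) by simp
    \<comment> \<open>\<open>z'\<close> is a fixed point for \<open>p'\<close>. Comparing it with
      the fixed point \<open>z\<close> for \<open>p\<close> and absorbing half of their distance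
      gives the constant 2 K.\<close>
    have "q (p' + \<psi> z') = z'"
      by (rule q_eq[OF inU[OF arg[OF p(2) z'c]] _ inV[OF z'c]]) (use z'(1) S in blast)
    then have "norm (z' - z) \<le> K * norm (p' - p) + norm (z' - z) / 2"
      using contr[OF p(2,1) z'c z(1)] z(2) by simp
    then have "norm (z' - z) \<le> 2 * K * norm (p' - p)" by simp
    then show "\<exists>z\<in>S p. norm (z' - z) \<le> 2 * K * norm (p' - p)" using zS by blast
  qed (use K s \<rho> in simp_all)
qed

section \<open>Strict differentiability of the KKT map\<close>

context smooth_system
begin

definition F :: "'a \<times> 'b \<Rightarrow> 'a \<times> 'b" where "F z = (gL (fst z) (snd z), G (fst z))"

definition DF :: "'a \<times> 'b \<Rightarrow> 'a \<times> 'b \<Rightarrow> 'a \<times> 'b" where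
  "DF z w = (f2 (fst z) (fst w) - (\<Sum>b\<in>Basis. (snd z \<bullet> b) *\<^sub>R \<gamma>2 b (fst z) (fst w) + (snd w \<bullet> b) *\<^sub>R \<gamma> b (fst z)),
     Jac (fst z) (fst w))"

lemma F_has_derivative: "(F has_derivative DF z) (at z)"
proof -
  have fstd: "((\<lambda>z. h (fst z)) has_derivative (\<lambda>w. h' (fst w))) (at z)"
    if "(h has_derivative h') (at (fst z))" for h h' and z :: "'a \<times> 'b"
    by (rule has_derivative_compose[OF has_derivative_fst[OF has_derivative_ident] that])
  show ?thesis
    unfolding F_def[abs_def] gL_def Adj_def DF_def[abs_def]
  proof (intro has_derivative_Pair has_derivative_diff has_derivative_sum)
    fix b :: 'b assume b: "b \<in> Basis"
    have "((\<lambda>z. (snd z \<bullet> b) *\<^sub>R \<gamma> b (fst z)) has_derivative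
        (\<lambda>w. (snd z \<bullet> b) *\<^sub>R \<gamma>2 b (fst z) (fst w) + (snd w \<bullet> b) *\<^sub>R \<gamma> b (fst z))) (at z)"
      by (intro has_derivative_scaleR has_derivative_inner_left has_derivative_snd has_derivative_ident fstd \<gamma>_deriv[OF b])
    then show "((\<lambda>z. (snd z \<bullet> b) *\<^sub>R \<gamma> b (fst z)) has_derivative
        (\<lambda>w. (snd z \<bullet> b) *\<^sub>R \<gamma>2 b (fst z) (fst w) + (snd w \<bullet> b) *\<^sub>R \<gamma> b (fst z))) (at z)" .
  qed (intro fstd gf_deriv G_has_derivative)+
qed

text \<open>A continuous bound for the change of \<open>DF\<close> from its value at
  \<open>(xs, ys)\<close>. The factor 2 arises since each \<open>\<gamma> b\<close> occurs both in
  the gradient of the Lagrangian and in the Jacobian.\<close>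

definition EF :: "'a \<times> 'b \<Rightarrow> real" where
  "EF z = norm (f2 (fst z) - f2 xs)
     + (\<Sum>b\<in>Basis. norm ((snd z \<bullet> b) *\<^sub>R \<gamma>2 b (fst z) - (ys \<bullet> b) *\<^sub>R \<gamma>2 b xs) + 2 * norm (\<gamma> b (fst z) - \<gamma> b xs))"

lemma EF_cont: "isCont EF (xs, ys)" and EF_zero: "EF (xs, ys) = 0"
proof -
  have comp: "isCont (\<lambda>z. h (fst z)) (xs, ys)" if "isCont h xs" for h :: "'a \<Rightarrow> 'c::topological_space"
    using isCont_o2[where f = fst and a = "(xs, ys)" and g = h] that by simp
  have c1: "isCont (\<lambda>z. f2 (fst z)) (xs, ys)"
    by (rule comp) (use f2_cont in \<open>simp add: continuous_on_eq_continuous_at\<close>)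
  have c2: "isCont (\<lambda>z. \<gamma>2 b (fst z)) (xs, ys)" if "b \<in> Basis" for b
    by (rule comp) (use \<gamma>2_cont[OF that] in \<open>simp add: continuous_on_eq_continuous_at\<close>)
  have c3: "isCont (\<lambda>z. \<gamma> b (fst z)) (xs, ys)" if "b \<in> Basis" for b
    by (rule comp) (rule has_derivative_continuous[OF \<gamma>_deriv[OF that]])
  show "isCont EF (xs, ys)"
    unfolding EF_def[abs_def] by (intro continuous_intros c1 c2 c3)
qed (simp add: EF_def)

lemma EF_bound: "norm (DF z w - DF (xs, ys) w) \<le> EF z * norm w"
proof -
  have h: "norm (fst w) \<le> norm w" "norm (snd w) \<le> norm w"
    using norm_fst_le[of "fst w" "snd w"] norm_snd_le[of "snd w" "fst w"] by simp_all
  define a where "a b = norm ((snd z \<bullet> b) *\<^sub>R \<gamma>2 b (fst z) - (ys \<bullet> b) *\<^sub>R \<gamma>2 b xs)" for b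
  define c where "c b = norm (\<gamma> b (fst z) - \<gamma> b xs)" for b
  have "norm (fst (DF z w - DF (xs, ys) w)) \<le> norm ((f2 (fst z) - f2 xs) (fst w))
      + norm (\<Sum>b\<in>Basis. ((snd z \<bullet> b) *\<^sub>R \<gamma>2 b (fst z) - (ys \<bullet> b) *\<^sub>R \<gamma>2 b xs) (fst w) + (snd w \<bullet> b) *\<^sub>R (\<gamma> b (fst z) - \<gamma> b xs))"
  proof -
    have eq: "fst (DF z w - DF (xs, ys) w) = (f2 (fst z) - f2 xs) (fst w)
      - (\<Sum>b\<in>Basis. ((snd z \<bullet> b) *\<^sub>R \<gamma>2 b (fst z) - (ys \<bullet> b) *\<^sub>R \<gamma>2 b xs) (fst w) + (snd w \<bullet> b) *\<^sub>R (\<gamma> b (fst z) - \<gamma> b xs))"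
      by (simp add: DF_def blinfun.diff_left blinfun.scaleR_left scaleR_diff_right sum.distrib sum_subtractf)
    show ?thesis unfolding eq by (rule norm_triangle_ineq4)
  qed
  also have "\<dots> \<le> norm (f2 (fst z) - f2 xs) * norm w + (\<Sum>b\<in>Basis. (a b + c b) * norm w)"
  proof (rule add_mono)
    show "norm ((f2 (fst z) - f2 xs) (fst w)) \<le> norm (f2 (fst z) - f2 xs) * norm w"
      by (rule order_trans[OF norm_blinfun mult_left_mono[OF h(1) norm_ge_zero]])
    show "norm (\<Sum>b\<in>Basis. ((snd z \<bullet> b) *\<^sub>R \<gamma>2 b (fst z) - (ys \<bullet> b) *\<^sub>R \<gamma>2 b xs) (fst w) + (snd w \<bullet> b) *\<^sub>R (\<gamma> b (fst z) - \<gamma> b xs))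
        \<le> (\<Sum>b\<in>Basis. (a b + c b) * norm w)"
    proof (rule sum_norm_le)
      fix b :: 'b assume b: "b \<in> Basis"
      have "norm (((snd z \<bullet> b) *\<^sub>R \<gamma>2 b (fst z) - (ys \<bullet> b) *\<^sub>R \<gamma>2 b xs) (fst w)) \<le> a b * norm w"
        unfolding a_def by (rule order_trans[OF norm_blinfun mult_left_mono[OF h(1) norm_ge_zero]])
      moreover have "norm ((snd w \<bullet> b) *\<^sub>R (\<gamma> b (fst z) - \<gamma> b xs)) \<le> c b * norm w"
        using mult_right_mono[OF order_trans[OF Basis_le_norm[OF b, of "snd w"] h(2)] norm_ge_zero[of "\<gamma> b (fst z) - \<gamma> b xs"]]
        by (simp add: c_def mult.commute)
      ultimately show "norm (((snd z \<bullet> b) *\<^sub>R \<gamma>2 b (fst z) - (ys \<bullet> b) *\<^sub>R \<gamma>2 b xs) (fst w) + (snd w \<bullet> b) *\<^sub>R (\<gamma> b (fst z) - \<gamma> b xs))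
          \<le> (a b + c b) * norm w"
        unfolding distrib_right by (intro norm_triangle_le add_mono)
    qed
  qed
  finally have 1: "norm (fst (DF z w - DF (xs, ys) w)) \<le> norm (f2 (fst z) - f2 xs) * norm w + (\<Sum>b\<in>Basis. (a b + c b) * norm w)" .
  have 2: "norm (snd (DF z w - DF (xs, ys) w)) \<le> (\<Sum>b\<in>Basis. c b * norm w)"
  proof -
    have "snd (DF z w - DF (xs, ys) w) = (\<Sum>b\<in>Basis. ((\<gamma> b (fst z) - \<gamma> b xs) \<bullet> fst w) *\<^sub>R b)"
      by (simp add: DF_def Jac_def sum_subtractf inner_diff_left scaleR_diff_left)
    also have "norm \<dots> \<le> (\<Sum>b\<in>Basis. c b * norm w)"
    proof (rule sum_norm_le)
      fix b :: 'b assume "b \<in> Basis"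
      have "\<bar>(\<gamma> b (fst z) - \<gamma> b xs) \<bullet> fst w\<bar> \<le> c b * norm w"
        unfolding c_def by (rule order_trans[OF Cauchy_Schwarz_ineq2 mult_left_mono[OF h(1) norm_ge_zero]])
      then show "norm (((\<gamma> b (fst z) - \<gamma> b xs) \<bullet> fst w) *\<^sub>R b) \<le> c b * norm w"
        using \<open>b \<in> Basis\<close> by simp
    qed
    finally show ?thesis .
  qed
  have "norm (DF z w - DF (xs, ys) w) \<le> norm (fst (DF z w - DF (xs, ys) w)) + norm (snd (DF z w - DF (xs, ys) w))"
    using norm_Pair_le by (metis prod.collapse)
  also have "\<dots> \<le> norm (f2 (fst z) - f2 xs) * norm w + (\<Sum>b\<in>Basis. (a b + c b) * norm w) + (\<Sum>b\<in>Basis. c b * norm w)"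
    using 1 2 by simp
  also have "\<dots> = EF z * norm w"
  proof -
    have "(\<Sum>b\<in>Basis. (a b + c b) * norm w) + (\<Sum>b\<in>Basis. c b * norm w) = (\<Sum>b\<in>Basis. a b + 2 * c b) * norm w"
      unfolding sum.distrib[symmetric] sum_distrib_right by (intro sum.cong refl) (simp add: algebra_simps)
    then show ?thesis unfolding EF_def a_def[symmetric] c_def[symmetric] distrib_right[of "norm (f2 (fst z) - f2 xs)"] by linarith
  qed
  finally show ?thesis .
qed

lemma DF_base: "DF (xs, ys) w = (Hess (fst w) - Adj xs (snd w), Jac xs (fst w))"
  by (simp add: DF_def Hess_def Adj_def sum.distrib)

lemma strongly_regular_aubin:
  assumes kkt: "(xs, ys) \<in> KKT 0"
    and U: "(0, 0) \<in> interior U" and V: "(xs, ys) \<in> interior V"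
    and uniq: "\<forall>p\<in>U. \<exists>!z. z \<in> KKT_lin p \<inter> V"
    and lip: "locally_lipschitz_on U (\<lambda>p. THE z. z \<in> KKT_lin p \<inter> V)"
  shows "aubin_property KKT 0 (xs, ys)"
proof (rule aubin_of_linearization[where SL = KKT_lin and V = V and U = U
      and \<psi> = "\<lambda>z. F (xs, ys) + DF (xs, ys) (z - (xs, ys)) - F z"])
  note lin = has_derivative_linear[OF F_has_derivative[of "(xs, ys)"]]
  show "z \<in> KKT p \<longleftrightarrow> z \<in> KKT_lin (p + (F (xs, ys) + DF (xs, ys) (z - (xs, ys)) - F z))" for p z
    by (auto simp: KKT_def KKT_lin_def F_def DF_base algebra_simps)
  show "F (xs, ys) + DF (xs, ys) ((xs, ys) - (xs, ys)) - F (xs, ys) = 0"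
    using linear_0[OF lin] by (simp only: diff_self) simp
  show "(xs, ys) \<in> KKT_lin 0"
    using kkt linear_0[OF linear_Hess] linear_0[OF linear_Adj] linear_0[OF linear_Jac] by (simp add: KKT_def KKT_lin_def)
  show "\<exists>\<delta>>0. \<forall>z\<in>ball (xs, ys) \<delta>. \<forall>z'\<in>ball (xs, ys) \<delta>.
      norm (F (xs, ys) + DF (xs, ys) (z - (xs, ys)) - F z - (F (xs, ys) + DF (xs, ys) (z' - (xs, ys)) - F z')) \<le> \<eta> * norm (z - z')"
    if \<eta>: "0 < \<eta>" for \<eta>
  proof -
    obtain \<delta> where \<delta>: "0 < \<delta>" "\<And>z z'. z \<in> ball (xs, ys) \<delta> \<Longrightarrow> z' \<in> ball (xs, ys) \<delta> \<Longrightarrow>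
        norm (F z - F z' - DF (xs, ys) (z - z')) \<le> \<eta> * norm (z - z')"
      by (rule strict_derivative_bound[OF F_has_derivative EF_bound EF_cont EF_zero \<eta>]) (rule that; assumption)
    have "F (xs, ys) + DF (xs, ys) (z - (xs, ys)) - F z - (F (xs, ys) + DF (xs, ys) (z' - (xs, ys)) - F z')
        = - (F z - F z' - DF (xs, ys) (z - z'))" for z z'
      by (simp only: linear_diff[OF lin]) simp
    then show ?thesis using \<delta> by (intro exI[of _ \<delta>]) (simp only: norm_minus_cancel, blast)
  qed
qed (use U V uniq lip in \<open>simp_all add: zero_prod_def\<close>)

end

section \<open>Second-order cone programs\<close>

context smooth_system
begin

lemma aubin_iff_regular:
  assumes kkt: "(xs, ys) \<in> KKT 0" and locmin: "local_minimizer f feasible xs"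
  shows "aubin_property KKT 0 (xs, ys) \<longleftrightarrow>
    (\<exists>U V. (0, 0) \<in> interior U \<and> (xs, ys) \<in> interior V \<and> (\<forall>p\<in>U. \<exists>!z. z \<in> KKT_lin p \<inter> V) \<and>
       locally_lipschitz_on U (\<lambda>p. THE z. z \<in> KKT_lin p \<inter> V))" (is "?L \<longleftrightarrow> ?R")
proof
  assume ?L
  then interpret S: solvable_system I pr e Hess "Jac xs" "Adj xs" ys "G xs"
    using aubin_solvable_system kkt locmin by blast
  \<comment> \<open>The two linearized systems differ by the constant \<open>gL xs ys\<close>, which
    vanishes at a KKT point.\<close>
  have "S.lin_sol xs = KKT_lin"
    using kkt by (auto simp: fun_eq_iff S.lin_sol_def KKT_lin_def KKT_def)
  then show ?R using S.strongly_regular_linearization[of xs] by simp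
next
  assume ?R
  then show ?L using strongly_regular_aubin[OF kkt] by (elim exE conjE)
qed

end

section \<open>Gradients and Jacobians as vectors and matrices\<close>

lemma twice_cont_differentiable_gradient:
  fixes \<phi> :: "'a::euclidean_space \<Rightarrow> real"
  assumes "twice_cont_differentiable \<phi>"
  shows "\<exists>g g2. (\<forall>x. (\<phi> has_derivative (\<lambda>h. g x \<bullet> h)) (at x)) \<and>
    (\<forall>x. (g has_derivative blinfun_apply (g2 x)) (at x)) \<and> continuous_on UNIV (g2 :: 'a \<Rightarrow> 'a \<Rightarrow>\<^sub>L 'a)"
proof -
  obtain f' :: "'a \<Rightarrow> 'a \<Rightarrow>\<^sub>L real" and f'' :: "'a \<Rightarrow> 'a \<Rightarrow>\<^sub>L 'a \<Rightarrow>\<^sub>L real"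
    where f': "\<And>x. (\<phi> has_derivative blinfun_apply (f' x)) (at x)"
      and f'': "\<And>x. (f' has_derivative blinfun_apply (f'' x)) (at x)" and cont: "continuous_on UNIV f''"
    using assms unfolding twice_cont_differentiable_def by blast
  \<comment> \<open>The Riesz map from functionals to vectors. It is bounded linear, so it carries
    the second derivative of \<phi> to the derivative of the gradient.\<close>
  define t :: "('a \<Rightarrow>\<^sub>L real) \<Rightarrow> 'a" where "t l = (\<Sum>b\<in>Basis. blinfun_apply l b *\<^sub>R b)" for l
  have t: "bounded_linear t"
    unfolding t_def[abs_def]
    by (intro bounded_linear_sum bounded_linear_scaleR_const blinfun.bounded_linear_left)
  have t_inner: "t l \<bullet> h = l h" for l h
    unfolding t_def inner_sum_left
    by (subst (2) euclidean_representation[of h, symmetric])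
      (simp add: blinfun.sum_right blinfun.scaleR_right inner_commute mult.commute)
  define g g2 where "g x = t (f' x)" and "g2 x = Blinfun t o\<^sub>L f'' x" for x
  have "(\<phi> has_derivative (\<lambda>h. g x \<bullet> h)) (at x)" for x
    using f'[of x] by (simp add: g_def t_inner)
  moreover have "blinfun_apply (g2 x) = (\<lambda>h. t (f'' x h))" for x
    by (simp add: g2_def fun_eq_iff bounded_linear_Blinfun_apply[OF t])
  then have "(g has_derivative blinfun_apply (g2 x)) (at x)" for x
    using bounded_linear.has_derivative[OF t f''[of x]] by (simp add: g_def[abs_def])
  moreover have "continuous_on UNIV g2"
    unfolding g2_def[abs_def]
    by (intro bounded_bilinear.continuous_on[OF bounded_bilinear_blinfun_compose] continuous_on_const cont)
  ultimately show ?thesis by blast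
qed

lemma grad_eq:
  assumes "(\<phi> has_derivative (\<lambda>h. v \<bullet> h)) (at x)"
  shows "grad \<phi> x = v"
  unfolding grad_def
proof (rule the_equality)
  show "GDERIV \<phi> x :> v" unfolding gderiv_def using assms by (simp add: inner_commute)
  fix D assume "GDERIV \<phi> x :> D"
  then have "(\<lambda>h. h \<bullet> D) = (\<lambda>h. v \<bullet> h)"
    unfolding gderiv_def using assms has_derivative_unique by blast
  then have "(D - v) \<bullet> (D - v) = 0"
    by (metis cancel_comm_monoid_add_class.diff_cancel inner_commute inner_diff_left)
  then show "D = v" by simp
qed

lemma jacobian_apply:
  fixes F :: "real ^ 'n \<Rightarrow> real ^ 'm"
  assumes "(F has_derivative F') (at x)"
  shows "jacobian F (at x) *v h = F' h"
proof -
  have "F differentiable (at x)" using assms by (auto simp: differentiable_def)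
  then have "(F has_derivative (\<lambda>h. jacobian F (at x) *v h)) (at x)" by (simp add: jacobian_works)
  then show ?thesis using has_derivative_unique[OF _ assms] by metis
qed

lemma inner_transpose_mult: "x \<bullet> (transpose M *v y) = (M *v x) \<bullet> (y :: real ^ 'm)"
  by (metis dot_lmul_matrix inner_commute transpose_matrix_vector)

section \<open>The cone program as a system of blocks\<close>

definition block_proj :: "('k::finite \<Rightarrow> coord) \<Rightarrow> nat \<Rightarrow> real ^ 'k \<Rightarrow> real ^ 'k" where
  "block_proj lab j y = (\<chi> k. case lab k of Eq i \<Rightarrow> 0 | Cone j' i \<Rightarrow> if j' = j then y $ k else 0)"

definition block_unit :: "('k::finite \<Rightarrow> coord) \<Rightarrow> nat \<Rightarrow> real ^ 'k" where
  "block_unit lab j = axis (inv lab (Cone j 0)) 1"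

context
  fixes m J :: nat and r :: "nat \<Rightarrow> nat" and lab :: "'k::finite \<Rightarrow> coord"
  assumes bij: "bij_betw lab UNIV (coords m J r)"
begin

lemma lab_inv: "c \<in> coords m J r \<Longrightarrow> lab (inv lab c) = c"
  using bij by (metis bij_betw_imp_surj_on f_inv_into_f)

lemma inv_lab: "inv lab (lab k) = k"
  using bij by (simp add: bij_betw_def)

lemma lab_in: "lab k \<in> coords m J r"
  using bij by (auto simp: bij_betw_def)

lemma lab_Cone_inv: "j \<in> {1..J} \<Longrightarrow> i \<in> {0..r j} \<Longrightarrow> lab (inv lab (Cone j i)) = Cone j i"
  by (rule lab_inv) (auto simp: coords_def)

lemma lab_Eq_inv: "i \<in> {1..m} \<Longrightarrow> lab (inv lab (Eq i)) = Eq i"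
  by (rule lab_inv) (auto simp: coords_def)

lemma cone_blocks_lab: "cone_blocks {1..J} (block_proj lab) (block_unit lab)"
proof (intro cone_blocks.intro)
  fix i j :: nat and y z :: "real ^ 'k"
  assume j: "j \<in> {1..J}"
  show "linear (block_proj lab j)"
    by (rule linearI) (simp_all add: block_proj_def vec_eq_iff split: coord.split)
  show "block_proj lab j y \<bullet> z = y \<bullet> block_proj lab j z"
    unfolding inner_vec_def by (intro sum.cong refl) (simp add: block_proj_def split: coord.split)
  show "block_proj lab j (block_proj lab j y) = block_proj lab j y"
    by (simp add: block_proj_def vec_eq_iff split: coord.split)
  show "block_proj lab i (block_proj lab j y) = 0" if "i \<noteq> j"
    using that by (simp add: block_proj_def vec_eq_iff split: coord.split)
  show "block_proj lab j (block_unit lab j) = block_unit lab j"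
    using lab_Cone_inv[OF j, of 0] by (auto simp: block_proj_def block_unit_def vec_eq_iff axis_def split: coord.split)
  show "norm (block_unit lab j) = 1" by (simp add: block_unit_def)
qed simp

interpretation cone_blocks "{1..J}" "block_proj lab" "block_unit lab"
  by (rule cone_blocks_lab)

text \<open>The axis is the coordinate vector of the head, so removing the axial component of the
  block leaves a vector whose norm is the \<open>L2_set\<close> of the tail.\<close>

lemma block_proj_in_qcone:
  assumes j: "j \<in> {1..J}"
  shows "block_proj lab j y \<in> qcone (block_unit lab j) \<longleftrightarrow> cone_part lab y j \<in> soc (r j)"
proof -
  let ?e = "block_unit lab j" and ?p = "block_proj lab j y"
  have head: "?p \<bullet> ?e = cone_part lab y j 0"
    using lab_Cone_inv[OF j, of 0] by (simp add: block_unit_def block_proj_def inner_axis cone_part_def)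
  define u where "u = ?p - (?p \<bullet> ?e) *\<^sub>R ?e"
  have eq: "eq_part lab u i = 0" if "i \<in> {1..m}" for i
  proof -
    have "inv lab (Eq i) \<noteq> inv lab (Cone j 0)"
      using lab_Eq_inv[OF that] lab_Cone_inv[OF j, of 0] by (metis atLeastAtMost_iff coord.distinct(1) le0 order_refl)
    then show ?thesis
      using lab_Eq_inv[OF that] by (simp add: u_def eq_part_def block_proj_def block_unit_def axis_def)
  qed
  have co: "cone_part lab u j' i = (if j' = j \<and> i \<noteq> 0 then cone_part lab y j i else 0)"
    if "j' \<in> {1..J}" "i \<in> {0..r j'}" for j' i
  proof -
    have "inv lab (Cone j' i) = inv lab (Cone j 0) \<longleftrightarrow> j' = j \<and> i = 0"
      using lab_Cone_inv[OF that] lab_Cone_inv[OF j, of 0] by (metis atLeastAtMost_iff coord.inject(2) le0)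
    then show ?thesis
      using lab_Cone_inv[OF that] head by (auto simp: u_def cone_part_def block_proj_def block_unit_def axis_def)
  qed
  have "u \<bullet> u = (\<Sum>j'\<in>{1..J}. \<Sum>i\<in>{0..r j'}. cone_part lab u j' i * cone_part lab u j' i)"
    unfolding inner_coords[OF bij] using eq by simp
  also have "\<dots> = (\<Sum>j'\<in>{1..J}. if j' = j then (\<Sum>i\<in>{0..r j}. cone_part lab u j i * cone_part lab u j i) else 0)"
  proof (intro sum.cong refl)
    fix j' assume j': "j' \<in> {1..J}"
    show "(\<Sum>i\<in>{0..r j'}. cone_part lab u j' i * cone_part lab u j' i)
        = (if j' = j then (\<Sum>i\<in>{0..r j}. cone_part lab u j i * cone_part lab u j i) else 0)"
    proof (cases "j' = j")
      case False
      then have "(\<Sum>i\<in>{0..r j'}. cone_part lab u j' i * cone_part lab u j' i) = 0"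
        using co[OF j'] by (intro sum.neutral) simp
      then show ?thesis using False by simp
    qed simp
  qed
  also have "\<dots> = (\<Sum>i\<in>{0..r j}. cone_part lab u j i * cone_part lab u j i)" using j by simp
  also have "\<dots> = (\<Sum>i\<in>{1..r j}. cone_part lab u j i * cone_part lab u j i)"
    using co[OF j, of 0] by (simp add: sum.atLeast_Suc_atMost)
  also have "\<dots> = (\<Sum>i\<in>{1..r j}. (cone_part lab y j i)\<^sup>2)"
    using co[OF j] by (intro sum.cong refl) (simp add: power2_eq_square)
  finally have "norm u = L2_set (cone_part lab y j) {1..r j}"
    by (simp add: norm_eq_sqrt_inner L2_set_def)
  then show ?thesis
    unfolding qcone_iff[OF norm_unit[OF j]] u_def[symmetric] unfolding soc_def head by simp
qed

lemma C_eq_dual: "C = dual_cone (constraint_cone m J r lab)"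
  unfolding dual_constraint_cone[OF bij] C_def using block_proj_in_qcone by auto

lemma pr0_eq_zero_iff: "pr0 y = 0 \<longleftrightarrow> (\<forall>i\<in>{1..m}. eq_part lab y i = 0)"
proof -
  have p: "pr0 y $ k = (case lab k of Eq i \<Rightarrow> y $ k | Cone j i \<Rightarrow> 0)" for k
  proof (cases "lab k")
    case (Eq i)
    then show ?thesis unfolding pr0_def by (simp add: block_proj_def)
  next
    case (Cone j i)
    then have "j \<in> {1..J}" using lab_in[of k] by (auto simp: coords_def)
    then show ?thesis using Cone unfolding pr0_def by (simp add: block_proj_def)
  qed
  show ?thesis
  proof
    assume h: "pr0 y = 0"
    have "eq_part lab y i = 0" if "i \<in> {1..m}" for i
      using p[of "inv lab (Eq i)"] lab_Eq_inv[OF that] h by (simp add: eq_part_def)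
    then show "\<forall>i\<in>{1..m}. eq_part lab y i = 0" by blast
  next
    assume h: "\<forall>i\<in>{1..m}. eq_part lab y i = 0"
    have "pr0 y $ k = 0" for k
    proof (cases "lab k")
      case (Eq i)
      then have "i \<in> {1..m}" using lab_in[of k] by (auto simp: coords_def)
      then have "y $ k = 0" using h inv_lab[of k] Eq by (auto simp: eq_part_def)
      then show ?thesis using p[of k] Eq by simp
    qed (use p[of k] in simp)
    then show "pr0 y = 0" by (simp add: vec_eq_iff)
  qed
qed

lemma compl_iff_mem_normal_cone:
  "compl y (v - b) \<longleftrightarrow> b \<in> (+) v ` normal_cone (dual_cone (constraint_cone m J r lab)) y"
proof -
  have "b \<in> (+) v ` N \<longleftrightarrow> b - v \<in> N" for N by (metis add_diff_cancel_left' diff_add_cancel add.commute image_iff)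
  moreover have "b - v \<in> normal_cone C y \<longleftrightarrow> compl y (v - b)"
    unfolding compl_iff_normal normal_cone_def by (auto simp: inner_diff_left)
  ultimately show ?thesis unfolding C_eq_dual by blast
qed

lemma socp_aubin_iff:
  fixes f :: "real ^ 'n::finite \<Rightarrow> real" and h :: "real ^ 'n \<Rightarrow> nat \<Rightarrow> real"
    and g :: "nat \<Rightarrow> real ^ 'n \<Rightarrow> nat \<Rightarrow> real" and xs :: "real ^ 'n" and ys :: "real ^ 'k"
  defines "G \<equiv> constraint_map lab h g" and "D \<equiv> dual_cone (constraint_cone m J r lab)"
  assumes f: "twice_cont_differentiable f"
    and h: "\<And>i. i \<in> {1..m} \<Longrightarrow> twice_cont_differentiable (\<lambda>x. h x i)"
    and g: "\<And>j i. j \<in> {1..J} \<Longrightarrow> i \<in> {0..r j} \<Longrightarrow> twice_cont_differentiable (\<lambda>x. g j x i)"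
    and locmin: "local_minimizer f (socp_feasible m J r h g) xs"
    and kkt: "(xs, ys) \<in> S_KKT f G D (0, 0)"
  shows "aubin_property (S_KKT f G D) (0, 0) (xs, ys) \<longleftrightarrow> strongly_regular f G D xs ys"
proof -
  obtain gf f2 where gf: "\<And>x. (f has_derivative (\<lambda>h. gf x \<bullet> h)) (at x)"
      "\<And>x. (gf has_derivative blinfun_apply (f2 x)) (at x)" "continuous_on UNIV f2"
    using twice_cont_differentiable_gradient[OF f] by blast
  have "twice_cont_differentiable (\<lambda>x. G x \<bullet> b)" if bB: "b \<in> Basis" for b
  proof -
    obtain k where b: "b = axis k 1" using bB by (auto simp: Basis_vec_def)
    have "G x \<bullet> b = (case lab k of Eq i \<Rightarrow> h x i | Cone j i \<Rightarrow> g j x i)" for x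
      by (simp add: b G_def constraint_map_def inner_axis)
    then show ?thesis
      using lab_in[of k] h g by (cases "lab k") (auto simp: coords_def)
  qed
  then have "\<forall>b\<in>Basis. \<exists>\<gamma> \<gamma>2. (\<forall>x. ((\<lambda>x. G x \<bullet> b) has_derivative (\<lambda>h. \<gamma> x \<bullet> h)) (at x)) \<and>
      (\<forall>x. (\<gamma> has_derivative blinfun_apply (\<gamma>2 x)) (at x)) \<and> continuous_on UNIV (\<gamma>2 :: real ^ 'n \<Rightarrow> (real ^ 'n) \<Rightarrow>\<^sub>L (real ^ 'n))"
    by (intro ballI twice_cont_differentiable_gradient)
  then obtain \<gamma> where "\<forall>b\<in>Basis. \<exists>\<gamma>2. (\<forall>x. ((\<lambda>x. G x \<bullet> b) has_derivative (\<lambda>h. \<gamma> b x \<bullet> h)) (at x)) \<and>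
      (\<forall>x. (\<gamma> b has_derivative blinfun_apply (\<gamma>2 x)) (at x)) \<and> continuous_on UNIV (\<gamma>2 :: real ^ 'n \<Rightarrow> (real ^ 'n) \<Rightarrow>\<^sub>L (real ^ 'n))"
    by (rule bchoice[THEN exE])
  then obtain \<gamma>2 where \<gamma>: "\<forall>b\<in>Basis. (\<forall>x. ((\<lambda>x. G x \<bullet> b) has_derivative (\<lambda>h. \<gamma> b x \<bullet> h)) (at x)) \<and>
      (\<forall>x. (\<gamma> b has_derivative blinfun_apply (\<gamma>2 b x)) (at x)) \<and> continuous_on UNIV (\<gamma>2 b)"
    by (rule bchoice[THEN exE])
  interpret S: smooth_system "{1..J}" "block_proj lab" "block_unit lab" f gf f2 G \<gamma> \<gamma>2 xs ys
    by unfold_locales (use gf \<gamma> in auto)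
  have grad: "grad (\<lambda>x. lagrangian f G x y) = (\<lambda>x. S.gL x y)" for y
    unfolding lagrangian_def using grad_eq[OF S.lagrangian_has_derivative] by blast
  have "z \<in> S_KKT f G D p \<longleftrightarrow> z \<in> S.KKT p" for z p
    unfolding S.KKT_def S_KKT_def mem_Collect_eq compl_iff_mem_normal_cone D_def grad
    by (cases z; cases p) simp
  then have KKT: "S_KKT f G D = S.KKT" by blast
  have hess: "hessian (\<lambda>x. lagrangian f G x ys) xs *v v = S.Hess v" for v
    unfolding hessian_def grad by (rule jacobian_apply[OF S.gL_has_derivative])
  have jac: "jacobian G (at xs) *v v = S.Jac xs v" for v
    by (rule jacobian_apply[OF S.G_has_derivative])
  have adj: "transpose (jacobian G (at xs)) *v v = S.Adj xs v" for v
  proof -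
    have "u \<bullet> (transpose (jacobian G (at xs)) *v v - S.Adj xs v) = 0" for u
      unfolding inner_diff_right inner_transpose_mult jac S.Jac_Adj by simp
    then show ?thesis by (metis eq_iff_diff_eq_0 inner_eq_zero_iff)
  qed
  have "z \<in> S_linearized f G D xs ys p \<longleftrightarrow> z \<in> S.KKT_lin p" for z p
    unfolding S.KKT_lin_def S_linearized_def mem_Collect_eq compl_iff_mem_normal_cone D_def grad hess jac adj
    by (cases z; cases p) simp
  then have lin: "S_linearized f G D xs ys = S.KKT_lin" by blast
  have "x \<in> S.feasible \<longleftrightarrow> x \<in> socp_feasible m J r h g" for x
    unfolding S.feasible_def mem_Collect_eq socp_feasible_iff[OF bij] G_def[symmetric] constraint_cone_def pr0_eq_zero_iff
    by (auto simp: block_proj_in_qcone)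
  then have feas: "S.feasible = socp_feasible m J r h g" by blast
  show ?thesis
    unfolding strongly_regular_def lin KKT
    using S.aubin_iff_regular[OF kkt[unfolded KKT zero_prod_def[symmetric]] locmin[folded feas]]
    unfolding zero_prod_def .
qed

end

theorem theorem4p12:
  fixes m J :: nat and r :: "nat \<Rightarrow> nat"
    and lab :: "'k::finite \<Rightarrow> coord"
    and f :: "real ^ 'n::finite \<Rightarrow> real"
    and h :: "real ^ 'n \<Rightarrow> nat \<Rightarrow> real"
    and g :: "nat \<Rightarrow> real ^ 'n \<Rightarrow> nat \<Rightarrow> real"
    and xs :: "real ^ 'n" and ys :: "real ^ 'k"
  defines "G \<equiv> constraint_map lab h g"
    and "Kstar \<equiv> dual_cone (constraint_cone m J r lab)"
  assumes "bij_betw lab UNIV (coords m J r)"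
    and "twice_cont_differentiable f"
    and "\<And>i. i \<in> {1..m} \<Longrightarrow> twice_cont_differentiable (\<lambda>x. h x i)"
    and "\<And>j i. j \<in> {1..J} \<Longrightarrow> i \<in> {0..r j} \<Longrightarrow> twice_cont_differentiable (\<lambda>x. g j x i)"
    and "local_minimizer f (socp_feasible m J r h g) xs"
    and "(xs, ys) \<in> S_KKT f G Kstar (0, 0)"
  shows "aubin_property (S_KKT f G Kstar) (0, 0) (xs, ys)
    \<longleftrightarrow> strongly_regular f G Kstar xs ys"
  unfolding G_def Kstar_def
  by (rule socp_aubin_iff[OF assms(3-7)]) (assumption | rule assms(8)[unfolded G_def Kstar_def])+

end
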